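(* Let $(\mathcal{X},T)$ be a dynamical system with a metric $d$ such that $(\mathcal{X},d)$ has tame growth of covering numbers, and let $\mathcal{F}=\{\varphi_n\}_{n=1}^\infty$ be a sub-additive potential on $\mathcal{X}$. Assume that $\overline{\mathrm{mdim}}_M(\mathcal{X},T,d')<\infty$ for all $d'\in\mathcal{D}(\mathcal{X})$ and that there exists $K>0$ such that $|\varphi_{n+1}-\varphi_n|<K$ on $\mathcal{X}$ for every $n$. Then $$\mathrm{mdim}_H(\mathcal{X},T,d,\mathcal{F})\le\sup_{\mu\in\mathcal{M}(\mathcal{X},T)}\left(\underline{\mathrm{rdim}}(\mathcal{X},T,d,\mu)+\mathcal{F}_*(\mu)\right).$$
   Context: A dynamical system $(\mathcal{X},T)$ is a compact metrizable space $\mathcal{X}$ with a homeomorphism $T:\mathcal{X}\to\mathcal{X}$. $\mathcal{D}(\mathcal{X})$ is the set of metrics on $\mathcal{X}$ compatible with the topology; $\mathcal{M}(\mathcal{X},T)$ is the set of $T$-invariant Borel probability measures. For a metric $d$ and $N\ge1$, $d_N(x,y)=\max_{0\le n<N}d(T^nx,T^ny)$. Sub-additive potential: a sequence $\mathcal{F}=\{\varphi_n\}_{n\ge1}$ of continuous functions $\varphi_n:\mathcal{X}\to\mathbb{R}$ with $\varphi_{n+m}(x)\le\varphi_n(x)+\varphi_m(T^nx)$ for all $x\in\mathcal{X}$, $m,n\in\mathbb{N}$. $\mathcal{F}_*(\mu)=\lim_{n\to\infty}\frac1n\int\varphi_n\,d\mu\in[-\infty,\infty)$ (exists by subadditivity).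 Let $\#(\mathcal{X},d,\epsilon)$ be the minimum cardinality of an open cover of $\mathcal{X}$ by sets of $d$-diameter $<\epsilon$. $(\mathcal{X},d)$ has tame growth of covering numbers if for every $\delta>0$, $\lim_{\epsilon\to0}\epsilon^\delta\log\#(\mathcal{X},d,\epsilon)=0$. The upper metric mean dimension is $\overline{\mathrm{mdim}}_M(\mathcal{X},T,d)=\limsup_{\epsilon\to0}\frac{1}{\log(1/\epsilon)}\lim_{N\to\infty}\frac{\log\#(\mathcal{X},d_N,\epsilon)}{N}$. Mean Hausdorff dimension with potential: for continuous $\varphi:\mathcal{X}\to\mathbb{R}$, $\epsilon>0$ and $s\ge\max_{\mathcal{X}}\varphi$, $$H^s_\epsilon(\mathcal{X},d,\varphi)=\inf\Big\{\sum_{i=1}^\infty(\mathrm{diam}\,E_i)^{s-\sup_{E_i}\varphi} : \mathcal{X}=\bigcup_{i=1}^\infty E_i,\ \mathrm{diam}\,E_i<\epsilon\ \forall i\ge1\Big\},$$ with the conventions $0^0=1$ and that terms with $E_i=\emptyset$ are $0$. $\dim_H(\mathcal{X},d,\varphi,\epsilon)$ is the supremum of $s\ge\max_{\mathcal{X}}\varphi$ with $H^s_\epsilon(\mathcal{X},d,\varphi)\ge1$. Set $\mathrm{mdim}_H(\mathcal{X},T,d,\mathcal{F})=\lim_{\epsilon\to0}\left(\limsup_{N\to\infty}\frac{\dim_H(\mathcal{X},d_N,\varphi_N,\epsilon)}{N}\right)$. Rate distortion dimension: for random variables $X,Y$ taking values in measurable spaces, the mutual information $I(X;Y)$ is the supremum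 of $I(f\circ X;g\circ Y)$ over measurable maps $f,g$ with finite range, where for finite-valued variables $I(X;Y)=H(X)+H(Y)-H(X,Y)$ ($H$ = Shannon entropy). For $\mu\in\mathcal{M}(\mathcal{X},T)$ and $\epsilon>0$, $R_\mu(\epsilon)$ is the infimum of $I(X;Y)/n$ over all $n\in\mathbb{N}$ and all random variables $X$ and $Y=(Y_0,\dots,Y_{n-1})$ on some probability space such that $X$ takes values in $\mathcal{X}$ with law $\mu$, each $Y_k$ takes values in $\mathcal{X}$, and $\mathbb{E}\left(\frac1n\sum_{k=0}^{n-1}d(T^kX,Y_k)\right)<\epsilon$. Then $\underline{\mathrm{rdim}}(\mathcal{X},T,d,\mu)=\liminf_{\epsilon\to0}R_\mu(\epsilon)/\log(1/\epsilon)$. *)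

theory Defs
  imports "HOL-Probability.Probability"
begin

text \<open>
  The space \<open>\<X>\<close> is the whole of a type. All logarithms are natural, and entropies are taken to
  base \<open>e\<close>, so that the normalisation by \<open>log (1/\<epsilon>)\<close> uses the same base throughout.
\<close>

subsection \<open>Dynamical systems, metrics, potentials\<close>

definition compatible_metrics :: "('a::topological_space \<Rightarrow> 'a \<Rightarrow> real) set" where
  "compatible_metrics =
     {d. Metric_space UNIV d \<and> Metric_space.mtopology UNIV d = euclidean}"

definition dynamical_system :: "('a::topological_space \<Rightarrow> 'a) \<Rightarrow> bool" where
  "dynamical_system T \<longleftrightarrow> compact (UNIV :: 'a set) \<and>
     metrizable_space (euclidean :: 'a topology) \<and> (\<exists>S. homeomorphism UNIV UNIV T S)"

definition invariant_measures :: "('a::topological_space \<Rightarrow> 'a) \<Rightarrow> 'a measure set" where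
  "invariant_measures T = {\<mu>. prob_space \<mu> \<and> sets \<mu> = sets borel \<and> distr \<mu> borel T = \<mu>}"

text \<open>Only meaningful for \<open>N \<ge> 1\<close>.\<close>

definition orbit_metric ::
    "('a \<Rightarrow> 'a) \<Rightarrow> ('a \<Rightarrow> 'a \<Rightarrow> real) \<Rightarrow> nat \<Rightarrow> 'a \<Rightarrow> 'a \<Rightarrow> real" where
  "orbit_metric T d N x y = Max ((\<lambda>n. d ((T ^^ n) x) ((T ^^ n) y)) ` {..<N})"

text \<open>A potential is a sequence indexed by \<open>n \<ge> 1\<close>; the value at index \<open>0\<close> is unconstrained.\<close>

definition subadditive_potential ::
    "('a::topological_space \<Rightarrow> 'a) \<Rightarrow> (nat \<Rightarrow> 'a \<Rightarrow> real) \<Rightarrow> bool" where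
  "subadditive_potential T \<phi> \<longleftrightarrow> (\<forall>n\<ge>1. continuous_on UNIV (\<phi> n)) \<and>
     (\<forall>n\<ge>1. \<forall>m\<ge>1. \<forall>x. \<phi> (n + m) x \<le> \<phi> n x + \<phi> m ((T ^^ n) x))"

definition potential_mean :: "(nat \<Rightarrow> 'a \<Rightarrow> real) \<Rightarrow> 'a measure \<Rightarrow> ereal" where
  "potential_mean \<phi> \<mu> = lim (\<lambda>n. ereal ((\<integral>x. \<phi> n x \<partial>\<mu>) / real n))"


subsection \<open>Covering numbers and metric mean dimension\<close>

text \<open>The library's \<^const>\<open>diameter\<close> is tied to \<^const>\<open>dist\<close>; this is the same notion for an
  arbitrary metric.\<close>

definition diam_wrt :: "('a \<Rightarrow> 'a \<Rightarrow> real) \<Rightarrow> 'a set \<Rightarrow> real" where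
  "diam_wrt d E = (if E = {} then 0 else SUP (x, y)\<in>E \<times> E. d x y)"

definition cover_number :: "('a::topological_space \<Rightarrow> 'a \<Rightarrow> real) \<Rightarrow> real \<Rightarrow> nat" where
  "cover_number d \<epsilon> = (LEAST n. \<exists>\<U>. finite \<U> \<and> card \<U> = n \<and>
     (\<forall>U\<in>\<U>. open U \<and> diam_wrt d U < \<epsilon>) \<and> \<Union>\<U> = UNIV)"

definition tame_growth :: "('a::topological_space \<Rightarrow> 'a \<Rightarrow> real) \<Rightarrow> bool" where
  "tame_growth d \<longleftrightarrow> (\<forall>\<delta>>0.
     ((\<lambda>\<epsilon>. \<epsilon> powr \<delta> * ln (real (cover_number d \<epsilon>))) \<longlongrightarrow> 0) (at_right 0))"

definition upper_mdim_M ::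
    "('a::topological_space \<Rightarrow> 'a) \<Rightarrow> ('a \<Rightarrow> 'a \<Rightarrow> real) \<Rightarrow> ereal" where
  "upper_mdim_M T d = Limsup (at_right 0) (\<lambda>\<epsilon>. ereal (1 / ln (1 / \<epsilon>)) *
     lim (\<lambda>N. ereal (ln (real (cover_number (orbit_metric T d N) \<epsilon>)) / real N)))"


subsection \<open>Mean Hausdorff dimension with potential\<close>

text \<open>The summand \<open>(diam E)\<^bsup>s - sup\<^sub>E \<phi>\<^esup>\<close>, which is \<open>0\<close> for empty \<open>E\<close>. The case distinction on
  the exponent is needed because \<open>0 powr 0 = 0\<close> in the library, while \<open>0\<^sup>0 = 1\<close> is wanted here.\<close>

definition hausdorff_term ::
    "('a \<Rightarrow> 'a \<Rightarrow> real) \<Rightarrow> ('a \<Rightarrow> real) \<Rightarrow> real \<Rightarrow> 'a set \<Rightarrow> real" where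
  "hausdorff_term d \<phi> s E =
     (if E = {} then 0
      else if s - (SUP x\<in>E. \<phi> x) = 0 then 1
      else diam_wrt d E powr (s - (SUP x\<in>E. \<phi> x)))"

definition hausdorff_sum ::
    "('a \<Rightarrow> 'a \<Rightarrow> real) \<Rightarrow> ('a \<Rightarrow> real) \<Rightarrow> real \<Rightarrow> real \<Rightarrow> ennreal" where
  "hausdorff_sum d \<phi> \<epsilon> s =
     (INF E\<in>{E :: nat \<Rightarrow> 'a set. (\<Union>i. E i) = UNIV \<and> (\<forall>i. diam_wrt d (E i) < \<epsilon>)}.
        \<Sum>i. ennreal (hausdorff_term d \<phi> s (E i)))"

definition hausdorff_dim ::
    "('a \<Rightarrow> 'a \<Rightarrow> real) \<Rightarrow> ('a \<Rightarrow> real) \<Rightarrow> real \<Rightarrow> ereal" where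
  "hausdorff_dim d \<phi> \<epsilon> = (SUP s\<in>{s. s \<ge> (SUP x. \<phi> x) \<and> hausdorff_sum d \<phi> \<epsilon> s \<ge> 1}. ereal s)"

definition mdim_H ::
    "('a \<Rightarrow> 'a) \<Rightarrow> ('a \<Rightarrow> 'a \<Rightarrow> real) \<Rightarrow> (nat \<Rightarrow> 'a \<Rightarrow> real) \<Rightarrow> ereal" where
  "mdim_H T d \<phi> = Lim (at_right 0)
     (\<lambda>\<epsilon>::real. limsup (\<lambda>N. hausdorff_dim (orbit_metric T d N) (\<phi> N) \<epsilon> / ereal (real N)))"


subsection \<open>Mutual information and rate distortion dimension\<close>

definition shannon_entropy :: "'w measure \<Rightarrow> ('w \<Rightarrow> 'b) \<Rightarrow> real" where
  "shannon_entropy P U = prob_space.entropy P (exp 1) (count_space (U ` space P)) U"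

text \<open>The finite alphabets are coded as finite sets of natural numbers.\<close>

definition mutual_info ::
    "'w measure \<Rightarrow> 'x measure \<Rightarrow> 'y measure \<Rightarrow> ('w \<Rightarrow> 'x) \<Rightarrow> ('w \<Rightarrow> 'y) \<Rightarrow> ereal" where
  "mutual_info P S R X Y =
     (SUP (f, g)\<in>{f :: 'x \<Rightarrow> nat. f \<in> S \<rightarrow>\<^sub>M count_space UNIV \<and> finite (f ` space S)} \<times>
                 {g :: 'y \<Rightarrow> nat. g \<in> R \<rightarrow>\<^sub>M count_space UNIV \<and> finite (g ` space R)}.
        ereal (shannon_entropy P (\<lambda>\<omega>. f (X \<omega>)) + shannon_entropy P (\<lambda>\<omega>. g (Y \<omega>))
             - shannon_entropy P (\<lambda>\<omega>. (f (X \<omega>), g (Y \<omega>)))))"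

text \<open>For a compact space and a compatible \<open>d\<close> the integrand below is bounded and measurable, so
  the Bochner integral is the expectation.\<close>

definition distortion_admissible ::
    "('a::topological_space \<Rightarrow> 'a) \<Rightarrow> ('a \<Rightarrow> 'a \<Rightarrow> real) \<Rightarrow> 'a measure \<Rightarrow> real \<Rightarrow> nat \<Rightarrow>
     'w measure \<Rightarrow> ('w \<Rightarrow> 'a) \<Rightarrow> (nat \<Rightarrow> 'w \<Rightarrow> 'a) \<Rightarrow> bool" where
  "distortion_admissible T d \<mu> \<epsilon> n P X Y \<longleftrightarrow>
     n \<ge> 1 \<and> prob_space P \<and> X \<in> P \<rightarrow>\<^sub>M borel \<and> distr P borel X = \<mu> \<and>
     (\<forall>k<n. Y k \<in> P \<rightarrow>\<^sub>M borel) \<and>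
     (\<integral>\<omega>. (1 / real n) * (\<Sum>k<n. d ((T ^^ k) (X \<omega>)) (Y k \<omega>)) \<partial>P) < \<epsilon>"

definition process_rate ::
    "nat \<Rightarrow> 'w measure \<Rightarrow> ('w \<Rightarrow> 'a::topological_space) \<Rightarrow> (nat \<Rightarrow> 'w \<Rightarrow> 'a) \<Rightarrow> ereal" where
  "process_rate n P X Y =
     mutual_info P borel (Pi\<^sub>M {..<n} (\<lambda>_. borel)) X (\<lambda>\<omega>. \<lambda>k\<in>{..<n}. Y k \<omega>) / ereal (real n)"

text \<open>
  A definition cannot quantify over the type of the sample space, so the sample spaces range over
  all probability measures (with any \<open>\<sigma>\<close>-algebra) on the one type \<open>'a \<times> (nat \<Rightarrow> 'a)\<close>. This type
  carries every joint law of \<open>(X, Y)\<close>; the theorem \<open>rate_distortion_le\<close> below shows that random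
  variables on any other type do not lower the infimum. Its measurability hypotheses hold for
  every dynamical system and compatible \<open>d\<close>, since \<open>\<X>\<close> is then second countable.
\<close>

definition rate_distortion ::
    "('a::topological_space \<Rightarrow> 'a) \<Rightarrow> ('a \<Rightarrow> 'a \<Rightarrow> real) \<Rightarrow> 'a measure \<Rightarrow> real \<Rightarrow> ereal" where
  "rate_distortion T d \<mu> \<epsilon> = Inf {process_rate n P X Y | n (P :: ('a \<times> (nat \<Rightarrow> 'a)) measure) X Y.
     distortion_admissible T d \<mu> \<epsilon> n P X Y}"

definition lower_rdim ::
    "('a::topological_space \<Rightarrow> 'a) \<Rightarrow> ('a \<Rightarrow> 'a \<Rightarrow> real) \<Rightarrow> 'a measure \<Rightarrow> ereal" where
  "lower_rdim T d \<mu> = Liminf (at_right 0) (\<lambda>\<epsilon>. rate_distortion T d \<mu> \<epsilon> / ereal (ln (1 / \<epsilon>)))"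


subsection \<open>Independence of the sample space\<close>

lemma shannon_entropy_eq:
  assumes "prob_space P" and U: "U \<in> P \<rightarrow>\<^sub>M count_space UNIV" and fin: "finite A"
    and sub: "U ` space P \<subseteq> A"
  shows "shannon_entropy P U =
    - (\<Sum>u\<in>A. measure (distr P (count_space UNIV) U) {u} * ln (measure (distr P (count_space UNIV) U) {u}))"
proof -
  interpret prob_space P by fact
  interpret information_space P "exp 1" by unfold_locales simp
  have m: "measure (distr P (count_space UNIV) U) {u} = measure P (U -` {u} \<inter> space P)" for u
    by (rule measure_distr[OF U]) simp
  have "simple_function P U"
    unfolding simple_function_def using U fin sub
    by (auto intro: finite_subset measurable_sets)
  then have "simple_distributed P U (\<lambda>u. measure P (U -` {u} \<inter> space P))"
    by (rule simple_distributedI) auto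
  from entropy_simple_distributed[OF this]
  have "shannon_entropy P U =
      - (\<Sum>u\<in>U ` space P. measure P (U -` {u} \<inter> space P) * ln (measure P (U -` {u} \<inter> space P)))"
    by (simp add: shannon_entropy_def log_def)
  also have "(\<Sum>u\<in>U ` space P. measure P (U -` {u} \<inter> space P) * ln (measure P (U -` {u} \<inter> space P)))
      = (\<Sum>u\<in>A. measure P (U -` {u} \<inter> space P) * ln (measure P (U -` {u} \<inter> space P)))"
  proof (rule sum.mono_neutral_left[OF fin sub], safe)
    fix u assume "u \<notin> U ` space P"
    then have "U -` {u} \<inter> space P = {}" by auto
    then show "measure P (U -` {u} \<inter> space P) * ln (measure P (U -` {u} \<inter> space P)) = 0"
      by simp
  qed
  finally show ?thesis by (simp add: m)
qed

lemma shannon_entropy_distr: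
  assumes P: "prob_space P" and h: "h \<in> P \<rightarrow>\<^sub>M N" and U: "U \<in> N \<rightarrow>\<^sub>M count_space UNIV"
    and fin: "finite (U ` space N)"
  shows "shannon_entropy (distr P N h) U = shannon_entropy P (\<lambda>\<omega>. U (h \<omega>))"
proof -
  have Uh: "(\<lambda>\<omega>. U (h \<omega>)) \<in> P \<rightarrow>\<^sub>M count_space UNIV"
    using h U by (rule measurable_compose)
  have 1: "distr (distr P N h) (count_space UNIV) U = distr P (count_space UNIV) (\<lambda>\<omega>. U (h \<omega>))"
    using distr_distr[OF U h] by (simp add: comp_def)
  have sub: "(\<lambda>\<omega>. U (h \<omega>)) ` space P \<subseteq> U ` space N"
    using measurable_space[OF h] by auto
  show ?thesis
    using shannon_entropy_eq[OF prob_space.prob_space_distr[OF P h], of U "U ` space N"]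
      shannon_entropy_eq[OF P Uh fin sub] U fin
    by (simp add: 1)
qed

lemma mutual_info_distr:
  assumes P: "prob_space P" and h: "h \<in> P \<rightarrow>\<^sub>M N" and X: "X \<in> N \<rightarrow>\<^sub>M S" and Y: "Y \<in> N \<rightarrow>\<^sub>M R"
  shows "mutual_info (distr P N h) S R X Y = mutual_info P S R (\<lambda>\<omega>. X (h \<omega>)) (\<lambda>\<omega>. Y (h \<omega>))"
  unfolding mutual_info_def
proof (rule SUP_cong[OF refl], clarsimp)
  fix f :: "_ \<Rightarrow> nat" and g :: "_ \<Rightarrow> nat"
  assume f: "f \<in> S \<rightarrow>\<^sub>M count_space UNIV" "finite (f ` space S)"
    and g: "g \<in> R \<rightarrow>\<^sub>M count_space UNIV" "finite (g ` space R)"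
  have fX: "(\<lambda>\<omega>. f (X \<omega>)) \<in> N \<rightarrow>\<^sub>M count_space UNIV"
    using X f(1) by (rule measurable_compose)
  have gY: "(\<lambda>\<omega>. g (Y \<omega>)) \<in> N \<rightarrow>\<^sub>M count_space UNIV"
    using Y g(1) by (rule measurable_compose)
  have fgXY: "(\<lambda>\<omega>. (f (X \<omega>), g (Y \<omega>))) \<in> N \<rightarrow>\<^sub>M count_space UNIV"
    using measurable_Pair[OF fX gY] by (simp add: pair_measure_countable)
  have finf: "finite ((\<lambda>\<omega>. f (X \<omega>)) ` space N)"
    by (rule finite_subset[OF _ f(2)]) (use measurable_space[OF X] in auto)
  have fing: "finite ((\<lambda>\<omega>. g (Y \<omega>)) ` space N)"
    by (rule finite_subset[OF _ g(2)]) (use measurable_space[OF Y] in auto)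
  have finfg: "finite ((\<lambda>\<omega>. (f (X \<omega>), g (Y \<omega>))) ` space N)"
    by (rule finite_subset[OF _ finite_cartesian_product[OF finf fing]]) auto
  show "shannon_entropy (distr P N h) (\<lambda>\<omega>. f (X \<omega>)) + shannon_entropy (distr P N h) (\<lambda>\<omega>. g (Y \<omega>))
        - shannon_entropy (distr P N h) (\<lambda>\<omega>. (f (X \<omega>), g (Y \<omega>)))
      = shannon_entropy P (\<lambda>\<omega>. f (X (h \<omega>))) + shannon_entropy P (\<lambda>\<omega>. g (Y (h \<omega>)))
        - shannon_entropy P (\<lambda>\<omega>. (f (X (h \<omega>)), g (Y (h \<omega>))))"
    using shannon_entropy_distr[OF P h fX finf] shannon_entropy_distr[OF P h gY fing]
      shannon_entropy_distr[OF P h fgXY finfg] by simp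
qed

theorem rate_distortion_le:
  fixes T :: "'a::topological_space \<Rightarrow> 'a" and P :: "'w measure"
  assumes T: "T \<in> borel \<rightarrow>\<^sub>M borel"
    and d: "(\<lambda>(x, y). d x y) \<in> borel_measurable (borel \<Otimes>\<^sub>M borel)"
    and adm: "distortion_admissible T d \<mu> \<epsilon> n P X Y"
  shows "rate_distortion T d \<mu> \<epsilon> \<le> process_rate n P X Y"
proof -
  from adm have n: "n \<ge> 1" and P: "prob_space P" and X: "X \<in> P \<rightarrow>\<^sub>M borel"
    and law: "distr P borel X = \<mu>" and Y: "\<And>k. k < n \<Longrightarrow> Y k \<in> P \<rightarrow>\<^sub>M borel"
    and E: "(\<integral>\<omega>. (1 / real n) * (\<Sum>k<n. d ((T ^^ k) (X \<omega>)) (Y k \<omega>)) \<partial>P) < \<epsilon>"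
    by (auto simp: distortion_admissible_def)
  define R :: "(nat \<Rightarrow> 'a) measure" where "R = Pi\<^sub>M {..<n} (\<lambda>_. borel)"
  define N :: "('a \<times> (nat \<Rightarrow> 'a)) measure" where "N = borel \<Otimes>\<^sub>M R"
  define h where "h = (\<lambda>\<omega>. (X \<omega>, \<lambda>k\<in>{..<n}. Y k \<omega>))"
  define Y' :: "nat \<Rightarrow> 'a \<times> (nat \<Rightarrow> 'a) \<Rightarrow> 'a" where "Y' = (\<lambda>k p. snd p k)"
  have Yr: "(\<lambda>\<omega>. \<lambda>k\<in>{..<n}. Y k \<omega>) \<in> P \<rightarrow>\<^sub>M R"
    unfolding R_def by (rule measurable_restrict) (use Y in auto)
  have h: "h \<in> P \<rightarrow>\<^sub>M N"
    unfolding h_def N_def using X Yr by (rule measurable_Pair)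
  have X': "fst \<in> N \<rightarrow>\<^sub>M borel"
    unfolding N_def by (rule measurable_fst)
  have snd: "snd \<in> N \<rightarrow>\<^sub>M R"
    unfolding N_def by (rule measurable_snd)
  have Y': "Y' k \<in> N \<rightarrow>\<^sub>M borel" if "k < n" for k
    unfolding Y'_def
    by (rule measurable_compose[OF snd]) (use that in \<open>auto simp: R_def intro: measurable_component_singleton\<close>)
  have Tk: "T ^^ k \<in> borel \<rightarrow>\<^sub>M borel" for k
  proof (induction k)
    case (Suc k)
    from measurable_comp[OF this T] show ?case by (simp add: comp_def)
  qed (simp add: id_def)
  have integrand: "(\<lambda>p. (1 / real n) * (\<Sum>k<n. d ((T ^^ k) (fst p)) (Y' k p))) \<in> borel_measurable N"
  proof (intro borel_measurable_times borel_measurable_const borel_measurable_sum)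
    fix k assume "k \<in> {..<n}"
    then have "(\<lambda>p. ((T ^^ k) (fst p), Y' k p)) \<in> N \<rightarrow>\<^sub>M borel \<Otimes>\<^sub>M borel"
      using Y' by (intro measurable_Pair measurable_compose[OF X' Tk]) auto
    from measurable_compose[OF this d]
    show "(\<lambda>p. d ((T ^^ k) (fst p)) (Y' k p)) \<in> borel_measurable N" by simp
  qed
  have Y'h: "Y' k (h \<omega>) = Y k \<omega>" if "k < n" for k \<omega>
    using that by (simp add: Y'_def h_def)
  have "distr (distr P N h) borel fst = \<mu>"
    using distr_distr[OF X' h] law by (simp add: comp_def h_def)
  moreover have "(\<integral>p. (1 / real n) * (\<Sum>k<n. d ((T ^^ k) (fst p)) (Y' k p)) \<partial>distr P N h) < \<epsilon>"
    unfolding integral_distr[OF h integrand] using E by (simp add: Y'h) (simp add: h_def)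
  ultimately have "distortion_admissible T d \<mu> \<epsilon> n (distr P N h) fst Y'"
    using n X' Y' prob_space.prob_space_distr[OF P h] by (simp add: distortion_admissible_def)
  then have "rate_distortion T d \<mu> \<epsilon> \<le> process_rate n (distr P N h) fst Y'"
    unfolding rate_distortion_def by (intro Inf_lower) blast
  also have "\<dots> = process_rate n P X Y"
  proof -
    have "(\<lambda>p. \<lambda>k\<in>{..<n}. Y' k p) \<in> N \<rightarrow>\<^sub>M R"
      unfolding R_def by (rule measurable_restrict) (use Y' in auto)
    from mutual_info_distr[OF P h X' this]
    have "mutual_info (distr P N h) borel R fst (\<lambda>p. \<lambda>k\<in>{..<n}. Y' k p)
        = mutual_info P borel R X (\<lambda>\<omega>. \<lambda>k\<in>{..<n}. Y k \<omega>)"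
      by (simp add: Y'h cong: restrict_cong) (simp add: h_def)
    then show ?thesis by (simp add: process_rate_def R_def)
  qed
  finally show ?thesis .
qed

end

theory Submission
  imports Defs
begin

text \<open>
  For every \<open>s\<close> below the mean Hausdorff dimension an invariant measure \<open>\<mu>\<close> is constructed whose
  rate distortion dimension and mean potential add up to almost \<open>s\<close>.

  \<^bold>\<open>Removing the potential.\<close> Fix a scale at which the Hausdorff dimension of \<open>(\<X>, d\<^sub>N, \<phi>\<^sub>N)\<close>
  exceeds \<open>s N\<close> for infinitely many \<open>N\<close>. Bounded increments of the potential give
  \<open>\<bar>\<phi>\<^sub>N\<bar> \<le> C N\<close>, so \<open>\<X>\<close> is a union of boundedly many sets on which \<open>\<phi>\<^sub>N / N\<close> varies by at most
  \<open>\<delta>\<close>. One level \<open>c\<close> occurs for infinitely many \<open>N\<close> with a level set whose ordinary Hausdorff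
  content in dimension \<open>t N\<close>, \<open>t = max 0 (s - c - \<delta>)\<close>, is bounded below (\<open>hausdorff_sum_level_set\<close>).

  \<^bold>\<open>The measure.\<close> A finite form of Frostman's lemma (\<open>finite_Frostman\<close>) yields a finitely supported
  probability \<open>\<nu>\<^sub>N\<close> on this level set that gives a set of \<open>d\<^sub>N\<close>-diameter at most \<open>\<rho>\<close> a mass
  of at most \<open>m (A \<rho>)\<^bsup>t N\<^esup>\<close>, for all \<open>\<rho>\<close> above a scale that tends to \<open>0\<close> with \<open>N\<close>. Let \<open>\<mu>\<close> be a weak limit of the orbit averages of \<open>\<nu>\<^sub>N\<close>
  (\<open>invariant_weak_limit\<close>). By subadditivity \<open>\<phi>\<^sub>N\<close> is at most the Birkhoff sum of \<open>\<phi>\<^sub>n / n\<close>, up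
  to a bounded error, and hence the mean potential of \<open>\<mu>\<close> is at least \<open>c\<close> (\<open>potential_mean_ge\<close>).

  \<^bold>\<open>The rate.\<close> Let \<open>Y\<close> reproduce \<open>X, T X, \<dots>, T\<^bsup>n-1\<^esup> X\<close> with mean distortion below \<open>\<epsilon>\<close>, and
  discretise both at scale \<open>\<epsilon>\<close>. With \<open>q\<close> the law of the discretised \<open>Y\<close>, the Gibbs inequality
  bounds the mutual information from below by the integral of the free energy
  \<open>G x = - ln (\<Sum>v. q v * exp (- (\<Sum>k<n. d (T\<^bsup>k\<^esup> x) (y v k)) / \<epsilon>))\<close>, up to \<open>4 n\<close>
  (\<open>information_ge_free_energy\<close>). In this form the
  joint law has disappeared: the bound is the integral of one continuous function, which passes to
  the weak limit. Along an orbit segment of \<open>\<nu>\<^sub>N\<close> the free energies of consecutive blocks add up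
  to the free energy of the product law, and Jensen's inequality leaves the partition function
  \<open>\<integral> exp (- (\<Sum>k<N. d (T\<^bsup>k\<^esup> x) (y k)) / \<epsilon>) d\<nu>\<^sub>N\<close> to be bounded uniformly in \<open>y\<close>
  (\<open>exp_average_le\<close>). Let \<open>L\<close> be the logarithm of the covering number at scale \<open>\<epsilon>\<close>, or \<open>1\<close> if that is larger. Each factor
  is at most the indicator of a ball of radius \<open>L \<epsilon>\<close> plus \<open>exp (- L)\<close> times the indicators of
  the covering sets. Expanding the product gives total weight at most \<open>2\<^bsup>N\<^esup>\<close>, each
  term being the mass of a set of \<open>d\<^sub>N\<close>-diameter at most \<open>2 L \<epsilon>\<close>. Hence the rate at \<open>\<epsilon>\<close> is at
  least \<open>t ln (1 / (L \<epsilon>))\<close> minus a constant, and tame growth makes \<open>ln L\<close> negligible against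
  \<open>ln (1 / \<epsilon>)\<close>. So the rate distortion dimension of \<open>\<mu>\<close> is at least \<open>t\<close>, and \<open>t + c \<ge> s - \<delta>\<close>.
\<close>

section \<open>Frostman measures on finite nets\<close>

text \<open>
  A greedy substitute for linear programming duality. Process the points one after the other and give
  each the largest mass that violates no constraint: some constraint through the point becomes tight,
  and it stays tight because masses are never taken back. Such a measure is maximal pointwise and
  need not have maximal total mass; tight sets through every point are all that Frostman's lemma needs.
\<close>

lemma exists_saturated_weights:
  fixes S :: "'b \<Rightarrow> 'a set" and w :: "'b \<Rightarrow> real"
  assumes "finite F" and B: "finite B" and w: "\<And>b. b \<in> B \<Longrightarrow> 0 \<le> w b"
    and "F \<subseteq> (\<Union>b\<in>B. S b)"
  shows "\<exists>\<nu> :: 'a \<Rightarrow> real. (\<forall>x. 0 \<le> \<nu> x) \<and> (\<forall>b\<in>B. (\<Sum>x\<in>F \<inter> S b. \<nu> x) \<le> w b) \<and>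
    (\<forall>x\<in>F. \<exists>b\<in>B. x \<in> S b \<and> (\<Sum>y\<in>F \<inter> S b. \<nu> y) = w b)"
  using assms(1,4)
proof (induction F rule: finite_induct)
  case empty
  then show ?case using w by (intro exI[of _ "\<lambda>_. 0"]) auto
next
  case (insert x F)
  from insert.prems have "F \<subseteq> (\<Union>b\<in>B. S b)" by simp
  from insert.IH[OF this] obtain \<nu> :: "'a \<Rightarrow> real" where pos: "\<And>x. 0 \<le> \<nu> x"
    and le: "\<And>b. b \<in> B \<Longrightarrow> (\<Sum>x\<in>F \<inter> S b. \<nu> x) \<le> w b"
    and tight: "\<And>x. x \<in> F \<Longrightarrow> \<exists>b\<in>B. x \<in> S b \<and> (\<Sum>y\<in>F \<inter> S b. \<nu> y) = w b"
    by blast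
  define slack where "slack b = w b - (\<Sum>x\<in>F \<inter> S b. \<nu> x)" for b
  define Bx where "Bx = {b\<in>B. x \<in> S b}"
  have Bx: "finite Bx" "Bx \<noteq> {}" using insert.prems B by (auto simp: Bx_def)
  define v where "v = Min (slack ` Bx)"
  have v_le: "v \<le> slack b" if "b \<in> Bx" for b using Bx that by (auto simp: v_def)
  obtain b0 where b0: "b0 \<in> Bx" "slack b0 = v"
    using Min_in[of "slack ` Bx"] Bx unfolding v_def by (simp add: image_iff) metis
  have v0: "0 \<le> v" using b0 le[of b0] by (auto simp: Bx_def slack_def)
  have sum_eq: "(\<Sum>y\<in>insert x F \<inter> S b. (\<nu>(x := v)) y)
      = (\<Sum>y\<in>F \<inter> S b. \<nu> y) + (if x \<in> S b then v else 0)" for b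
  proof -
    have "(\<Sum>y\<in>F \<inter> S b. (\<nu>(x := v)) y) = (\<Sum>y\<in>F \<inter> S b. \<nu> y)"
      using insert.hyps by (intro sum.cong) auto
    then show ?thesis using insert.hyps by (auto simp: Int_insert_left)
  qed
  have le': "(\<Sum>y\<in>insert x F \<inter> S b. (\<nu>(x := v)) y) \<le> w b" if "b \<in> B" for b
    using v_le[of b] le[OF that] that unfolding sum_eq by (auto simp: Bx_def slack_def)
  have "\<exists>b\<in>B. z \<in> S b \<and> (\<Sum>y\<in>insert x F \<inter> S b. (\<nu>(x := v)) y) = w b" if "z \<in> insert x F" for z
  proof (cases "z = x")
    case True
    have "(\<Sum>y\<in>insert x F \<inter> S b0. (\<nu>(x := v)) y) = w b0"
      using b0 unfolding sum_eq by (auto simp: Bx_def slack_def)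
    then show ?thesis using True b0 by (auto simp: Bx_def)
  next
    case False
    then have "z \<in> F" using that by simp
    then obtain b where b: "b \<in> B" "z \<in> S b" "(\<Sum>y\<in>F \<inter> S b. \<nu> y) = w b"
      using tight by blast
    have "(\<Sum>y\<in>insert x F \<inter> S b. (\<nu>(x := v)) y) = w b"
      using le'[OF b(1)] b v0 unfolding sum_eq by (auto split: if_splits)
    then show ?thesis using b by blast
  qed
  then show ?case using pos v0 le' by (intro exI[of _ "\<nu>(x := v)"]) auto
qed

text \<open>
  Vitali's selection: take a largest ball, discard the balls that it meets, and repeat.
\<close>

lemma Vitali_finite_subfamily:
  fixes D :: "'a \<Rightarrow> 'a \<Rightarrow> real" and c :: "'b \<Rightarrow> 'a" and r :: "'b \<Rightarrow> real"
  assumes sym: "\<And>x y. D x y = D y x" and D0: "\<And>x. D x x = 0"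
    and "finite B" and r: "\<And>b. b \<in> B \<Longrightarrow> 0 \<le> r b"
  shows "\<exists>B'\<subseteq>B. (\<forall>b\<in>B'. \<forall>b'\<in>B'. b \<noteq> b' \<longrightarrow> r b + r b' < D (c b) (c b')) \<and>
    (\<forall>b\<in>B. \<exists>b'\<in>B'. r b \<le> r b' \<and> D (c b) (c b') \<le> r b + r b')"
  using assms(3,4)
proof (induction B rule: finite_psubset_induct)
  case (psubset B)
  show ?case
  proof (cases "B = {}")
    case False
    obtain b0 where b0: "b0 \<in> B" "\<And>b. b \<in> B \<Longrightarrow> r b \<le> r b0"
      using Max_in[of "r ` B"] Max_ge[of "r ` B"] False psubset.hyps
      by (metis (no_types, lifting) finite_imageI image_iff image_is_empty)
    define R where "R = {b\<in>B. r b + r b0 < D (c b) (c b0)}"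
    have "b0 \<notin> R" using b0 psubset.prems[of b0] by (simp add: R_def D0)
    then have "R \<subset> B" using b0(1) unfolding R_def by blast
    from psubset.IH[OF this] psubset.prems obtain B' where B': "B' \<subseteq> R"
      "\<forall>b\<in>B'. \<forall>b'\<in>B'. b \<noteq> b' \<longrightarrow> r b + r b' < D (c b) (c b')"
      "\<forall>b\<in>R. \<exists>b'\<in>B'. r b \<le> r b' \<and> D (c b) (c b') \<le> r b + r b'"
      by (auto simp: R_def)
    show ?thesis
    proof (intro exI[of _ "insert b0 B'"] conjI ballI impI)
      show "insert b0 B' \<subseteq> B" using B' b0 by (auto simp: R_def)
    next
      fix b b' assume "b \<in> insert b0 B'" "b' \<in> insert b0 B'" "b \<noteq> b'"
      then show "r b + r b' < D (c b) (c b')"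
        using B'(1,2) sym[of "c b0"] by (auto simp: R_def add.commute subset_iff)
    next
      fix b assume b: "b \<in> B"
      show "\<exists>b'\<in>insert b0 B'. r b \<le> r b' \<and> D (c b) (c b') \<le> r b + r b'"
      proof (cases "b \<in> R")
        case True
        then show ?thesis using B'(3) by auto
      next
        case False
        then show ?thesis using b b0 by (intro bexI[of _ b0]) (auto simp: R_def)
      qed
    qed
  qed auto
qed

text \<open>
  Take saturated weights for the constraints \<open>\<nu>(B(p, r)) \<le> r\<^sup>s\<close>, with \<open>p\<close> in the net and \<open>r\<close> in the
  dyadic scales from \<open>\<tau>\<close> to \<open>\<epsilon> / 16\<close>. The tight balls cover the net; a Vitali subfamily of them is
  disjoint, so its total \<open>\<Sum>r\<^sup>s\<close> is at most the mass of \<open>\<nu>\<close>, while its fourfold enlargements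
  cover \<open>\<Omega>\<close> and have diameters at most \<open>8 r\<close>. The lower bound \<open>h\<close> on the content therefore bounds the
  mass below, and normalising costs a factor exponential in \<open>s\<close>. This loss is harmless: with
  \<open>s\<close> proportional to the orbit length it contributes only a constant to the rate.

  The content is tested on covers indexed by net points and scales because those are
  the covers that the argument produces.
\<close>

lemma finite_Frostman:
  fixes D :: "'a \<Rightarrow> 'a \<Rightarrow> real"
  assumes sym: "\<And>x y. D x y = D y x" and D0: "\<And>x. D x x = 0"
    and tri: "\<And>x y z. D x z \<le> D x y + D y z"
    and F: "finite F" and net: "\<And>x. x \<in> \<Omega> \<Longrightarrow> \<exists>p\<in>F. D x p \<le> \<tau>"
    and \<tau>: "0 < \<tau>" "\<tau> \<le> \<epsilon> / 16" and \<epsilon>: "\<epsilon> < 1" and s: "0 \<le> s" and h: "0 < h" "h \<le> 1"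
    and content: "\<And>(B :: ('a \<times> nat) set) E \<rho>. finite B \<Longrightarrow> \<Omega> \<subseteq> (\<Union>b\<in>B. E b) \<Longrightarrow>
      (\<And>b. b \<in> B \<Longrightarrow> 0 < \<rho> b \<and> \<rho> b < \<epsilon>) \<Longrightarrow>
      (\<And>b x y. b \<in> B \<Longrightarrow> x \<in> E b \<Longrightarrow> y \<in> E b \<Longrightarrow> D x y \<le> \<rho> b) \<Longrightarrow> h \<le> (\<Sum>b\<in>B. \<rho> b powr s)"
  shows "\<exists>\<nu>. (\<forall>x. 0 \<le> \<nu> x) \<and> sum \<nu> F = 1 \<and>
    (\<forall>E \<rho>. \<tau> \<le> \<rho> \<longrightarrow> (\<forall>x\<in>E. \<forall>y\<in>E. D x y \<le> \<rho>) \<longrightarrow>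
      sum \<nu> (F \<inter> E) \<le> (32 / \<epsilon>) powr s * \<rho> powr s / h)"
proof -
  define J where "J = {j::nat. \<tau> * 2 ^ j \<le> \<epsilon> / 16}"
  have finJ: "finite J"
  proof (rule finite_subset)
    show "J \<subseteq> {..nat \<lceil>\<epsilon> / 16 / \<tau>\<rceil>}"
    proof
      fix j assume "j \<in> J"
      then have "2 ^ j \<le> \<epsilon> / 16 / \<tau>" using \<tau> by (simp add: J_def field_simps)
      moreover have "real j \<le> 2 ^ j" using of_nat_less_two_power[of j, where 'a = real] by linarith
      ultimately have "real j \<le> \<epsilon> / 16 / \<tau>" by linarith
      then show "j \<in> {..nat \<lceil>\<epsilon> / 16 / \<tau>\<rceil>}" by (simp add: le_nat_iff le_ceiling_iff)
    qed
  qed simp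
  define r where "r b = \<tau> * 2 ^ snd b" for b :: "'a \<times> nat"
  define S where "S b = {x. D (fst b) x \<le> r b}" for b :: "'a \<times> nat"
  define B where "B = F \<times> J"
  have finB: "finite B" using F finJ by (simp add: B_def)
  have r_pos: "0 < r b" and r_ge: "\<tau> \<le> r b" for b using \<tau> by (simp_all add: r_def)
  have r_le: "r b \<le> \<epsilon> / 16" if "b \<in> B" for b using that by (auto simp: r_def B_def J_def)
  have "F \<subseteq> (\<Union>b\<in>B. S b)"
  proof
    fix x assume "x \<in> F"
    then have "(x, 0) \<in> B" "x \<in> S (x, 0)" using \<tau> by (auto simp: B_def J_def S_def r_def D0)
    then show "x \<in> (\<Union>b\<in>B. S b)" by blast
  qed
  from exists_saturated_weights[OF F finB _ this, of "\<lambda>b. r b powr s", OF powr_ge_zero]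
  obtain \<nu> :: "'a \<Rightarrow> real" where pos: "\<And>x. 0 \<le> \<nu> x"
    and le: "\<And>b. b \<in> B \<Longrightarrow> sum \<nu> (F \<inter> S b) \<le> r b powr s"
    and tight: "\<And>x. x \<in> F \<Longrightarrow> \<exists>b\<in>B. x \<in> S b \<and> sum \<nu> (F \<inter> S b) = r b powr s"
    by blast
  define B1 where "B1 = {b\<in>B. sum \<nu> (F \<inter> S b) = r b powr s}"
  have "finite B1" using finB by (simp add: B1_def)
  from Vitali_finite_subfamily[of D, OF sym D0 this, of r fst] r_pos[THEN less_imp_le]
  obtain B2 where B2: "B2 \<subseteq> B1"
    and disj: "\<And>b b'. b \<in> B2 \<Longrightarrow> b' \<in> B2 \<Longrightarrow> b \<noteq> b' \<Longrightarrow> r b + r b' < D (fst b) (fst b')"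
    and cov: "\<And>b. b \<in> B1 \<Longrightarrow> \<exists>b'\<in>B2. r b \<le> r b' \<and> D (fst b) (fst b') \<le> r b + r b'"
    by metis
  have finB2: "finite B2" using B2 finB by (auto simp: B1_def intro: finite_subset)
  have "h \<le> (\<Sum>b\<in>B2. (8 * r b) powr s)"
  proof (rule content[OF finB2, of "\<lambda>b. {x. D (fst b) x \<le> 4 * r b}"])
    show "\<Omega> \<subseteq> (\<Union>b\<in>B2. {x. D (fst b) x \<le> 4 * r b})"
    proof
      fix x assume "x \<in> \<Omega>"
      then obtain p where p: "p \<in> F" "D x p \<le> \<tau>" using net by blast
      then obtain b where b: "b \<in> B1" "p \<in> S b" using tight unfolding B1_def by blast
      then obtain b' where b': "b' \<in> B2" "r b \<le> r b'" "D (fst b) (fst b') \<le> r b + r b'"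
        using cov by blast
      have "D (fst b') x \<le> D (fst b') (fst b) + (D (fst b) p + D p x)"
        using tri[of "fst b'" x "fst b"] tri[of "fst b" x p] by linarith
      also have "\<dots> \<le> 4 * r b'"
        using b b' p sym[of "fst b'" "fst b"] sym[of p x] r_ge[of b] by (simp add: S_def)
      finally show "x \<in> (\<Union>b\<in>B2. {x. D (fst b) x \<le> 4 * r b})" using b' by blast
    qed
  next
    fix b assume "b \<in> B2"
    then have "b \<in> B" using B2 by (auto simp: B1_def)
    then show "0 < 8 * r b \<and> 8 * r b < \<epsilon>"
      using r_pos[of b] r_le[of b] \<tau> by simp
  next
    fix b x y assume "x \<in> {x. D (fst b) x \<le> 4 * r b}" "y \<in> {x. D (fst b) x \<le> 4 * r b}"
    then show "D x y \<le> 8 * r b" using tri[of x y "fst b"] sym[of x "fst b"] by simp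
  qed
  also have "\<dots> = 8 powr s * (\<Sum>b\<in>B2. sum \<nu> (F \<inter> S b))"
  proof (subst sum_distrib_left, rule sum.cong[OF refl])
    fix b assume "b \<in> B2"
    then have "sum \<nu> (F \<inter> S b) = r b powr s" using B2 by (auto simp: B1_def)
    then show "(8 * r b) powr s = 8 powr s * sum \<nu> (F \<inter> S b)"
      using r_pos[of b] by (simp add: powr_mult)
  qed
  also have "(\<Sum>b\<in>B2. sum \<nu> (F \<inter> S b)) = sum \<nu> (\<Union>b\<in>B2. F \<inter> S b)"
  proof (rule sum.UNION_disjoint[symmetric, OF finB2])
    show "\<forall>i\<in>B2. \<forall>j\<in>B2. i \<noteq> j \<longrightarrow> F \<inter> S i \<inter> (F \<inter> S j) = {}"
    proof (intro ballI impI)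
      fix b b' assume "b \<in> B2" "b' \<in> B2" "b \<noteq> b'"
      then have "r b + r b' < D (fst b) (fst b')" by (rule disj)
      then have False if "x \<in> S b" "x \<in> S b'" for x
        using that tri[of "fst b" "fst b'" x] sym[of x "fst b'"] by (simp add: S_def)
      then show "F \<inter> S b \<inter> (F \<inter> S b') = {}" by auto
    qed
  qed (use F in auto)
  also have "sum \<nu> (\<Union>b\<in>B2. F \<inter> S b) \<le> sum \<nu> F"
    by (rule sum_mono2) (use F pos in auto)
  finally have total: "h \<le> 8 powr s * sum \<nu> F" by simp
  define W where "W = sum \<nu> F"
  have W: "0 < W" using total h by (simp add: W_def) (smt (verit) powr_gt_zero zero_less_mult_iff)
  have h_W: "h / 8 powr s \<le> W" using total by (simp add: W_def field_simps)
  show ?thesis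
  proof (intro exI[of _ "\<lambda>x. \<nu> x / W"] conjI allI impI)
    show "0 \<le> \<nu> x / W" for x using pos W by simp
    show "(\<Sum>x\<in>F. \<nu> x / W) = 1" using W by (simp add: W_def flip: sum_divide_distrib)
  next
    fix E \<rho> assume \<rho>: "\<tau> \<le> \<rho>" and diam: "\<forall>x\<in>E. \<forall>y\<in>E. D x y \<le> \<rho>"
    have W1: "sum \<nu> (F \<inter> E) \<le> W" unfolding W_def by (rule sum_mono2) (use F pos in auto)
    have eps: "0 < \<epsilon>" using \<tau> by linarith
    have "sum \<nu> (F \<inter> E) / W \<le> (32 / \<epsilon>) powr s * \<rho> powr s / h"
    proof (cases "\<rho> < \<epsilon> / 32 \<and> F \<inter> E \<noteq> {}")
      case True
      then obtain p where p: "p \<in> F" "p \<in> E" by auto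
      have "\<exists>j. \<rho> \<le> \<tau> * 2 ^ j"
      proof -
        obtain j where "\<rho> / \<tau> < 2 ^ j" using real_arch_pow[of 2 "\<rho> / \<tau>"] by auto
        then show ?thesis using \<tau> by (intro exI[of _ j]) (simp add: field_simps)
      qed
      then obtain j where j: "\<rho> \<le> \<tau> * 2 ^ j" and min: "\<And>i. i < j \<Longrightarrow> \<not> \<rho> \<le> \<tau> * 2 ^ i"
        by (auto simp: exists_least_iff[of "\<lambda>j. \<rho> \<le> \<tau> * 2 ^ j"])
      have j2: "\<tau> * 2 ^ j \<le> 2 * \<rho>"
      proof (cases j)
        case (Suc i)
        then show ?thesis using min[of i] by simp
      qed (use \<rho> \<tau> in auto)
      have pj: "(p, j) \<in> B" using p j2 True by (auto simp: B_def J_def)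
      have "sum \<nu> (F \<inter> E) \<le> sum \<nu> (F \<inter> S (p, j))"
        by (rule sum_mono2) (use F pos diam p j in \<open>auto simp: S_def r_def intro: order_trans\<close>)
      also have "\<dots> \<le> r (p, j) powr s" by (rule le[OF pj])
      also have "\<dots> \<le> (2 * \<rho>) powr s"
        using j2 \<tau> s by (intro powr_mono2) (auto simp: r_def)
      finally have "sum \<nu> (F \<inter> E) / W \<le> (2 * \<rho>) powr s / (h / 8 powr s)"
        using h_W h W by (intro frac_le) auto
      also have "\<dots> = (16 * \<rho>) powr s / h"
        using \<rho> \<tau> powr_mult[of 8 "2 * \<rho>" s] by (simp add: field_simps)
      also have "\<dots> \<le> (32 / \<epsilon> * \<rho>) powr s / h"
      proof -
        have "16 * \<rho> \<le> 32 / \<epsilon> * \<rho>"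
          using eps \<epsilon> \<rho> \<tau> by (intro mult_right_mono) (auto simp: field_simps)
        then show ?thesis using h \<rho> \<tau> s by (intro divide_right_mono powr_mono2) auto
      qed
      also have "\<dots> = (32 / \<epsilon>) powr s * \<rho> powr s / h"
        using \<rho> \<tau> eps by (subst powr_mult) auto
      finally show ?thesis .
    next
      case False
      show ?thesis
      proof (cases "F \<inter> E = {}")
        case True
        then show ?thesis using h by simp
      next
        case ne: False
        with False have "1 \<le> 32 / \<epsilon> * \<rho>" using eps by (simp add: field_simps)
        then have "1 \<le> (32 / \<epsilon> * \<rho>) powr s" using s by (simp add: ge_one_powr_ge_zero)
        also have "\<dots> = (32 / \<epsilon>) powr s * \<rho> powr s"
          using \<rho> \<tau> eps by (subst powr_mult) auto
        finally have "h * 1 \<le> 1 * ((32 / \<epsilon>) powr s * \<rho> powr s)"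
          using h by (intro mult_mono) auto
        moreover have "sum \<nu> (F \<inter> E) / W \<le> 1" using W1 W by simp
        moreover have "1 \<le> (32 / \<epsilon>) powr s * \<rho> powr s / h" using calculation h by (simp add: field_simps)
        ultimately show ?thesis by linarith
      qed
    qed
    then show "(\<Sum>x\<in>F \<inter> E. \<nu> x / W) \<le> (32 / \<epsilon>) powr s * \<rho> powr s / h"
      by (simp add: sum_divide_distrib)
  qed
qed

section \<open>Partition functions of finite mixtures\<close>

lemma sum_lessThan_blocks:
  fixes f :: "nat \<Rightarrow> real"
  shows "(\<Sum>k<M * n. f k) = (\<Sum>i<M. \<Sum>l<n. f (i * n + l))"
  unfolding sum.nat_group[symmetric]
  by (rule sum.cong[OF refl], subst sum.atLeastLessThan_shift_0) (simp add: atLeast0LessThan)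

lemma convex_combination_pos:
  fixes q e :: "'v \<Rightarrow> real"
  assumes V: "finite V" "\<And>v. v \<in> V \<Longrightarrow> 0 \<le> q v" "sum q V = 1" and e: "\<And>v. v \<in> V \<Longrightarrow> 0 < e v"
  shows "0 < (\<Sum>v\<in>V. q v * e v)"
proof -
  have "\<exists>v\<in>V. 0 < q v" using V sum_nonpos[of V q] by force
  then obtain v where "v \<in> V" "0 < q v" by blast
  then show ?thesis using V e by (intro sum_pos2[of V v]) (auto simp: less_imp_le)
qed

text \<open>
  A product of mixtures is a mixture of products, with weights multiplying up to
  \<open>\<Prod>i. \<Sum>w. c i w\<close>. It is used once for the product law of independent blocks and once for the
  expansion of a partition function over cells.
\<close>

lemma sum_prod_mixture_le:
  fixes \<nu> :: "'a \<Rightarrow> real" and c :: "'i \<Rightarrow> 'w \<Rightarrow> real" and e :: "'i \<Rightarrow> 'w \<Rightarrow> 'a \<Rightarrow> real"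
  assumes I: "finite I" and W: "\<And>i. i \<in> I \<Longrightarrow> finite (W i)"
    and c: "\<And>i w. i \<in> I \<Longrightarrow> w \<in> W i \<Longrightarrow> 0 \<le> c i w"
    and b: "\<And>p. p \<in> PiE I W \<Longrightarrow> (\<Sum>x\<in>F. \<nu> x * (\<Prod>i\<in>I. e i (p i) x)) \<le> b"
  shows "(\<Sum>x\<in>F. \<nu> x * (\<Prod>i\<in>I. \<Sum>w\<in>W i. c i w * e i w x)) \<le> (\<Prod>i\<in>I. \<Sum>w\<in>W i. c i w) * b"
proof -
  have "(\<Sum>x\<in>F. \<nu> x * (\<Prod>i\<in>I. \<Sum>w\<in>W i. c i w * e i w x))
      = (\<Sum>x\<in>F. \<Sum>p\<in>PiE I W. (\<Prod>i\<in>I. c i (p i)) * (\<nu> x * (\<Prod>i\<in>I. e i (p i) x)))"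
    using I W by (simp add: prod_sum_PiE prod.distrib sum_distrib_left mult_ac)
  also have "\<dots> = (\<Sum>p\<in>PiE I W. (\<Prod>i\<in>I. c i (p i)) * (\<Sum>x\<in>F. \<nu> x * (\<Prod>i\<in>I. e i (p i) x)))"
    by (subst sum.swap) (simp add: sum_distrib_left)
  also have "\<dots> \<le> (\<Sum>p\<in>PiE I W. (\<Prod>i\<in>I. c i (p i)) * b)"
    using b c by (intro sum_mono mult_left_mono prod_nonneg) (auto simp: PiE_iff)
  also have "\<dots> = (\<Prod>i\<in>I. \<Sum>w\<in>W i. c i w) * b"
    using I W by (simp add: prod_sum_PiE sum_distrib_right)
  finally show ?thesis .
qed

text \<open>
  Jensen's inequality for the convex function \<open>- ln\<close>, from its tangent at \<open>b\<close>.
\<close>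

lemma neg_ln_sum_le:
  fixes g :: "'a \<Rightarrow> real"
  assumes F: "finite F" and \<nu>: "\<And>x. x \<in> F \<Longrightarrow> 0 \<le> \<nu> x" "sum \<nu> F = 1"
    and g: "\<And>x. x \<in> F \<Longrightarrow> 0 < g x" and b: "(\<Sum>x\<in>F. \<nu> x * g x) \<le> b"
  shows "- ln b \<le> (\<Sum>x\<in>F. \<nu> x * - ln (g x))"
proof -
  have "0 < (\<Sum>x\<in>F. \<nu> x * g x)" by (rule convex_combination_pos[OF F \<nu> g])
  then have b0: "0 < b" using b by linarith
  have "(\<Sum>x\<in>F. \<nu> x * ln (g x)) \<le> (\<Sum>x\<in>F. \<nu> x * (g x / b - 1 + ln b))"
  proof (intro sum_mono mult_left_mono)
    fix x assume "x \<in> F"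
    then show "ln (g x) \<le> g x / b - 1 + ln b"
      using ln_le_minus_one[of "g x / b"] g[of x] b0 by (simp add: ln_div)
  qed (use \<nu> in auto)
  also have "\<dots> = (\<Sum>x\<in>F. \<nu> x * g x) / b + (ln b - 1) * sum \<nu> F"
    by (simp add: sum_divide_distrib sum_distrib_left sum.distrib[symmetric] algebra_simps)
  also have "\<dots> \<le> ln b" using b b0 \<nu> by (simp add: field_simps)
  finally show ?thesis by (simp add: sum_negf)
qed

section \<open>Weak limits of finitely supported measures\<close>

lemma finite_measurable_code:
  fixes U :: "'a::topological_space \<Rightarrow> 'a set"
  assumes "compact (UNIV :: 'a set)" and U: "\<And>z. open (U z)" "\<And>z. z \<in> U z"
  obtains p :: "'a \<Rightarrow> nat" and r m where "p \<in> borel \<rightarrow>\<^sub>M count_space UNIV"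
    "\<And>x. p x < m" "\<And>x. x \<in> U (r (p x))"
proof -
  have "UNIV \<subseteq> (\<Union>z. U z)" using U by auto
  from compactE_image[OF assms(1), of UNIV U, OF U(1) this]
  obtain Z where Z: "finite Z" "UNIV \<subseteq> (\<Union>z\<in>Z. U z)" by (metis)
  obtain zs where zs: "set zs = Z" using finite_list[OF Z(1)] by blast
  define p where "p x = (LEAST i. i < length zs \<and> x \<in> U (zs ! i))" for x
  have p: "p x < length zs \<and> x \<in> U (zs ! p x)" for x
  proof -
    have "\<exists>i. i < length zs \<and> x \<in> U (zs ! i)"
      using Z(2) zs by (metis UN_E UNIV_I in_set_conv_nth subsetD)
    then show ?thesis unfolding p_def by (rule LeastI_ex)
  qed
  have "p \<in> borel \<rightarrow>\<^sub>M count_space UNIV"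
    unfolding p_def
  proof (rule measurable_Least)
    fix i
    have "{x. i < length zs \<and> x \<in> U (zs ! i)} = (if i < length zs then U (zs ! i) else {})" by auto
    then show "Measurable.pred borel (\<lambda>x. i < length zs \<and> x \<in> U (zs ! i))"
      using U(1) by (simp add: pred_def)
  qed
  then show thesis using p by (intro that[of p "length zs" "\<lambda>i. zs ! i"]) auto
qed

text \<open>
  Base \<open>4\<close> with digits \<open>0\<close> and \<open>1\<close> leaves gaps, as in the Cantor set, so that close numbers share
  their leading digits. In base \<open>2\<close> this fails.
\<close>

lemma base4_expansion_separates:
  fixes b b' :: "nat \<Rightarrow> bool"
  assumes "b i \<noteq> b' i"
  shows "(1 / 4) ^ i / 2 \<le> \<bar>(\<Sum>k. of_bool (b k) * (1 / 4 :: real) ^ k) - (\<Sum>k. of_bool (b' k) * (1 / 4) ^ k)\<bar>"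
proof -
  define f where "f k = (of_bool (b k) - of_bool (b' k)) * (1 / 4 :: real) ^ k" for k
  have geo: "summable (\<lambda>k. (1 / 4 :: real) ^ k)" by (simp add: summable_geometric)
  have sm: "summable (\<lambda>k. of_bool (c k) * (1 / 4 :: real) ^ k)" for c :: "nat \<Rightarrow> bool"
    by (rule summable_comparison_test'[OF geo, of 0]) simp
  have absf: "\<bar>f k\<bar> \<le> (1 / 4) ^ k" for k by (auto simp: f_def of_bool_def)
  have smf: "summable f"
    by (rule summable_comparison_test'[OF geo, of 0]) (use absf in auto)
  have eq: "(\<Sum>k. of_bool (b k) * (1 / 4 :: real) ^ k) - (\<Sum>k. of_bool (b' k) * (1 / 4) ^ k) = suminf f"
    using suminf_diff[OF sm[of b] sm[of b']] by (simp add: f_def[abs_def] left_diff_distrib)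
  define j where "j = (LEAST j. b j \<noteq> b' j)"
  have j: "b j \<noteq> b' j" using LeastI[of "\<lambda>j. b j \<noteq> b' j", OF assms] by (simp add: j_def)
  have jmin: "b k = b' k" if "k < j" for k using not_less_Least[of k "\<lambda>j. b j \<noteq> b' j"] that by (simp add: j_def)
  have ji: "j \<le> i" unfolding j_def by (rule Least_le) fact
  have "suminf f = (\<Sum>k. f (k + Suc j)) + (\<Sum>k<Suc j. f k)"
    by (rule suminf_split_initial_segment[OF smf])
  also have "(\<Sum>k<Suc j. f k) = f j" using jmin by (simp add: f_def)
  finally have 1: "suminf f = (\<Sum>k. f (k + Suc j)) + f j" .
  have sg: "summable (\<lambda>k. (1 / 4 :: real) ^ (k + Suc j))"
    using geo by (subst summable_iff_shift)
  have "\<bar>\<Sum>k. f (k + Suc j)\<bar> \<le> (\<Sum>k. (1 / 4) ^ (k + Suc j))"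
  proof -
    have "summable (\<lambda>k. \<bar>f (k + Suc j)\<bar>)"
      by (rule summable_comparison_test'[OF sg, of 0]) (use absf in \<open>simp del: power_Suc add_Suc_right\<close>)
    then have "\<bar>\<Sum>k. f (k + Suc j)\<bar> \<le> (\<Sum>k. \<bar>f (k + Suc j)\<bar>)" by (rule summable_rabs)
    also have "\<dots> \<le> (\<Sum>k. (1 / 4) ^ (k + Suc j))"
      by (rule suminf_le[OF absf \<open>summable (\<lambda>k. \<bar>f (k + Suc j)\<bar>)\<close> sg])
    finally show ?thesis .
  qed
  also have "(\<Sum>k. (1 / 4 :: real) ^ (k + Suc j)) = (1 / 4) ^ Suc j * (\<Sum>k. (1 / 4) ^ k)"
    by (subst suminf_mult[symmetric, OF geo]) (simp add: power_add mult_ac)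
  also have "\<dots> = (1 / 4) ^ j / 3" using suminf_geometric[of "1 / 4 :: real"] by simp
  finally have 2: "\<bar>\<Sum>k. f (k + Suc j)\<bar> \<le> (1 / 4) ^ j / 3" .
  have 3: "\<bar>f j\<bar> = (1 / 4) ^ j" using j by (auto simp: f_def of_bool_def)
  have "(1 / 4 :: real) ^ i \<le> (1 / 4) ^ j" using ji by (intro power_decreasing) auto
  with 1 2 3 have "(1 / 4) ^ i / 2 \<le> \<bar>suminf f\<bar>" by linarith
  then show ?thesis by (simp only: eq)
qed

text \<open>
  The inverse of a Cantor-type parametrisation of the space: nearby codes force nearby points. The code
  itself is far from continuous; only its inverse has to be uniformly continuous, since it
  serves to transport convergence from the line back to the space.
\<close>

lemma ex_expanding_real_code:
  assumes "compact (UNIV :: 'a::metric_space set)"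
  shows "\<exists>c :: 'a \<Rightarrow> real. (\<forall>x. c x \<in> {0..2}) \<and>
    (\<forall>\<epsilon>>0. \<exists>\<delta>>0. \<forall>x y. \<bar>c x - c y\<bar> < \<delta> \<longrightarrow> dist x y < \<epsilon>)"
proof -
  have "\<exists>p :: 'a \<Rightarrow> nat. \<exists>m. (\<forall>x. p x < m) \<and> (\<forall>x y. p x = p y \<longrightarrow> dist x y < \<epsilon>)" if \<epsilon>: "\<epsilon> > 0" for \<epsilon> :: real
  proof -
    obtain p :: "'a \<Rightarrow> nat" and r m where p: "\<And>x. p x < m" "\<And>x. x \<in> ball (r (p x)) (\<epsilon> / 2)"
      using finite_measurable_code[OF assms, of "\<lambda>z. ball z (\<epsilon> / 2)"] \<epsilon> by (metis centre_in_ball half_gt_zero open_ball)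
    have "dist x y < \<epsilon>" if "p x = p y" for x y
      using p(2)[of x] p(2)[of y] that dist_triangle_half_r[of "r (p x)" x \<epsilon> y] by auto
    then show ?thesis using p by blast
  qed
  then have "\<exists>p :: 'a \<Rightarrow> nat. \<exists>m. (\<forall>x. p x < m) \<and> (\<forall>x y. p x = p y \<longrightarrow> dist x y < 1 / real (Suc j))" for j
    by simp
  then obtain p :: "nat \<Rightarrow> 'a \<Rightarrow> nat" and m where
    p: "\<And>j x. p j x < m j" "\<And>j x y. p j x = p j y \<Longrightarrow> dist x y < 1 / real (Suc j)"
    by metis
  define b where "b x i \<longleftrightarrow> p (fst (prod_decode i)) x = snd (prod_decode i)" for x i
  define c where "c x = (\<Sum>k. of_bool (b x k) * (1 / 4 :: real) ^ k)" for x
  have geo: "summable (\<lambda>k. (1 / 4 :: real) ^ k)" by (simp add: summable_geometric)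
  have sm: "summable (\<lambda>k. of_bool (b x k) * (1 / 4 :: real) ^ k)" for x
    by (rule summable_comparison_test'[OF geo, of 0]) simp
  have "0 \<le> c x" "c x \<le> 2" for x
  proof -
    show "0 \<le> c x" unfolding c_def by (rule suminf_nonneg[OF sm]) simp
    have "c x \<le> (\<Sum>k. (1 / 4) ^ k)" unfolding c_def by (rule suminf_le[OF _ sm geo]) auto
    then show "c x \<le> 2" using suminf_geometric[of "1 / 4 :: real"] by simp
  qed
  moreover have "\<exists>\<delta>>0. \<forall>x y. \<bar>c x - c y\<bar> < \<delta> \<longrightarrow> dist x y < \<epsilon>" if "0 < \<epsilon>" for \<epsilon>
  proof -
    obtain j where j: "1 / real (Suc j) < \<epsilon>" using \<open>0 < \<epsilon>\<close> by (metis nat_approx_posE inverse_eq_divide)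
    define n where "n = Max ((\<lambda>l. prod_encode (j, l)) ` {..<m j})"
    show ?thesis
    proof (intro exI[of _ "(1 / 4) ^ n / 2"] conjI allI impI)
      fix x y assume xy: "\<bar>c x - c y\<bar> < (1 / 4) ^ n / 2"
      define i where "i = prod_encode (j, p j x)"
      have "i \<le> n" unfolding n_def i_def by (rule Max_ge) (use p(1) in auto)
      then have "(1 / 4 :: real) ^ n \<le> (1 / 4) ^ i" by (intro power_decreasing) auto
      then have "\<not> (1 / 4) ^ i / 2 \<le> \<bar>c x - c y\<bar>" using xy by linarith
      then have "b x i = b y i"
        using base4_expansion_separates[of "b x" i "b y"] unfolding c_def by blast
      then have "p j x = p j y" by (simp add: b_def i_def)
      then show "dist x y < \<epsilon>" using p(2) j by (meson less_trans)
    qed simp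
  qed
  ultimately show ?thesis by (intro exI[of _ c]) auto
qed

text \<open>
  Sequential weak compactness by reduction to the real line. Codes turn the measures into laws on
  a bounded interval, where Helly's theorem gives a weakly convergent subsequence and Skorohod's theorem
  realises it by pointwise convergent real random variables. These take values in the code of a finite
  set almost surely, so they decode to points of the space; the decoded points are Cauchy because the code
  is expanding. The law of their pointwise limit is the weak limit.
\<close>

lemma weak_limit_of_finite_measures:
  fixes z :: "nat \<Rightarrow> 'i \<Rightarrow> 'a::metric_space" and w :: "nat \<Rightarrow> 'i \<Rightarrow> real"
  assumes compact: "compact (UNIV :: 'a set)"
    and I: "\<And>n. finite (I n)" and w: "\<And>n i. i \<in> I n \<Longrightarrow> 0 \<le> w n i" "\<And>n. sum (w n) (I n) = 1"
  obtains r :: "nat \<Rightarrow> nat" and \<mu> :: "'a measure" where "strict_mono r" "prob_space \<mu>"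
    "sets \<mu> = sets borel"
    "\<And>f. continuous_on UNIV f \<Longrightarrow>
      (\<lambda>n. \<Sum>i\<in>I (r n). w (r n) i * f (z (r n) i)) \<longlonglongrightarrow> (\<integral>x. f x \<partial>\<mu> :: real)"
proof -
  obtain c :: "'a \<Rightarrow> real" where c: "\<And>x. c x \<in> {0..2}"
    "\<And>\<epsilon>. \<epsilon> > 0 \<Longrightarrow> \<exists>\<delta>>0. \<forall>x y. \<bar>c x - c y\<bar> < \<delta> \<longrightarrow> dist x y < \<epsilon>"
    using ex_expanding_real_code[OF compact] by blast
  have inj: "x = y" if "c x = c y" for x y
  proof (rule ccontr)
    assume "x \<noteq> y"
    then obtain \<delta> where "\<delta> > 0" "\<forall>x' y'. \<bar>c x' - c y'\<bar> < \<delta> \<longrightarrow> dist x' y' < dist x y"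
      using c(2)[of "dist x y"] by auto
    then show False using that by (metis abs_zero diff_self less_irrefl)
  qed
  define P where "P n = point_measure (I n) (w n)" for n
  define \<nu> where "\<nu> n = distr (P n) borel (c \<circ> z n)" for n
  have prob_P: "prob_space (P n)" for n
    using I[of n] w(1)[of _ n] w(2)[of n]
    by (intro prob_spaceI) (simp add: P_def space_point_measure emeasure_point_measure_finite sum_ennreal)
  have meas_P: "g \<in> measurable (P n) N" if "g \<in> I n \<rightarrow> space N" for n g and N :: "'x measure"
    using that by (simp add: P_def)
  have cz: "c \<circ> z n \<in> borel_measurable (P n)" for n by (rule meas_P) simp
  have rd: "real_distribution (\<nu> n)" for n
  proof -
    interpret prob_space "\<nu> n" unfolding \<nu>_def by (rule prob_space.prob_space_distr[OF prob_P cz])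
    show ?thesis by unfold_locales (simp add: \<nu>_def)
  qed
  have "tight \<nu>"
    unfolding tight_def
  proof (intro conjI allI impI rd)
    fix \<epsilon> :: real assume "0 < \<epsilon>"
    have "measure (\<nu> n) {-1<..2} = 1" for n
    proof -
      have "(c \<circ> z n) -` {-1<..2} \<inter> space (P n) = space (P n)" using c(1) by force
      then show ?thesis
        unfolding \<nu>_def using prob_space.prob_space[OF prob_P[of n]] by (subst measure_distr[OF cz]) simp_all
    qed
    then have "(-1 :: real) < 2 \<and> (\<forall>n. 1 - \<epsilon> < measure (\<nu> n) {-1<..2})" using \<open>0 < \<epsilon>\<close> by simp
    then show "\<exists>a b. a < b \<and> (\<forall>n. 1 - \<epsilon> < measure (\<nu> n) {a<..b})" by blast
  qed
  from tight_imp_convergent_subsubsequence[OF this, of id] obtain r M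
    where r: "strict_mono r" and M: "real_distribution M" and conv: "weak_conv_m (\<lambda>n. \<nu> (r n)) M"
    by (auto simp: strict_mono_def comp_def)
  from Skorohod[OF rd M conv] obtain \<Omega> :: "real measure" and Y Y0 where
    \<Omega>: "prob_space \<Omega>" and Y: "\<And>n. Y n \<in> borel_measurable \<Omega>" "\<And>n. distr \<Omega> borel (Y n) = \<nu> (r n)"
    and lim: "\<And>u. u \<in> space \<Omega> \<Longrightarrow> (\<lambda>n. Y n u) \<longlonglongrightarrow> (Y0 u :: real)"
    by blast
  interpret \<Omega>: prob_space \<Omega> by fact
  define C where "C n = (c \<circ> z (r n)) ` I (r n)" for n
  have finC: "finite (C n)" for n by (simp add: C_def I)
  have Cb: "C n \<in> sets borel" for n using finC by (simp add: finite_imp_closed borel_closed)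
  define a :: 'a where "a = undefined"
  define G where "G = {u\<in>space \<Omega>. \<forall>n. Y n u \<in> C n}"
  have G_sets: "G \<in> sets \<Omega>" unfolding G_def using Y(1) Cb by measurable
  have G_AE: "AE u in \<Omega>. u \<in> G"
  proof -
    have "AE u in \<Omega>. Y n u \<in> C n" for n
    proof -
      have "AE v in \<nu> (r n). v \<in> C n"
        unfolding \<nu>_def by (subst AE_distr_iff[OF cz]) (use Cb in \<open>auto intro!: AE_I2 simp: C_def P_def space_point_measure\<close>)
      then show ?thesis
        unfolding Y(2)[symmetric] by (subst (asm) AE_distr_iff[OF Y(1)]) (use Cb in auto)
    qed
    then have "AE u in \<Omega>. \<forall>n. Y n u \<in> C n" by (simp add: AE_all_countable)
    then show ?thesis by (rule AE_mp) (auto simp: G_def intro!: AE_I2)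
  qed
  define g where "g n v = (if v \<in> C n then inv c v else a)" for n v
  have g_c: "g n (c (z (r n) i)) = z (r n) i" if "i \<in> I (r n)" for n i
    using that inj by (auto simp: g_def C_def inv_def)
  have c_g: "c (g n v) = v" if "v \<in> C n" for n v
    using that by (auto simp: g_def C_def f_inv_into_f)
  have g: "g n \<in> borel_measurable borel" for n
  proof (rule measurable_piecewise_restrict[of "insert (- C n) ((\<lambda>v. {v}) ` C n)"])
    show "countable (insert (- C n) ((\<lambda>v. {v}) ` C n))" using finC by (simp add: countable_finite)
    show "space borel \<subseteq> \<Union> (insert (- C n) ((\<lambda>v. {v}) ` C n))" by auto
    fix A assume A: "A \<in> insert (- C n) ((\<lambda>v. {v}) ` C n)"
    then show "A \<inter> space borel \<in> sets borel" using Cb by auto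
    obtain y where "\<And>v. v \<in> A \<Longrightarrow> g n v = y" using A by (fastforce simp: g_def)
    then show "g n \<in> borel_measurable (restrict_space borel A)"
      by (subst measurable_cong[of _ _ "\<lambda>_. y"]) (auto simp: space_restrict_space)
  qed
  define x where "x n u = (if u \<in> G then g n (Y n u) else a)" for n u
  have x: "x n \<in> borel_measurable \<Omega>" for n
    unfolding x_def using measurable_compose[OF Y(1) g] G_sets by measurable
  have "\<exists>l. (\<lambda>n. x n u) \<longlonglongrightarrow> l" if "u \<in> space \<Omega>" for u
  proof (cases "u \<in> G")
    case True
    have "Cauchy (\<lambda>n. x n u)"
    proof (rule metric_CauchyI)
      fix \<epsilon> :: real assume "0 < \<epsilon>"
      then obtain \<delta> where \<delta>: "\<delta> > 0" "\<And>x y. \<bar>c x - c y\<bar> < \<delta> \<Longrightarrow> dist x y < \<epsilon>"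
        using c(2) by blast
      from LIMSEQ_imp_Cauchy[OF lim[OF that]] \<delta>(1)
      obtain K where K: "\<And>m n. m \<ge> K \<Longrightarrow> n \<ge> K \<Longrightarrow> dist (Y m u) (Y n u) < \<delta>"
        unfolding Cauchy_def by blast
      have "c (x n u) = Y n u" for n using True by (simp add: x_def G_def c_g)
      then show "\<exists>K. \<forall>m\<ge>K. \<forall>n\<ge>K. dist (x m u) (x n u) < \<epsilon>"
        using K \<delta>(2) by (intro exI[of _ K]) (simp add: dist_real_def)
    qed
    then show ?thesis
      using compact_imp_complete[OF compact] by (auto simp: complete_def)
  next
    case False
    then show ?thesis by (auto simp: x_def)
  qed
  then obtain x0 where x0: "\<And>u. u \<in> space \<Omega> \<Longrightarrow> (\<lambda>n. x n u) \<longlonglongrightarrow> x0 u" by metis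
  have x0_meas: "x0 \<in> borel_measurable \<Omega>"
    by (rule borel_measurable_LIMSEQ_metric[OF x x0])
  show thesis
  proof (rule that[OF r])
    show "prob_space (distr \<Omega> borel x0)" by (rule \<Omega>.prob_space_distr[OF x0_meas])
  next
    fix f :: "'a \<Rightarrow> real" assume f: "continuous_on UNIV f"
    then have f_meas: "f \<in> borel_measurable borel" by (rule borel_measurable_continuous_onI)
    have "bounded (range f)" by (rule compact_imp_bounded[OF compact_continuous_image[OF f compact]])
    then obtain B where B: "\<And>x. norm (f x) \<le> B" by (auto simp: bounded_iff)
    have "(\<lambda>n. \<integral>u. f (x n u) \<partial>\<Omega>) \<longlonglongrightarrow> (\<integral>u. f (x0 u) \<partial>\<Omega>)"
    proof (rule integral_dominated_convergence[of _ _ _ "\<lambda>_. B"])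
      show "(\<lambda>u. f (x0 u)) \<in> borel_measurable \<Omega>" by (rule measurable_compose[OF x0_meas f_meas])
      show "(\<lambda>u. f (x n u)) \<in> borel_measurable \<Omega>" for n by (rule measurable_compose[OF x f_meas])
      have "isCont f x" for x using f by (simp add: continuous_on_eq_continuous_at)
      then show "AE u in \<Omega>. (\<lambda>n. f (x n u)) \<longlonglongrightarrow> f (x0 u)"
        by (intro AE_I2) (metis x0 isCont_tendsto_compose)
    qed (use B in auto)
    also have "(\<integral>u. f (x0 u) \<partial>\<Omega>) = (\<integral>x. f x \<partial>distr \<Omega> borel x0)"
      by (rule integral_distr[symmetric, OF x0_meas f_meas])
    also have "(\<lambda>n. \<integral>u. f (x n u) \<partial>\<Omega>) = (\<lambda>n. \<Sum>i\<in>I (r n). w (r n) i * f (z (r n) i))"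
    proof
      fix n
      have gf: "(\<lambda>v. f (g n v)) \<in> borel_measurable borel" by (rule measurable_compose[OF g f_meas])
      have "(\<integral>u. f (x n u) \<partial>\<Omega>) = (\<integral>u. f (g n (Y n u)) \<partial>\<Omega>)"
        by (rule integral_cong_AE[OF measurable_compose[OF x f_meas] measurable_compose[OF Y(1) gf]])
          (use G_AE in \<open>auto simp: x_def elim!: eventually_mono\<close>)
      also have "\<dots> = (\<integral>v. f (g n v) \<partial>\<nu> (r n))"
        unfolding Y(2)[symmetric] by (rule integral_distr[symmetric, OF Y(1) gf])
      also have "\<dots> = (\<integral>i. f (g n (c (z (r n) i))) \<partial>P (r n))"
        unfolding \<nu>_def by (subst integral_distr[OF cz gf]) simp
      also have "\<dots> = (\<Sum>i\<in>I (r n). w (r n) i * f (g n (c (z (r n) i))))"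
        unfolding P_def by (subst lebesgue_integral_point_measure_finite) (use I w in auto)
      also have "\<dots> = (\<Sum>i\<in>I (r n). w (r n) i * f (z (r n) i))"
        by (intro sum.cong) (simp_all add: g_c)
      finally show "(\<integral>u. f (x n u) \<partial>\<Omega>) = (\<Sum>i\<in>I (r n). w (r n) i * f (z (r n) i))" .
    qed
    finally show "(\<lambda>n. \<Sum>i\<in>I (r n). w (r n) i * f (z (r n) i)) \<longlonglongrightarrow> (\<integral>x. f x \<partial>distr \<Omega> borel x0)" .
  qed simp
qed

text \<open>
  The indicator of a closed set is the decreasing limit of \<open>max 0 (1 - n * infdist x A)\<close>, and closed sets
  form a generator stable under intersection.
\<close>

lemma measure_eqI_continuous:
  fixes \<mu> \<nu> :: "'a::metric_space measure"
  assumes \<mu>: "prob_space \<mu>" "sets \<mu> = sets borel" and \<nu>: "prob_space \<nu>" "sets \<nu> = sets borel"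
    and eq: "\<And>f. continuous_on UNIV f \<Longrightarrow> (\<And>x. \<bar>f x\<bar> \<le> 1) \<Longrightarrow> (\<integral>x. f x \<partial>\<mu>) = (\<integral>x. f x \<partial>\<nu> :: real)"
  shows "\<mu> = \<nu>"
proof (rule measure_eqI_generator_eq[of "Collect closed" UNIV _ _ "\<lambda>_. UNIV"])
  show "Int_stable (Collect closed :: 'a set set)" by (auto simp: Int_stable_def)
  show "sets \<mu> = sigma_sets UNIV (Collect closed)" "sets \<nu> = sigma_sets UNIV (Collect closed)"
    using \<mu> \<nu> by (simp_all add: borel_eq_closed)
  show "emeasure \<mu> UNIV \<noteq> \<infinity>"
    using prob_space.finite_measure[OF \<mu>(1)] by (simp add: finite_measure.emeasure_finite)
  fix A :: "'a set" assume "A \<in> Collect closed"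
  then have A: "closed A" by simp
  define f where "f n x = max 0 (1 - real n * infdist x A)" for n x
  have f1: "\<bar>f n x\<bar> \<le> 1" for n x by (auto simp: f_def infdist_nonneg)
  have fc: "continuous_on UNIV (f n)" for n
    unfolding f_def by (intro continuous_intros)
  show "emeasure \<mu> A = emeasure \<nu> A"
  proof (cases "A = {}")
    case False
    have lim: "(\<lambda>n. f n x) \<longlonglongrightarrow> indicator A x" for x
    proof (cases "x \<in> A")
      case True
      then show ?thesis by (simp add: f_def)
    next
      case nx: False
      then have pos: "0 < infdist x A"
        using A False in_closed_iff_infdist_zero[of A x] infdist_nonneg[of x A] by fastforce
      obtain K where K: "1 < real K * infdist x A" using reals_Archimedean3[OF pos] by blast
      have "f n x = 0" if "n \<ge> K" for n
      proof -
        have "real K * infdist x A \<le> real n * infdist x A" using that pos by simp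
        then show ?thesis using K by (simp add: f_def)
      qed
      then have "eventually (\<lambda>n. f n x = 0) sequentially" by (auto simp: eventually_sequentially)
      then show ?thesis using nx by (simp add: tendsto_eventually)
    qed
    have conv: "(\<lambda>n. \<integral>x. f n x \<partial>\<rho>) \<longlonglongrightarrow> measure \<rho> A" if \<rho>: "prob_space \<rho>" "sets \<rho> = sets borel" for \<rho>
    proof -
      interpret prob_space \<rho> by fact
      have "(\<lambda>n. \<integral>x. f n x \<partial>\<rho>) \<longlonglongrightarrow> (\<integral>x. indicator A x \<partial>\<rho>)"
      proof (rule integral_dominated_convergence[of _ _ _ "\<lambda>_. 1"])
        show "f n \<in> borel_measurable \<rho>" for n
          using borel_measurable_continuous_onI[OF fc] \<rho>(2) by (simp cong: measurable_cong_sets)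
      qed (use f1 lim A \<rho>(2) in \<open>auto intro!: borel_measurable_indicator\<close>)
      then show ?thesis using A \<rho>(2) sets_eq_imp_space_eq[OF \<rho>(2)] by simp
    qed
    have "measure \<mu> A = measure \<nu> A"
      using LIMSEQ_unique[OF conv[OF \<mu>]] conv[OF \<nu>] eq[OF fc f1] by simp
    then show ?thesis
      using \<mu>(1) \<nu>(1) by (simp add: finite_measure.emeasure_eq_measure prob_space.finite_measure)
  qed simp
qed auto

section \<open>A variational lower bound for mutual information\<close>

text \<open>
  The Donsker--Varadhan bound for the relative entropy of a joint law \<open>a\<close> with respect to the product of
  its marginals, for functions \<open>h\<close> normalised in the second variable. Termwise it is
  \<open>ln z \<le> z - 1\<close> at \<open>z = pu u * pv v * exp (h u v) / a u v\<close>.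
\<close>

lemma Gibbs_inequality:
  fixes a h :: "'u \<Rightarrow> 'v \<Rightarrow> real"
  assumes A: "finite A" and B: "finite B" and a: "\<And>u v. 0 \<le> a u v" "(\<Sum>u\<in>A. \<Sum>v\<in>B. a u v) = 1"
    and pu: "\<And>u. u \<in> A \<Longrightarrow> pu u = (\<Sum>v\<in>B. a u v)" and pv: "\<And>v. v \<in> B \<Longrightarrow> pv v = (\<Sum>u\<in>A. a u v)"
    and h: "\<And>u. u \<in> A \<Longrightarrow> (\<Sum>v\<in>B. pv v * exp (h u v)) \<le> 1"
  shows "(\<Sum>u\<in>A. \<Sum>v\<in>B. a u v * h u v) \<le> (\<Sum>u\<in>A. \<Sum>v\<in>B. a u v * (ln (a u v) - ln (pu u) - ln (pv v)))"
proof -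
  have pu0: "0 \<le> pu u" if "u \<in> A" for u using a(1) by (simp add: pu[OF that] sum_nonneg)
  have pv0: "0 \<le> pv v" if "v \<in> B" for v using a(1) by (simp add: pv[OF that] sum_nonneg)
  have "a u v * h u v - a u v * (ln (a u v) - ln (pu u) - ln (pv v)) \<le> pu u * pv v * exp (h u v) - a u v"
    if uv: "u \<in> A" "v \<in> B" for u v
  proof (cases "a u v = 0")
    case True
    then show ?thesis using pu0 pv0 uv by simp
  next
    case False
    then have a_pos: "0 < a u v" using a(1)[of u v] by linarith
    have "a u v \<le> pu u" unfolding pu[OF uv(1)] by (rule member_le_sum) (use uv a B in auto)
    moreover have "a u v \<le> pv v" unfolding pv[OF uv(2)] by (rule member_le_sum) (use uv a A in auto)
    ultimately have pos: "0 < pu u" "0 < pv v" using a_pos by linarith+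
    have "ln (pu u * pv v * exp (h u v) / a u v) \<le> pu u * pv v * exp (h u v) / a u v - 1"
      by (rule ln_le_minus_one) (use pos a_pos in simp)
    also have "ln (pu u * pv v * exp (h u v) / a u v) = ln (pu u) + ln (pv v) + h u v - ln (a u v)"
      using pos a_pos by (simp add: ln_div ln_mult)
    finally have "a u v * (ln (pu u) + ln (pv v) + h u v - ln (a u v))
        \<le> a u v * (pu u * pv v * exp (h u v) / a u v - 1)"
      using a_pos by (intro mult_left_mono) auto
    then show ?thesis using a_pos by (simp add: algebra_simps)
  qed
  then have "(\<Sum>u\<in>A. \<Sum>v\<in>B. a u v * h u v - a u v * (ln (a u v) - ln (pu u) - ln (pv v)))
      \<le> (\<Sum>u\<in>A. \<Sum>v\<in>B. pu u * pv v * exp (h u v) - a u v)"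
    by (intro sum_mono)
  also have "\<dots> = (\<Sum>u\<in>A. pu u * (\<Sum>v\<in>B. pv v * exp (h u v))) - 1"
    using a(2) by (simp add: sum_subtractf sum_distrib_left mult.assoc)
  also have "(\<Sum>u\<in>A. pu u * (\<Sum>v\<in>B. pv v * exp (h u v))) \<le> (\<Sum>u\<in>A. pu u * 1)"
    using h pu0 by (intro sum_mono mult_left_mono)
  also have "(\<Sum>u\<in>A. pu u * 1) = 1" using a(2) pu by simp
  finally show ?thesis by (simp add: sum_subtractf)
qed

text \<open>
  The supremum that defines mutual information is at least the contribution of the codes \<open>f\<close> and \<open>g\<close>.
  Written with the joint law of the coded variables it is the relative entropy that the Gibbs inequality
  bounds.
\<close>

lemma mutual_info_lower_bound:
  fixes f :: "'x \<Rightarrow> nat" and g :: "'y \<Rightarrow> nat"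
  assumes P: "prob_space P" and X: "X \<in> P \<rightarrow>\<^sub>M S" and Y: "Y \<in> P \<rightarrow>\<^sub>M R"
    and f: "f \<in> S \<rightarrow>\<^sub>M count_space UNIV" "finite A" "f ` space S \<subseteq> A"
    and g: "g \<in> R \<rightarrow>\<^sub>M count_space UNIV" "finite B" "g ` space R \<subseteq> B"
    and h: "\<And>u. u \<in> A \<Longrightarrow> (\<Sum>v\<in>B. measure P {\<omega>\<in>space P. g (Y \<omega>) = v} * exp (h u v)) \<le> 1"
  shows "ereal (\<integral>\<omega>. h (f (X \<omega>)) (g (Y \<omega>)) \<partial>P) \<le> mutual_info P S R X Y"
proof -
  interpret prob_space P by fact
  have fX: "(\<lambda>\<omega>. f (X \<omega>)) \<in> P \<rightarrow>\<^sub>M count_space UNIV" using X f(1) by (rule measurable_compose)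
  have gY: "(\<lambda>\<omega>. g (Y \<omega>)) \<in> P \<rightarrow>\<^sub>M count_space UNIV" using Y g(1) by (rule measurable_compose)
  have fg: "(\<lambda>\<omega>. (f (X \<omega>), g (Y \<omega>))) \<in> P \<rightarrow>\<^sub>M count_space UNIV"
    using measurable_Pair[OF fX gY] by (simp add: pair_measure_countable)
  have subA: "f (X \<omega>) \<in> A" if "\<omega> \<in> space P" for \<omega> using measurable_space[OF X that] f(3) by auto
  have subB: "g (Y \<omega>) \<in> B" if "\<omega> \<in> space P" for \<omega> using measurable_space[OF Y that] g(3) by auto
  define E where "E u v = {\<omega>\<in>space P. f (X \<omega>) = u \<and> g (Y \<omega>) = v}" for u v
  define a where "a u v = measure P (E u v)" for u v
  define pu where "pu u = measure P {\<omega>\<in>space P. f (X \<omega>) = u}" for u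
  define pv where "pv v = measure P {\<omega>\<in>space P. g (Y \<omega>) = v}" for v
  have E: "E u v \<in> sets P" for u v
    using measurable_sets[OF fg, of "{(u, v)}"] by (simp add: E_def vimage_def Int_def conj_commute)
  have pu: "pu u = (\<Sum>v\<in>B. a u v)" for u
  proof -
    have "{\<omega>\<in>space P. f (X \<omega>) = u} = (\<Union>v\<in>B. E u v)" using subB by (auto simp: E_def)
    then show ?thesis unfolding pu_def a_def
      using E by (simp only:, intro finite_measure_finite_Union g(2)) (auto simp: disjoint_family_on_def E_def)
  qed
  have pv: "pv v = (\<Sum>u\<in>A. a u v)" for v
  proof -
    have "{\<omega>\<in>space P. g (Y \<omega>) = v} = (\<Union>u\<in>A. E u v)" using subA by (auto simp: E_def)
    then show ?thesis unfolding pv_def a_def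
      using E by (simp only:, intro finite_measure_finite_Union f(2)) (auto simp: disjoint_family_on_def E_def)
  qed
  have split: "\<phi> (f (X \<omega>)) (g (Y \<omega>)) = (\<Sum>u\<in>A. \<Sum>v\<in>B. \<phi> u v * indicator (E u v) \<omega>)"
    if "\<omega> \<in> space P" for \<omega> and \<phi> :: "nat \<Rightarrow> nat \<Rightarrow> real"
  proof -
    have "(\<Sum>u\<in>A. \<Sum>v\<in>B. \<phi> u v * indicator (E u v) \<omega>)
        = (\<Sum>u\<in>A. \<Sum>v\<in>B. if f (X \<omega>) = u then if g (Y \<omega>) = v then \<phi> u v else 0 else 0)"
      using that by (intro sum.cong refl) (auto simp: E_def indicator_def)
    also have "\<dots> = (\<Sum>u\<in>A. if f (X \<omega>) = u then \<Sum>v\<in>B. if g (Y \<omega>) = v then \<phi> u v else 0 else 0)"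
      by (intro sum.cong refl) auto
    also have "\<dots> = \<phi> (f (X \<omega>)) (g (Y \<omega>))"
      using f(2) g(2) subA[OF that] subB[OF that] by simp
    finally show ?thesis by simp
  qed
  have int: "(\<integral>\<omega>. \<phi> (f (X \<omega>)) (g (Y \<omega>)) \<partial>P) = (\<Sum>u\<in>A. \<Sum>v\<in>B. a u v * \<phi> u v)" for \<phi> :: "nat \<Rightarrow> nat \<Rightarrow> real"
  proof -
    have "(\<integral>\<omega>. \<phi> (f (X \<omega>)) (g (Y \<omega>)) \<partial>P) = (\<integral>\<omega>. (\<Sum>u\<in>A. \<Sum>v\<in>B. \<phi> u v * indicator (E u v) \<omega>) \<partial>P)"
      using split by (intro Bochner_Integration.integral_cong) auto
    also have "\<dots> = (\<Sum>u\<in>A. \<Sum>v\<in>B. a u v * \<phi> u v)"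
      using E by (subst Bochner_Integration.integral_sum;
        (subst Bochner_Integration.integral_sum)?) (auto simp: a_def mult.commute emeasure_eq_measure intro!: sum.cong)
    finally show ?thesis .
  qed
  have a1: "(\<Sum>u\<in>A. \<Sum>v\<in>B. a u v) = 1" using int[of "\<lambda>_ _. 1"] by (simp add: prob_space)
  have entX: "shannon_entropy P (\<lambda>\<omega>. f (X \<omega>)) = - (\<Sum>u\<in>A. pu u * ln (pu u))"
    using subA by (subst shannon_entropy_eq[OF P fX f(2)])
      (auto simp: measure_distr[OF fX] pu_def vimage_def Int_def conj_commute intro!: sum.cong)
  have entY: "shannon_entropy P (\<lambda>\<omega>. g (Y \<omega>)) = - (\<Sum>v\<in>B. pv v * ln (pv v))"
    using subB by (subst shannon_entropy_eq[OF P gY g(2)])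
      (auto simp: measure_distr[OF gY] pv_def vimage_def Int_def conj_commute intro!: sum.cong)
  have entXY: "shannon_entropy P (\<lambda>\<omega>. (f (X \<omega>), g (Y \<omega>))) = - (\<Sum>u\<in>A. \<Sum>v\<in>B. a u v * ln (a u v))"
    using subA subB by (subst shannon_entropy_eq[OF P fg finite_cartesian_product[OF f(2) g(2)]])
      (auto simp: measure_distr[OF fg] a_def E_def vimage_def Int_def conj_commute sum.cartesian_product
        intro!: sum.cong)
  have "(\<Sum>u\<in>A. \<Sum>v\<in>B. a u v * (ln (a u v) - ln (pu u) - ln (pv v)))
      = (\<Sum>u\<in>A. \<Sum>v\<in>B. a u v * ln (a u v)) - (\<Sum>u\<in>A. \<Sum>v\<in>B. a u v * ln (pu u))
        - (\<Sum>u\<in>A. \<Sum>v\<in>B. a u v * ln (pv v))"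
    by (simp add: right_diff_distrib sum_subtractf)
  also have "(\<Sum>u\<in>A. \<Sum>v\<in>B. a u v * ln (pu u)) = (\<Sum>u\<in>A. pu u * ln (pu u))"
    by (simp add: pu sum_distrib_right)
  also have "(\<Sum>u\<in>A. \<Sum>v\<in>B. a u v * ln (pv v)) = (\<Sum>v\<in>B. pv v * ln (pv v))"
    by (subst sum.swap) (simp add: pv sum_distrib_right)
  finally have "(\<integral>\<omega>. h (f (X \<omega>)) (g (Y \<omega>)) \<partial>P)
      \<le> shannon_entropy P (\<lambda>\<omega>. f (X \<omega>)) + shannon_entropy P (\<lambda>\<omega>. g (Y \<omega>))
        - shannon_entropy P (\<lambda>\<omega>. (f (X \<omega>), g (Y \<omega>)))"
    using Gibbs_inequality[OF f(2) g(2) _ a1 pu pv, of h] h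
    unfolding int entX entY entXY pv_def[symmetric] by (simp add: a_def)
  also have "ereal \<dots> \<le> mutual_info P S R X Y"
    unfolding mutual_info_def
    by (rule SUP_upper2[of "(f, g)"]) (use f g in \<open>auto intro: finite_subset\<close>)
  finally show ?thesis by simp
qed

section \<open>Metric and coding in a compact system\<close>

locale compact_dynamics =
  fixes T :: "'a::metric_space \<Rightarrow> 'a" and d :: "'a \<Rightarrow> 'a \<Rightarrow> real"
  assumes compact_space: "compact (UNIV :: 'a set)"
    and T: "continuous_on UNIV T"
    and d: "d \<in> compatible_metrics"
begin

lemma Metric_space_d: "Metric_space UNIV d"
  using d by (simp add: compatible_metrics_def)

lemma d_nonneg: "0 \<le> d x y" and d_commute: "d x y = d y x" and d_refl: "d x x = 0"
  and d_triangle: "d x z \<le> d x y + d y z"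
  using Metric_space.nonneg[OF Metric_space_d] Metric_space.commute[OF Metric_space_d]
    Metric_space.zero[OF Metric_space_d] Metric_space.triangle[OF Metric_space_d]
  by auto

lemma open_d_ball: "open {x. d x z < r}"
proof -
  have "openin (Metric_space.mtopology UNIV d) (Metric_space.mball UNIV d z r)"
    by (rule Metric_space.openin_mball[OF Metric_space_d])
  moreover have "Metric_space.mball UNIV d z r = {x. d x z < r}"
    by (auto simp: Metric_space.mball_def[OF Metric_space_d] d_commute)
  ultimately show ?thesis using d by (simp add: compatible_metrics_def)
qed

lemma continuous_on_d: "continuous_on UNIV (\<lambda>x. d x y)"
proof (rule continuous_at_imp_continuous_on, intro ballI)
  fix x0
  have "\<forall>\<^sub>F x in at x0. dist (d x y) (d x0 y) < e" if "0 < e" for e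
    unfolding eventually_at_topological
  proof (intro exI[of _ "{x. d x x0 < e}"] conjI ballI impI)
    fix x assume "x \<in> {x. d x x0 < e}"
    then show "dist (d x y) (d x0 y) < e"
      using d_triangle[of x y x0] d_triangle[of x0 y x] d_commute[of x x0] by (simp add: dist_real_def)
  qed (use open_d_ball that in \<open>auto simp: d_refl\<close>)
  then show "isCont (\<lambda>x. d x y) x0" unfolding isCont_def by (rule tendstoI)
qed

lemma continuous_on_funpow: "continuous_on UNIV (T ^^ k)"
proof (induction k)
  case (Suc k)
  then show ?case using continuous_on_compose[OF Suc, of T] T continuous_on_subset by (auto simp: comp_def)
qed (simp add: id_def)

lemma continuous_on_compose_funpow:
  assumes "continuous_on UNIV f"
  shows "continuous_on UNIV (\<lambda>x. f ((T ^^ k) x))"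
  using continuous_on_compose2[OF assms continuous_on_funpow] by simp

lemma funpow_measurable: "T ^^ k \<in> borel_measurable borel"
  by (rule borel_measurable_continuous_onI[OF continuous_on_funpow])

lemma continuous_bounded:
  fixes f :: "'a \<Rightarrow> real"
  assumes "continuous_on UNIV f"
  obtains B where "0 \<le> B" "\<And>x. \<bar>f x\<bar> \<le> B"
proof -
  have "bounded (range f)" by (rule compact_imp_bounded[OF compact_continuous_image[OF assms compact_space]])
  then obtain B where B: "\<And>x. norm (f x) \<le> B" by (auto simp: bounded_iff)
  have "0 \<le> B" using B[of undefined] norm_ge_zero[of "f undefined"] by linarith
  then show thesis using B by (intro that[of B]) auto
qed

lemma integrable_continuous:
  assumes "prob_space \<mu>" "sets \<mu> = sets borel" "continuous_on UNIV (f :: 'a \<Rightarrow> real)"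
  shows "integrable \<mu> f"
proof -
  interpret prob_space \<mu> by fact
  obtain B where B: "\<And>x. \<bar>f x\<bar> \<le> B" using continuous_bounded[OF assms(3)] by blast
  show ?thesis
  proof (rule integrable_const_bound[of _ B])
    show "f \<in> borel_measurable \<mu>"
      using borel_measurable_continuous_onI[OF assms(3)] assms(2) by (simp cong: measurable_cong_sets)
  qed (use B in auto)
qed

lemma d_bounded: obtains B where "\<And>x y. d x y \<le> B"
proof -
  obtain B where B: "\<And>x. \<bar>d x undefined\<bar> \<le> B" using continuous_bounded[OF continuous_on_d] by blast
  have "d x y \<le> B + B" for x y
    using d_triangle[of x y undefined] B[of x] B[of y] d_commute[of y undefined] by linarith
  then show thesis by (rule that)
qed

lemma d_code:
  assumes "0 < \<epsilon>"
  obtains p :: "'a \<Rightarrow> nat" and r m where "p \<in> borel \<rightarrow>\<^sub>M count_space UNIV" "\<And>x. p x < m"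
    "\<And>x. d x (r (p x)) < \<epsilon>"
proof (rule finite_measurable_code[OF compact_space, of "\<lambda>z. {x. d x z < \<epsilon>}"])
  show "open {x. d x z < \<epsilon>}" for z by (rule open_d_ball)
  show "z \<in> {x. d x z < \<epsilon>}" for z using assms by (simp add: d_refl)
  fix p :: "'a \<Rightarrow> nat" and r m
  assume "p \<in> borel \<rightarrow>\<^sub>M count_space UNIV" "\<And>x. p x < m" "\<And>x. x \<in> {xa. d xa (r (p x)) < \<epsilon>}"
  then show thesis by (intro that[of p m r]) auto
qed

text \<open>
  A finite measurable partition whose cells are small for the orbit metric, presented by the index
  \<open>p x\<close> of the cell and a point \<open>r (p x)\<close> that represents it.
\<close>

lemma orbit_code:
  assumes "0 < \<epsilon>"
  obtains p :: "'a \<Rightarrow> nat" and r m where "p \<in> borel \<rightarrow>\<^sub>M count_space UNIV" "\<And>x. p x < m"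
    "\<And>x k. k < n \<Longrightarrow> d ((T ^^ k) x) ((T ^^ k) (r (p x))) < \<epsilon>"
proof (rule finite_measurable_code[OF compact_space, of "\<lambda>z. \<Inter>k<n. {x. d ((T ^^ k) x) ((T ^^ k) z) < \<epsilon>}"])
  have "open ((T ^^ k) -` {x. d x ((T ^^ k) z) < \<epsilon>})" for z k
    using continuous_on_open_vimage[OF open_UNIV, of "T ^^ k"] continuous_on_funpow open_d_ball
    by (metis inf_top.right_neutral)
  then show "open (\<Inter>k<n. {x. d ((T ^^ k) x) ((T ^^ k) z) < \<epsilon>})" for z by (auto simp: vimage_def)
  show "z \<in> (\<Inter>k<n. {x. d ((T ^^ k) x) ((T ^^ k) z) < \<epsilon>})" for z using assms by (simp add: d_refl)
  fix p :: "'a \<Rightarrow> nat" and r m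
  assume "p \<in> borel \<rightarrow>\<^sub>M count_space UNIV" "\<And>x. p x < m"
    "\<And>x. x \<in> (\<Inter>k<n. {xa. d ((T ^^ k) xa) ((T ^^ k) (r (p x))) < \<epsilon>})"
  then show thesis by (intro that[of p m r]) auto
qed

text \<open>
  Continuity of \<open>d\<close> concerns open sets of the product space, while \<open>X\<close> and \<open>Y\<close> are measurable
  separately. Replacing both by approximations with finitely many values bridges the two.
\<close>

lemma d_measurable:
  assumes X: "X \<in> borel_measurable P" and Y: "Y \<in> borel_measurable P"
  shows "(\<lambda>\<omega>. d (X \<omega>) (Y \<omega>)) \<in> borel_measurable P"
proof -
  have "\<exists>p :: 'a \<Rightarrow> nat. \<exists>r. p \<in> borel \<rightarrow>\<^sub>M count_space UNIV \<and> (\<forall>x. d x (r (p x)) < 1 / real (Suc j))" for j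
    using d_code[of "1 / real (Suc j)"] by (metis of_nat_0_less_iff zero_less_Suc zero_less_divide_1_iff)
  then obtain p :: "nat \<Rightarrow> 'a \<Rightarrow> nat" and r where p: "\<And>j. p j \<in> borel \<rightarrow>\<^sub>M count_space UNIV"
    and r: "\<And>j x. d x (r j (p j x)) < 1 / real (Suc j)" by metis
  show ?thesis
  proof (rule borel_measurable_LIMSEQ_real)
    fix j
    have "(\<lambda>\<omega>. (p j (X \<omega>), p j (Y \<omega>))) \<in> P \<rightarrow>\<^sub>M count_space UNIV"
      using measurable_Pair[OF measurable_compose[OF X p] measurable_compose[OF Y p]]
      by (simp add: pair_measure_countable)
    from measurable_compose[OF this, of "\<lambda>(a, b). d (r j a) (r j b)" borel]
    show "(\<lambda>\<omega>. d (r j (p j (X \<omega>))) (r j (p j (Y \<omega>)))) \<in> borel_measurable P" by simp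
  next
    fix \<omega>
    show "(\<lambda>j. d (r j (p j (X \<omega>))) (r j (p j (Y \<omega>)))) \<longlonglongrightarrow> d (X \<omega>) (Y \<omega>)"
    proof (rule LIMSEQ_I)
      fix e :: real assume "0 < e"
      then obtain j0 where j0: "1 / real (Suc j0) < e / 2" using nat_approx_posE[of "e / 2"] by (auto simp: inverse_eq_divide)
      have "norm (d (r j (p j (X \<omega>))) (r j (p j (Y \<omega>))) - d (X \<omega>) (Y \<omega>)) < e" if "j \<ge> j0" for j
      proof -
        have "1 / real (Suc j) \<le> 1 / real (Suc j0)" using that by (simp add: frac_le)
        moreover have "\<bar>d x' y' - d x y\<bar> \<le> d x x' + d y y'" for x y x' y'
          using d_triangle[of x' y' x] d_triangle[of x y' y] d_triangle[of x y x'] d_triangle[of x' y y']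
            d_commute[of x x'] d_commute[of y y'] by linarith
        from this[of "r j (p j (X \<omega>))" "r j (p j (Y \<omega>))" "X \<omega>" "Y \<omega>"]
        show ?thesis using r[of "X \<omega>" j] r[of "Y \<omega>" j] j0 calculation by simp
      qed
      then show "\<exists>j0. \<forall>j\<ge>j0. norm (d (r j (p j (X \<omega>))) (r j (p j (Y \<omega>))) - d (X \<omega>) (Y \<omega>)) < e" by blast
    qed
  qed
qed

lemma cover_number_attained:
  assumes "0 < \<epsilon>"
  obtains \<U> :: "'a set set" where "finite \<U>" "card \<U> = cover_number d \<epsilon>" "\<Union>\<U> = UNIV"
    "\<And>U x y. U \<in> \<U> \<Longrightarrow> x \<in> U \<Longrightarrow> y \<in> U \<Longrightarrow> d x y < \<epsilon>"
proof -
  define Q where "Q n \<longleftrightarrow> (\<exists>\<U>. finite \<U> \<and> card \<U> = n \<and>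
     (\<forall>U\<in>\<U>. open (U :: 'a set) \<and> diam_wrt d U < \<epsilon>) \<and> \<Union>\<U> = UNIV)" for n
  have "UNIV \<subseteq> (\<Union>z. {x. d x z < \<epsilon> / 3})" using assms by (auto intro!: exI simp: d_refl)
  from compactE_image[OF compact_space, of UNIV "\<lambda>z. {x. d x z < \<epsilon> / 3}", OF open_d_ball this]
  obtain Z where Z: "finite Z" "UNIV \<subseteq> (\<Union>z\<in>Z. {x. d x z < \<epsilon> / 3})" by metis
  have "diam_wrt d {x. d x z < \<epsilon> / 3} < \<epsilon>" for z
  proof -
    have "{x. d x z < \<epsilon> / 3} \<noteq> {}" using assms by (auto intro!: exI[of _ z] simp: d_refl)
    moreover have "(SUP (x, y)\<in>{x. d x z < \<epsilon> / 3} \<times> {x. d x z < \<epsilon> / 3}. d x y) \<le> 2 * \<epsilon> / 3"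
    proof (rule cSUP_least)
      fix q assume "q \<in> {x. d x z < \<epsilon> / 3} \<times> {x. d x z < \<epsilon> / 3}"
      then show "(case q of (x, y) \<Rightarrow> d x y) \<le> 2 * \<epsilon> / 3"
        using d_triangle[of "fst q" "snd q" z] d_commute[of "snd q" z] by auto
    qed (use \<open>{x. d x z < \<epsilon> / 3} \<noteq> {}\<close> in auto)
    ultimately show ?thesis using assms by (simp add: diam_wrt_def)
  qed
  then have "Q (card ((\<lambda>z. {x. d x z < \<epsilon> / 3}) ` Z))"
    unfolding Q_def using Z open_d_ball by (intro exI[of _ "(\<lambda>z. {x. d x z < \<epsilon> / 3}) ` Z"]) blast
  then have "Q (cover_number d \<epsilon>)" unfolding cover_number_def Q_def[symmetric] by (rule LeastI)
  then obtain \<U> where \<U>: "finite \<U>" "card \<U> = cover_number d \<epsilon>" "\<Union>\<U> = UNIV"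
    "\<And>U. U \<in> \<U> \<Longrightarrow> diam_wrt d U < \<epsilon>" unfolding Q_def by blast
  obtain B where B: "\<And>x y. d x y \<le> B" using d_bounded by blast
  have "d x y < \<epsilon>" if "U \<in> \<U>" "x \<in> U" "y \<in> U" for U x y
  proof -
    have "d x y \<le> (SUP (x, y)\<in>U \<times> U. d x y)"
      by (rule cSUP_upper2[where x = "(x, y)"]) (use that B in \<open>auto intro!: bdd_aboveI2\<close>)
    then show ?thesis using \<U>(4)[OF that(1)] that by (auto simp: diam_wrt_def split: if_splits)
  qed
  then show thesis using that \<U> by blast
qed

lemma cover_number_pos: "0 < \<epsilon> \<Longrightarrow> 0 < cover_number d \<epsilon>"
  using cover_number_attained[of \<epsilon>] by (metis UNIV_not_empty Union_empty card_gt_0_iff)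

end

section \<open>Free energy along orbits\<close>

context compact_dynamics
begin

text \<open>
  The partition function of an orbit segment. Here \<open>L\<close> bounds the logarithm of the covering number.
  For \<open>k \<in> J\<close> the factor \<open>exp (- d (T\<^bsup>k\<^esup> x) (y k) / \<epsilon>)\<close> is at most \<open>1\<close> if the distance is at most
  \<open>L \<epsilon>\<close>, and at most \<open>exp (- L)\<close> otherwise. In the second case the point lies in one of at most
  \<open>exp L\<close> cells, so the weights of the two cases sum to at most \<open>2\<close>. At the other times, which
  the exponent does not control, a cell is chosen at the price of the full covering number. Each choice of cases
  confines \<open>x\<close> to a set of orbit diameter at most \<open>2 L \<epsilon>\<close>. This is how an average
  distance is compared with the maximum that defines the orbit metric.
\<close>

lemma exp_average_le:
  assumes \<epsilon>: "0 < \<epsilon>" and L: "1 \<le> L" "ln (real (cover_number d \<epsilon>)) \<le> L"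
    and F: "finite F" and \<nu>: "\<And>x. 0 \<le> \<nu> x" and J: "J \<subseteq> {..<N}"
    and b: "\<And>E. (\<And>x y k. x \<in> E \<Longrightarrow> y \<in> E \<Longrightarrow> k < N \<Longrightarrow> d ((T ^^ k) x) ((T ^^ k) y) \<le> 2 * L * \<epsilon>) \<Longrightarrow>
      sum \<nu> (F \<inter> E) \<le> b"
  shows "(\<Sum>x\<in>F. \<nu> x * exp (- (\<Sum>k\<in>J. d ((T ^^ k) x) (y k)) / \<epsilon>))
    \<le> real (cover_number d \<epsilon>) ^ (N - card J) * 2 ^ card J * b"
proof -
  obtain \<U> where \<U>: "finite \<U>" "card \<U> = cover_number d \<epsilon>" "\<Union>\<U> = UNIV"
    "\<And>U x y. U \<in> \<U> \<Longrightarrow> x \<in> U \<Longrightarrow> y \<in> U \<Longrightarrow> d x y < \<epsilon>"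
    using cover_number_attained[OF \<epsilon>] by blast
  \<comment> \<open>\<open>None\<close> stands for the ball around \<open>y k\<close>, and \<open>Some U\<close> for the cell \<open>U\<close>\<close>
  define W where "W = insert None (Some ` \<U>)"
  define c :: "nat \<Rightarrow> 'a set option \<Rightarrow> real" where
    "c k w = (if k \<in> J then (case w of None \<Rightarrow> 1 | Some U \<Rightarrow> exp (- L)) else (case w of None \<Rightarrow> 0 | Some U \<Rightarrow> 1))" for k w
  define in_cell :: "nat \<Rightarrow> 'a set option \<Rightarrow> 'a \<Rightarrow> bool" where
    "in_cell k w x = (case w of None \<Rightarrow> d ((T ^^ k) x) (y k) \<le> L * \<epsilon> | Some U \<Rightarrow> (T ^^ k) x \<in> U)" for k w x
  have sumW: "(\<Sum>w\<in>W. \<phi> w) = \<phi> None + (\<Sum>U\<in>\<U>. \<phi> (Some U))" for \<phi> :: "'a set option \<Rightarrow> real"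
    using \<U>(1) by (simp add: W_def sum.reindex)
  have pointwise: "(if k \<in> J then exp (- d ((T ^^ k) x) (y k) / \<epsilon>) else 1)
      \<le> (\<Sum>w\<in>W. c k w * of_bool (in_cell k w x))" for k x
  proof -
    obtain U where U: "U \<in> \<U>" "(T ^^ k) x \<in> U" using \<U>(3) by blast
    have *: "0 \<le> c k w * of_bool (in_cell k w x)" for w by (auto simp: c_def split: option.splits)
    have sU: "c k (Some U) * of_bool (in_cell k (Some U) x) \<le> (\<Sum>w\<in>W. c k w * of_bool (in_cell k w x))"
      by (rule member_le_sum) (use * U \<U>(1) in \<open>auto simp: W_def\<close>)
    have sN: "c k None * of_bool (in_cell k None x) \<le> (\<Sum>w\<in>W. c k w * of_bool (in_cell k w x))"
      by (rule member_le_sum) (use * \<U>(1) in \<open>auto simp: W_def\<close>)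
    show ?thesis
    proof (cases "k \<in> J")
      case True
      show ?thesis
      proof (cases "d ((T ^^ k) x) (y k) \<le> L * \<epsilon>")
        case le: True
        have "exp (- d ((T ^^ k) x) (y k) / \<epsilon>) \<le> 1" using d_nonneg \<epsilon> by simp
        also have "1 \<le> (\<Sum>w\<in>W. c k w * of_bool (in_cell k w x))"
          using sN le True by (simp add: c_def[of _ None] in_cell_def[of _ None])
        finally show ?thesis using True by simp
      next
        case False
        then have "exp (- d ((T ^^ k) x) (y k) / \<epsilon>) \<le> exp (- L)" using \<epsilon> by (simp add: field_simps)
        also have "exp (- L) \<le> (\<Sum>w\<in>W. c k w * of_bool (in_cell k w x))"
          using sU U True by (simp add: c_def[of _ "Some _"] in_cell_def[of _ "Some _"])
        finally show ?thesis using True by simp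
      qed
    next
      case False
      then show ?thesis using sU U by (simp add: c_def in_cell_def)
    qed
  qed
  have "(\<Sum>x\<in>F. \<nu> x * exp (- (\<Sum>k\<in>J. d ((T ^^ k) x) (y k)) / \<epsilon>))
      = (\<Sum>x\<in>F. \<nu> x * (\<Prod>k<N. if k \<in> J then exp (- d ((T ^^ k) x) (y k) / \<epsilon>) else 1))"
  proof (intro sum.cong refl arg_cong2[where f = "(*)"])
    fix x
    have "finite J" using J finite_subset by blast
    then have "exp (- (\<Sum>k\<in>J. d ((T ^^ k) x) (y k)) / \<epsilon>) = (\<Prod>k\<in>J. exp (- d ((T ^^ k) x) (y k) / \<epsilon>))"
      by (simp add: exp_sum[symmetric] sum_negf sum_divide_distrib)
    also have "\<dots> = (\<Prod>k<N. if k \<in> J then exp (- d ((T ^^ k) x) (y k) / \<epsilon>) else 1)"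
      using J by (simp add: prod.If_cases Int_absorb1)
    finally show "exp (- (\<Sum>k\<in>J. d ((T ^^ k) x) (y k)) / \<epsilon>) = \<dots>" .
  qed
  also have "\<dots> \<le> (\<Sum>x\<in>F. \<nu> x * (\<Prod>k<N. \<Sum>w\<in>W. c k w * of_bool (in_cell k w x)))"
    using \<nu> pointwise by (intro sum_mono mult_left_mono prod_mono) auto
  also have "\<dots> \<le> (\<Prod>k<N. \<Sum>w\<in>W. c k w) * b"
  proof (rule sum_prod_mixture_le)
    show "0 \<le> c k w" for k w by (auto simp: c_def split: option.splits)
    fix p assume p: "p \<in> {..<N} \<rightarrow>\<^sub>E W"
    define E where "E = {x. \<forall>k<N. in_cell k (p k) x}"
    have "(\<Prod>k<N. of_bool (in_cell k (p k) x) :: real) = of_bool (x \<in> E)" for x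
      by (auto simp: E_def)
    then have "(\<Sum>x\<in>F. \<nu> x * (\<Prod>k<N. of_bool (in_cell k (p k) x))) = (\<Sum>x\<in>F. \<nu> x * of_bool (x \<in> E))"
      by (simp only:)
    also have "\<dots> = sum \<nu> (F \<inter> E)"
      using F by (simp add: sum.inter_restrict of_bool_def if_distrib cong: if_cong)
    also have "\<dots> \<le> b"
    proof (rule b)
      fix x x' k assume x: "x \<in> E" "x' \<in> E" and k: "k < N"
      have cell: "in_cell k (p k) x" "in_cell k (p k) x'" using x k by (auto simp: E_def)
      have "p k \<in> W" using p k by auto
      then consider "p k = None" | U where "U \<in> \<U>" "p k = Some U" by (auto simp: W_def)
      then show "d ((T ^^ k) x) ((T ^^ k) x') \<le> 2 * L * \<epsilon>"
      proof cases
        case 1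
        then show ?thesis using cell d_triangle[of "(T ^^ k) x" "(T ^^ k) x'" "y k"] d_commute[of "y k" "(T ^^ k) x'"]
          by (simp add: in_cell_def)
      next
        case 2
        then have "d ((T ^^ k) x) ((T ^^ k) x') < \<epsilon>" using cell \<U>(4) by (simp add: in_cell_def)
        also have "\<epsilon> \<le> 2 * L * \<epsilon>" using L \<epsilon> by simp
        finally show ?thesis by simp
      qed
    qed
    finally show "(\<Sum>x\<in>F. \<nu> x * (\<Prod>k<N. of_bool (in_cell k (p k) x))) \<le> b" .
  qed (use \<U>(1) in \<open>auto simp: W_def\<close>)
  also have "\<dots> \<le> (real (cover_number d \<epsilon>) ^ (N - card J) * 2 ^ card J) * b"
  proof (rule mult_right_mono)
    have "(\<Prod>k<N. \<Sum>w\<in>W. c k w) \<le> (\<Prod>k<N. if k \<in> J then 2 else real (cover_number d \<epsilon>))"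
    proof (rule prod_mono, intro conjI)
      fix k
      show "0 \<le> (\<Sum>w\<in>W. c k w)" by (intro sum_nonneg) (auto simp: c_def split: option.splits)
      have "real (cover_number d \<epsilon>) \<le> exp L"
        using L(2) cover_number_pos[OF \<epsilon>] by (simp add: ln_le_cancel_iff[symmetric] del: ln_le_cancel_iff)
      then have "real (cover_number d \<epsilon>) * exp (- L) \<le> 1" by (simp add: exp_minus field_simps)
      then show "(\<Sum>w\<in>W. c k w) \<le> (if k \<in> J then 2 else real (cover_number d \<epsilon>))"
        by (simp add: sumW c_def \<U>(2))
    qed
    also have "\<dots> = real (cover_number d \<epsilon>) ^ (N - card J) * 2 ^ card J"
      using J by (simp add: prod.If_cases Int_absorb1 Diff_eq[symmetric] card_Diff_subset finite_subset mult.commute)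
    finally show "(\<Prod>k<N. \<Sum>w\<in>W. c k w) \<le> \<dots>" .
    show "0 \<le> b" using b[of "{}"] by simp
  qed
  finally show ?thesis by simp
qed

text \<open>
  For each offset \<open>j < n\<close> cut the segment \<open>[0, N)\<close> into blocks of length \<open>n\<close> that start at
  \<open>j\<close> modulo \<open>n\<close>. The product of the block partition functions is that of the product law on
  sequences of words, so Jensen's inequality and the uniform bound of \<open>exp_average_le\<close> apply. Summing
  over the offsets gives the full Birkhoff sum; the at most \<open>2 n\<close> times outside the blocks account for
  the term with the covering number.
\<close>

lemma Birkhoff_free_energy_ge:
  fixes y :: "'v \<Rightarrow> nat \<Rightarrow> 'a"
  assumes \<epsilon>: "0 < \<epsilon>" and L: "1 \<le> L" "ln (real (cover_number d \<epsilon>)) \<le> L"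
    and F: "finite F" and \<nu>: "\<And>x. 0 \<le> \<nu> x" "sum \<nu> F = 1" and b0: "0 < b"
    and b: "\<And>E. (\<And>x y k. x \<in> E \<Longrightarrow> y \<in> E \<Longrightarrow> k < N \<Longrightarrow> d ((T ^^ k) x) ((T ^^ k) y) \<le> 2 * L * \<epsilon>) \<Longrightarrow>
      sum \<nu> (F \<inter> E) \<le> b"
    and V: "finite V" and q: "\<And>v. v \<in> V \<Longrightarrow> 0 \<le> q v" "sum q V = 1" and n: "1 \<le> n"
  defines "g \<equiv> \<lambda>x. \<Sum>v\<in>V. q v * exp (- (\<Sum>k<n. d ((T ^^ k) x) (y v k)) / \<epsilon>)"
  shows "- real n * (2 * real n * ln (real (cover_number d \<epsilon>)) + real N * ln 2 + ln b)
    \<le> (\<Sum>x\<in>F. \<nu> x * (\<Sum>k<N. - ln (g ((T ^^ k) x))))"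
proof -
  \<comment> \<open>one block fewer than fits, so that all \<open>n\<close> offsets stay inside the segment\<close>
  define M where "M = N div n - 1"
  have N_eq: "N = N div n * n + N mod n" and mod: "N mod n < n" using n by auto
  have MN: "M * n \<le> N" and Mn: "N - M * n \<le> 2 * n"
  proof -
    show "M * n \<le> N" unfolding M_def by (meson diff_le_self div_times_less_eq_dividend mult_le_mono1 order_trans)
    show "N - M * n \<le> 2 * n"
      using N_eq mod unfolding M_def by (cases "N div n") (auto simp: diff_mult_distrib)
  qed
  have in_range: "{j..<j + M * n} \<subseteq> {..<N}" if "j < n" for j
  proof (cases "M = 0")
    case False
    then have "M * n + n \<le> N" using N_eq unfolding M_def by (cases "N div n") auto
    then show ?thesis using that by auto
  qed simp
  have g_pos: "0 < g x" and g_le: "g x \<le> 1" for x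
  proof -
    show "0 < g x" unfolding g_def by (rule convex_combination_pos[OF V q]) simp_all
    have "g x \<le> (\<Sum>v\<in>V. q v * 1)"
      unfolding g_def using q \<epsilon> d_nonneg by (intro sum_mono mult_left_mono) (auto intro!: divide_nonneg_pos sum_nonneg)
    then show "g x \<le> 1" using q by simp
  qed
  define cn where "cn = real (cover_number d \<epsilon>)"
  have cn: "1 \<le> cn" using cover_number_pos[OF \<epsilon>] by (simp add: cn_def)
  define b' where "b' = cn ^ (N - M * n) * 2 ^ (M * n) * b"
  have b'0: "0 < b'" using cn b0 by (simp add: b'_def)
  have block_le: "(\<Sum>x\<in>F. \<nu> x * (\<Prod>i<M. g ((T ^^ (i * n + j)) x))) \<le> b'" if j: "j < n" for j
  proof -
    have "(\<Sum>x\<in>F. \<nu> x * (\<Prod>i<M. g ((T ^^ (i * n + j)) x)))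
      \<le> (\<Prod>i<M. \<Sum>v\<in>V. q v) * b'"
      unfolding g_def
    proof (rule sum_prod_mixture_le)
      fix p assume "p \<in> {..<M} \<rightarrow>\<^sub>E V"
      \<comment> \<open>the concatenation of the words selected by \<open>p\<close>\<close>
      define y' where "y' k = y (p ((k - j) div n)) ((k - j) mod n)" for k
      have "(\<Sum>x\<in>F. \<nu> x * (\<Prod>i<M. exp (- (\<Sum>k<n. d ((T ^^ k) ((T ^^ (i * n + j)) x)) (y (p i) k)) / \<epsilon>)))
        = (\<Sum>x\<in>F. \<nu> x * exp (- (\<Sum>k\<in>{j..<j + M * n}. d ((T ^^ k) x) (y' k)) / \<epsilon>))"
      proof (intro sum.cong refl arg_cong2[where f = "(*)"])
        fix x
        have "(\<Sum>k\<in>{j..<j + M * n}. d ((T ^^ k) x) (y' k)) = (\<Sum>k<M * n. d ((T ^^ (j + k)) x) (y' (j + k)))"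
          by (subst sum.atLeastLessThan_shift_0) (simp add: atLeast0LessThan)
        also have "\<dots> = (\<Sum>i<M. \<Sum>k<n. d ((T ^^ k) ((T ^^ (i * n + j)) x)) (y (p i) k))"
          unfolding sum_lessThan_blocks
        proof (intro sum.cong refl)
          fix i k assume "k \<in> {..<n}"
          then have "(j + (i * n + k) - j) div n = i" "(j + (i * n + k) - j) mod n = k" by auto
          moreover have "j + (i * n + k) = k + (i * n + j)" by simp
          then have "(T ^^ (j + (i * n + k))) x = (T ^^ k) ((T ^^ (i * n + j)) x)"
            by (simp only: funpow_add comp_apply)
          ultimately show "d ((T ^^ (j + (i * n + k))) x) (y' (j + (i * n + k)))
              = d ((T ^^ k) ((T ^^ (i * n + j)) x)) (y (p i) k)"
            by (simp only: y'_def)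
        qed
        finally show "(\<Prod>i<M. exp (- (\<Sum>k<n. d ((T ^^ k) ((T ^^ (i * n + j)) x)) (y (p i) k)) / \<epsilon>))
            = exp (- (\<Sum>k\<in>{j..<j + M * n}. d ((T ^^ k) x) (y' k)) / \<epsilon>)"
          by (simp add: exp_sum[symmetric] sum_negf sum_divide_distrib)
      qed
      also have "\<dots> \<le> b'"
        using exp_average_le[OF \<epsilon> L F \<nu>(1) in_range[OF j] b] by (simp add: b'_def cn_def)
      finally show "(\<Sum>x\<in>F. \<nu> x * (\<Prod>i<M. exp (- (\<Sum>k<n. d ((T ^^ k) ((T ^^ (i * n + j)) x)) (y (p i) k)) / \<epsilon>))) \<le> b'" .
    qed (use V q in auto)
    then show ?thesis using q by simp
  qed
  have "- ln b' \<le> (\<Sum>x\<in>F. \<nu> x * (\<Sum>i<M. - ln (g ((T ^^ (i * n + j)) x))))" if j: "j < n" for j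
  proof -
    have "- ln b' \<le> (\<Sum>x\<in>F. \<nu> x * - ln (\<Prod>i<M. g ((T ^^ (i * n + j)) x)))"
      by (rule neg_ln_sum_le[OF F \<nu>(1,2) _ block_le[OF j]]) (simp add: prod_pos g_pos)
    moreover have "ln (\<Prod>i<M. g ((T ^^ (i * n + j)) x)) = (\<Sum>i<M. ln (g ((T ^^ (i * n + j)) x)))" for x
      by (rule ln_prod) (simp_all add: g_pos[THEN less_imp_neq, THEN not_sym])
    ultimately show ?thesis by (simp add: sum_negf)
  qed
  then have "(\<Sum>j<n. - ln b') \<le> (\<Sum>j<n. \<Sum>x\<in>F. \<nu> x * (\<Sum>i<M. - ln (g ((T ^^ (i * n + j)) x))))"
    by (intro sum_mono) auto
  also have "\<dots> = (\<Sum>x\<in>F. \<nu> x * (\<Sum>j<n. \<Sum>i<M. - ln (g ((T ^^ (i * n + j)) x))))"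
    by (subst sum.swap) (simp add: sum_distrib_left)
  also have "\<dots> = (\<Sum>x\<in>F. \<nu> x * (\<Sum>k<M * n. - ln (g ((T ^^ k) x))))"
    unfolding sum_lessThan_blocks by (subst sum.swap) simp
  also have "\<dots> \<le> (\<Sum>x\<in>F. \<nu> x * (\<Sum>k<N. - ln (g ((T ^^ k) x))))"
    using \<nu> MN g_pos g_le by (intro sum_mono mult_left_mono sum_mono2) auto
  finally have "- real n * ln b' \<le> (\<Sum>x\<in>F. \<nu> x * (\<Sum>k<N. - ln (g ((T ^^ k) x))))" by simp
  moreover have "ln b' \<le> 2 * real n * ln cn + real N * ln 2 + ln b"
  proof -
    have "ln b' = real (N - M * n) * ln cn + real (M * n) * ln 2 + ln b"
      using cn b0 unfolding b'_def by (simp add: ln_mult ln_realpow)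
    moreover have "real (N - M * n) * ln cn \<le> real (2 * n) * ln cn"
      using Mn cn by (intro mult_right_mono) (auto simp del: of_nat_mult)
    moreover have "real (M * n) * ln 2 \<le> real N * ln 2"
      using MN by (intro mult_right_mono) (auto simp del: of_nat_mult)
    ultimately show ?thesis by (simp only: of_nat_mult of_nat_numeral)
  qed
  then have "real n * ln b' \<le> real n * (2 * real n * ln cn + real N * ln 2 + ln b)"
    by (intro mult_left_mono) auto
  ultimately show ?thesis by (simp add: cn_def)
qed

text \<open>
  Discretise \<open>X\<close> by an orbit code and \<open>Y\<close> letter by letter, both with error \<open>\<epsilon>\<close>, and apply the
  Gibbs inequality to \<open>h = - D / \<epsilon> - ln Z\<close>, where \<open>D\<close> is the total distortion between
  representatives and \<open>Z\<close> its partition function under the law of the coded \<open>Y\<close>, which normalises \<open>h\<close>.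
  The expected distortion costs \<open>n\<close>, its change under discretisation \<open>2 n\<close>, and the change of \<open>ln Z\<close>
  another \<open>n\<close>. Free energy at slope \<open>1 / \<epsilon>\<close> makes all these losses independent of
  \<open>\<epsilon>\<close>.
\<close>

lemma information_ge_free_energy:
  assumes \<epsilon>: "0 < \<epsilon>" and \<mu>: "prob_space \<mu>" "sets \<mu> = sets borel"
    and adm: "distortion_admissible T d \<mu> \<epsilon> n P X Y"
  obtains V :: "nat set" and q y where "finite V" "\<And>v. v \<in> V \<Longrightarrow> 0 \<le> q v" "sum q V = 1"
    "ereal ((\<integral>x. - ln (\<Sum>v\<in>V. q v * exp (- (\<Sum>k<n. d ((T ^^ k) x) (y v k)) / \<epsilon>)) \<partial>\<mu>) - 4 * real n)
      \<le> mutual_info P borel (Pi\<^sub>M {..<n} (\<lambda>_. borel)) X (\<lambda>\<omega>. \<lambda>k\<in>{..<n}. Y k \<omega>)"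
proof -
  from adm have n: "n \<ge> 1" and P: "prob_space P" and X: "X \<in> borel_measurable P"
    and law: "distr P borel X = \<mu>" and Y: "\<And>k. k < n \<Longrightarrow> Y k \<in> borel_measurable P"
    and E: "(\<integral>\<omega>. (1 / real n) * (\<Sum>k<n. d ((T ^^ k) (X \<omega>)) (Y k \<omega>)) \<partial>P) < \<epsilon>"
    by (auto simp: distortion_admissible_def)
  interpret prob_space P by fact
  define R :: "(nat \<Rightarrow> 'a) measure" where "R = Pi\<^sub>M {..<n} (\<lambda>_. borel)"
  define Yr where "Yr = (\<lambda>\<omega>. \<lambda>k\<in>{..<n}. Y k \<omega>)"
  have Yr: "Yr \<in> P \<rightarrow>\<^sub>M R"
    unfolding R_def Yr_def by (rule measurable_restrict) (use Y in auto)
  obtain f :: "'a \<Rightarrow> nat" and rf mf where f: "f \<in> borel \<rightarrow>\<^sub>M count_space UNIV" "\<And>x. f x < mf"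
    "\<And>x k. k < n \<Longrightarrow> d ((T ^^ k) x) ((T ^^ k) (rf (f x))) < \<epsilon>"
    using orbit_code[OF \<epsilon>] by metis
  obtain p :: "'a \<Rightarrow> nat" and rp mp where p: "p \<in> borel \<rightarrow>\<^sub>M count_space UNIV" "\<And>x. p x < mp"
    "\<And>x. d x (rp (p x)) < \<epsilon>"
    using d_code[OF \<epsilon>] by metis
  define word where "word j z = map (\<lambda>k. p (z k)) [0..<j]" for j and z :: "nat \<Rightarrow> 'a"
  have "word j \<in> R \<rightarrow>\<^sub>M count_space UNIV" if "j \<le> n" for j
    using that
  proof (induction j)
    case (Suc j)
    have "(\<lambda>z. p (z j)) \<in> R \<rightarrow>\<^sub>M count_space UNIV"
      using Suc.prems by (intro measurable_compose[OF _ p(1)]) (simp add: R_def)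
    with Suc have "(\<lambda>z. (word j z, p (z j))) \<in> R \<rightarrow>\<^sub>M count_space UNIV \<Otimes>\<^sub>M count_space UNIV"
      by (intro measurable_Pair) auto
    then have "(\<lambda>z. (word j z, p (z j))) \<in> R \<rightarrow>\<^sub>M count_space UNIV" by (simp add: pair_measure_countable)
    from measurable_compose[OF this, of "\<lambda>(l, a). l @ [a]" "count_space UNIV"]
    show ?case by (simp add: word_def)
  qed (simp add: word_def[abs_def])
  from measurable_compose[OF this[OF order_refl], of to_nat "count_space UNIV"]
  have g: "(\<lambda>z. to_nat (word n z)) \<in> R \<rightarrow>\<^sub>M count_space UNIV" by simp
  define V where "V = to_nat ` {l. set l \<subseteq> {..<mp} \<and> length l = n}"
  have V: "finite V" unfolding V_def by (intro finite_imageI finite_lists_length_eq) simp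
  have gV: "to_nat (word n z) \<in> V" for z
    unfolding V_def by (rule imageI) (use p(2) in \<open>auto simp: word_def\<close>)
  define y where "y v k = rp ((from_nat v :: nat list) ! k)" for v k
  have y: "y (to_nat (word n (Yr \<omega>))) k = rp (p (Y k \<omega>))" if "k < n" for k \<omega>
    using that by (simp add: y_def word_def Yr_def)
  define q where "q v = measure P {\<omega>\<in>space P. to_nat (word n (Yr \<omega>)) = v}" for v
  have gY: "(\<lambda>\<omega>. to_nat (word n (Yr \<omega>))) \<in> P \<rightarrow>\<^sub>M count_space UNIV" by (rule measurable_compose[OF Yr g])
  have q1: "sum q V = 1"
  proof -
    have "prob (\<Union>v\<in>V. {\<omega>\<in>space P. to_nat (word n (Yr \<omega>)) = v}) = sum q V"
      unfolding q_def
    proof (rule finite_measure_finite_Union[OF V])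
      have "{\<omega>\<in>space P. to_nat (word n (Yr \<omega>)) = v} \<in> sets P" for v
        using measurable_sets[OF gY, of "{v}"] by (simp add: vimage_def Int_def conj_commute)
      then show "(\<lambda>v. {\<omega>\<in>space P. to_nat (word n (Yr \<omega>)) = v}) ` V \<subseteq> sets P" by blast
    qed (auto simp: disjoint_family_on_def)
    also have "(\<Union>v\<in>V. {\<omega>\<in>space P. to_nat (word n (Yr \<omega>)) = v}) = space P" using gV by auto
    finally show ?thesis by (simp add: prob_space)
  qed
  have q0: "0 \<le> q v" for v by (simp add: q_def)
  define D where "D x v = (\<Sum>k<n. d ((T ^^ k) x) (y v k))" for x v
  define Z where "Z x = (\<Sum>v\<in>V. q v * exp (- D x v / \<epsilon>))" for x
  have Z_pos: "0 < Z x" for x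
    unfolding Z_def by (rule convex_combination_pos[OF V q0 q1]) simp
  define h where "h u v = - D (rf u) v / \<epsilon> - ln (Z (rf u))" for u v
  have "(\<Sum>v\<in>V. q v * exp (h u v)) = 1" for u
  proof -
    have "(\<Sum>v\<in>V. q v * exp (h u v)) = (\<Sum>v\<in>V. q v * exp (- D (rf u) v / \<epsilon>)) / Z (rf u)"
      using Z_pos by (simp add: h_def exp_diff sum_divide_distrib)
    then show ?thesis using Z_pos[of "rf u"] by (simp add: Z_def)
  qed
  then have info: "ereal (\<integral>\<omega>. h (f (X \<omega>)) (to_nat (word n (Yr \<omega>))) \<partial>P) \<le> mutual_info P borel R X Yr"
    using mutual_info_lower_bound[OF P X Yr f(1), of "{..<mf}", OF _ _ g V, of h] f(2) gV
    by (auto simp: q_def)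
  have D_diff: "\<bar>D x v - D x' v\<bar> \<le> real n * \<epsilon>"
    if "\<And>k. k < n \<Longrightarrow> d ((T ^^ k) x) ((T ^^ k) x') < \<epsilon>" for x x' v
  proof -
    have "\<bar>D x v - D x' v\<bar> \<le> (\<Sum>k<n. \<bar>d ((T ^^ k) x) (y v k) - d ((T ^^ k) x') (y v k)\<bar>)"
      unfolding D_def sum_subtractf[symmetric] by (rule sum_abs)
    also have "\<dots> \<le> (\<Sum>k<n. \<epsilon>)"
    proof (rule sum_mono)
      fix k assume "k \<in> {..<n}"
      then show "\<bar>d ((T ^^ k) x) (y v k) - d ((T ^^ k) x') (y v k)\<bar> \<le> \<epsilon>"
        using that[of k] d_triangle[of "(T ^^ k) x" "y v k" "(T ^^ k) x'"]
          d_triangle[of "(T ^^ k) x'" "y v k" "(T ^^ k) x"] d_commute[of "(T ^^ k) x'" "(T ^^ k) x"] by auto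
    qed
    finally show ?thesis by simp
  qed
  have Z_rf: "ln (Z (rf (f x))) \<le> ln (Z x) + real n" for x
  proof -
    have "Z (rf (f x)) \<le> (\<Sum>v\<in>V. q v * (exp (- D x v / \<epsilon>) * exp (real n)))"
      unfolding Z_def
    proof (intro sum_mono mult_left_mono q0)
      fix v
      have "- D (rf (f x)) v \<le> - D x v + real n * \<epsilon>"
        using D_diff[of x "rf (f x)" v, OF f(3)] by linarith
      then have "- D (rf (f x)) v / \<epsilon> \<le> - D x v / \<epsilon> + real n" using \<epsilon> by (simp add: field_simps)
      then show "exp (- D (rf (f x)) v / \<epsilon>) \<le> exp (- D x v / \<epsilon>) * exp (real n)"
        by (simp add: exp_add[symmetric])
    qed
    also have "\<dots> = Z x * exp (real n)" by (simp add: Z_def sum_distrib_right mult.assoc)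
    finally have "ln (Z (rf (f x))) \<le> ln (Z x * exp (real n))" using Z_pos by (subst ln_le_cancel_iff) auto
    then show ?thesis using Z_pos[of x] by (simp add: ln_mult)
  qed
  have D_rf: "D (rf (f (X \<omega>))) (to_nat (word n (Yr \<omega>)))
      \<le> (\<Sum>k<n. d ((T ^^ k) (X \<omega>)) (Y k \<omega>)) + 2 * real n * \<epsilon>" for \<omega>
  proof -
    have "D (X \<omega>) (to_nat (word n (Yr \<omega>))) \<le> (\<Sum>k<n. d ((T ^^ k) (X \<omega>)) (Y k \<omega>) + \<epsilon>)"
      unfolding D_def
    proof (rule sum_mono)
      fix k assume "k \<in> {..<n}"
      then show "d ((T ^^ k) (X \<omega>)) (y (to_nat (word n (Yr \<omega>))) k) \<le> d ((T ^^ k) (X \<omega>)) (Y k \<omega>) + \<epsilon>"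
        using p(3)[of "Y k \<omega>"] d_triangle[of "(T ^^ k) (X \<omega>)" "rp (p (Y k \<omega>))" "Y k \<omega>"] by (simp add: y)
    qed
    moreover have "\<bar>D (X \<omega>) v - D (rf (f (X \<omega>))) v\<bar> \<le> real n * \<epsilon>" for v
      by (rule D_diff[OF f(3)])
    from this[of "to_nat (word n (Yr \<omega>))"] calculation show ?thesis by (simp add: sum.distrib)
  qed
  define S where "S \<omega> = (\<Sum>k<n. d ((T ^^ k) (X \<omega>)) (Y k \<omega>))" for \<omega>
  obtain B where B: "\<And>x y. d x y \<le> B" using d_bounded by blast
  have S: "integrable P S"
    unfolding S_def
  proof (rule Bochner_Integration.integrable_sum, rule integrable_const_bound[of _ B])
    fix k assume "k \<in> {..<n}"
    then show "(\<lambda>\<omega>. d ((T ^^ k) (X \<omega>)) (Y k \<omega>)) \<in> borel_measurable P"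
      using Y by (intro d_measurable measurable_compose[OF X funpow_measurable]) auto
  qed (use B d_nonneg in auto)
  have ES: "(\<integral>\<omega>. S \<omega> \<partial>P) \<le> real n * \<epsilon>"
  proof -
    have "(\<integral>\<omega>. S \<omega> \<partial>P) / real n < \<epsilon>" using E by (simp add: S_def)
    then show ?thesis using n by (simp add: field_simps)
  qed
  have contZ: "continuous_on UNIV (\<lambda>x. - ln (Z x))"
    unfolding Z_def D_def using Z_pos \<epsilon>
    by (intro continuous_intros continuous_on_compose_funpow[OF continuous_on_d])
      (use Z_pos[THEN less_imp_neq, THEN not_sym] in \<open>auto simp: Z_def D_def\<close>)
  then have measZ: "(\<lambda>x. - ln (Z x)) \<in> borel_measurable borel" by (rule borel_measurable_continuous_onI)
  have "integrable (distr P borel X) (\<lambda>x. - ln (Z x))"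
    unfolding law using integrable_continuous[OF \<mu> contZ] .
  then have intZ: "integrable P (\<lambda>\<omega>. - ln (Z (X \<omega>)))" by (rule integrable_distr[OF X])
  have "(\<integral>x. - ln (Z x) \<partial>\<mu>) - 4 * real n \<le> (\<integral>\<omega>. - ln (Z (X \<omega>)) - S \<omega> / \<epsilon> - 3 * real n \<partial>P)"
  proof -
    have "(\<integral>\<omega>. - ln (Z (X \<omega>)) - S \<omega> / \<epsilon> - 3 * real n \<partial>P)
        = (\<integral>\<omega>. - ln (Z (X \<omega>)) \<partial>P) - (\<integral>\<omega>. S \<omega> \<partial>P) / \<epsilon> - 3 * real n"
      using S intZ by (simp add: prob_space)
    also have "(\<integral>\<omega>. - ln (Z (X \<omega>)) \<partial>P) = (\<integral>x. - ln (Z x) \<partial>\<mu>)"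
      unfolding law[symmetric] by (rule integral_distr[symmetric, OF X measZ])
    finally show ?thesis using ES \<epsilon> by (simp add: field_simps)
  qed
  also have "\<dots> \<le> (\<integral>\<omega>. h (f (X \<omega>)) (to_nat (word n (Yr \<omega>))) \<partial>P)"
  proof (rule integral_mono)
    show "integrable P (\<lambda>\<omega>. - ln (Z (X \<omega>)) - S \<omega> / \<epsilon> - 3 * real n)" using S intZ by simp
    show "integrable P (\<lambda>\<omega>. h (f (X \<omega>)) (to_nat (word n (Yr \<omega>))))"
    proof (rule integrable_const_bound[of _ "\<Sum>u<mf. \<Sum>v\<in>V. \<bar>h u v\<bar>"])
      have "(\<lambda>\<omega>. (f (X \<omega>), to_nat (word n (Yr \<omega>)))) \<in> P \<rightarrow>\<^sub>M count_space UNIV"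
        using measurable_Pair[OF measurable_compose[OF X f(1)] gY] by (simp add: pair_measure_countable)
      from measurable_compose[OF this, of "\<lambda>(u, v). h u v" borel]
      show "(\<lambda>\<omega>. h (f (X \<omega>)) (to_nat (word n (Yr \<omega>)))) \<in> borel_measurable P" by simp
      have "\<bar>h u v\<bar> \<le> (\<Sum>u<mf. \<Sum>v\<in>V. \<bar>h u v\<bar>)" if "u < mf" "v \<in> V" for u v
      proof -
        have "\<bar>h u v\<bar> \<le> (\<Sum>v\<in>V. \<bar>h u v\<bar>)" using that V by (intro member_le_sum) auto
        also have "\<dots> \<le> (\<Sum>u<mf. \<Sum>v\<in>V. \<bar>h u v\<bar>)"
          using that by (intro member_le_sum[of u "{..<mf}" "\<lambda>u. \<Sum>v\<in>V. \<bar>h u v\<bar>"]) (auto intro: sum_nonneg)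
        finally show ?thesis .
      qed
      then show "AE \<omega> in P. norm (h (f (X \<omega>)) (to_nat (word n (Yr \<omega>)))) \<le> (\<Sum>u<mf. \<Sum>v\<in>V. \<bar>h u v\<bar>)"
        using f(2) gV by simp
    qed
    fix \<omega>
    have "D (rf (f (X \<omega>))) (to_nat (word n (Yr \<omega>))) / \<epsilon> \<le> S \<omega> / \<epsilon> + 2 * real n"
      using D_rf[of \<omega>] \<epsilon> by (simp add: S_def field_simps)
    then show "- ln (Z (X \<omega>)) - S \<omega> / \<epsilon> - 3 * real n \<le> h (f (X \<omega>)) (to_nat (word n (Yr \<omega>)))"
      using Z_rf[of "X \<omega>"] by (simp add: h_def)
  qed
  finally have "ereal ((\<integral>x. - ln (Z x) \<partial>\<mu>) - 4 * real n) \<le> mutual_info P borel R X Yr"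
    using info by (meson ereal_less_eq(3) order_trans)
  then show thesis
    using V q0 q1 by (intro that[of V q y]) (auto simp: Z_def D_def R_def Yr_def)
qed

end

section \<open>Invariant limit measures and the mean potential\<close>

text \<open>
  Fekete's lemma: the quotients converge to their infimum. The value at \<open>0\<close> is unconstrained, so
  remainders are taken in \<open>1, \<dots>, m\<close> instead of \<open>0, \<dots>, m - 1\<close>.
\<close>

lemma Fekete_bounded_below:
  fixes a :: "nat \<Rightarrow> real"
  assumes sub: "\<And>m n. 1 \<le> m \<Longrightarrow> 1 \<le> n \<Longrightarrow> a (m + n) \<le> a m + a n"
    and low: "\<And>n. 1 \<le> n \<Longrightarrow> c \<le> a n / real n"
  shows "convergent (\<lambda>n. a n / real n)"
proof -
  define l where "l = (INF n\<in>{1..}. a n / real n)"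
  have bdd: "bdd_below ((\<lambda>n. a n / real n) ` {1..})" using low by (intro bdd_belowI2[of _ c]) auto
  have l_le: "l \<le> a n / real n" if "1 \<le> n" for n
    unfolding l_def using that by (intro cINF_lower bdd) auto
  have "(\<lambda>n. a n / real n) \<longlonglongrightarrow> l"
  proof (rule LIMSEQ_I)
    fix e :: real assume e: "0 < e"
    have "\<exists>m\<in>{1..}. a m / real m < l + e / 2"
      using cINF_less_iff[of "{1..}" "\<lambda>n. a n / real n" "l + e / 2"] bdd e by (auto simp: l_def)
    then obtain m where m: "1 \<le> m" "a m / real m < l + e / 2" by auto
    define B where "B = (\<Sum>r\<le>m. \<bar>a r\<bar>) + \<bar>a m\<bar>"
    have mult: "a (m * q + r) \<le> real q * a m + a r" if "1 \<le> r" for q r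
    proof (induction q)
      case (Suc q)
      have "a (m + (m * q + r)) \<le> a m + a (m * q + r)" by (rule sub) (use m that in auto)
      with Suc show ?case by (simp add: algebra_simps)
    qed simp
    have upper: "a n / real n \<le> a m / real m + B / real n" if n: "1 \<le> n" for n
    proof -
      define q r where "q = (n - 1) div m" and "r = Suc ((n - 1) mod m)"
      have nqr: "n = m * q + r" using n by (simp add: q_def r_def)
      have r: "1 \<le> r" "r \<le> m" using m by (auto simp: r_def Suc_leI)
      have "\<bar>a r\<bar> \<le> (\<Sum>r\<le>m. \<bar>a r\<bar>)" using r by (intro member_le_sum) auto
      moreover have "real q * a m \<le> real n * (a m / real m) + \<bar>a m\<bar>"
      proof -
        have "real n * (a m / real m) = real q * a m + (real r / real m) * a m"
          using m by (simp add: nqr field_simps)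
        moreover have "\<bar>(real r / real m) * a m\<bar> \<le> 1 * \<bar>a m\<bar>"
          unfolding abs_mult using r m by (intro mult_right_mono) auto
        ultimately show ?thesis by linarith
      qed
      ultimately have "a n \<le> real n * (a m / real m) + B"
        using mult[OF r(1), of q] unfolding nqr[symmetric] B_def by linarith
      then show ?thesis using n by (simp add: field_simps)
    qed
    obtain n0 where n0: "2 * B / e < real n0" using reals_Archimedean2 by blast
    have "norm (a n / real n - l) < e" if "n \<ge> max 1 n0" for n
    proof -
      have "2 * B / e < real n" "1 \<le> n" using that n0 by auto
      then have "B / real n < e / 2" using e by (simp add: field_simps)
      then show ?thesis
        using upper[OF \<open>1 \<le> n\<close>] l_le[OF \<open>1 \<le> n\<close>] m(2) unfolding real_norm_def by linarith
    qed
    then show "\<exists>n0. \<forall>n\<ge>n0. norm (a n / real n - l) < e" by blast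
  qed
  then show ?thesis by (auto simp: convergent_def)
qed

context compact_dynamics
begin

definition Birkhoff_average :: "nat \<Rightarrow> 'a set \<Rightarrow> ('a \<Rightarrow> real) \<Rightarrow> ('a \<Rightarrow> real) \<Rightarrow> real" where
  "Birkhoff_average N F \<nu> f = (\<Sum>x\<in>F. \<nu> x * (\<Sum>k<N. f ((T ^^ k) x))) / real N"

text \<open>
  Averaging along orbit segments of length \<open>N i\<close> makes the integrals of \<open>f \<circ> T\<close> and of \<open>f\<close> differ
  only by the two ends of the segment, hence by at most \<open>2 / N i\<close> if \<open>\<bar>f\<bar> \<le> 1\<close>.
\<close>

lemma invariant_weak_limit:
  fixes \<nu> :: "nat \<Rightarrow> 'a \<Rightarrow> real"
  assumes N: "strict_mono N" "\<And>i. 1 \<le> N i" and F: "\<And>i. finite (F i)"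
    and \<nu>: "\<And>i x. 0 \<le> \<nu> i x" "\<And>i. sum (\<nu> i) (F i) = 1"
  obtains r \<mu> where "strict_mono (r :: nat \<Rightarrow> nat)" "\<mu> \<in> invariant_measures T"
    "\<And>f. continuous_on UNIV f \<Longrightarrow>
      (\<lambda>i. Birkhoff_average (N (r i)) (F (r i)) (\<nu> (r i)) f) \<longlonglongrightarrow> (\<integral>x. f x \<partial>\<mu>)"
proof -
  define I where "I i = F i \<times> {..<N i}" for i
  define w where "w i = (\<lambda>(x, k :: nat). \<nu> i x / real (N i))" for i
  define z where "z i = (\<lambda>(x, k). (T ^^ k) x)" for i :: nat
  have avg: "(\<Sum>p\<in>I i. w i p * f (z i p)) = Birkhoff_average (N i) (F i) (\<nu> i) f" for i f
    by (simp add: I_def w_def z_def sum.cartesian_product Birkhoff_average_def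
        sum_distrib_left sum_divide_distrib case_prod_unfold)
  have fin: "finite (I i)" for i by (simp add: I_def F)
  have w0: "0 \<le> w i p" for i p using \<nu>(1) by (simp add: w_def split: prod.split)
  have N0: "N i \<noteq> 0" for i using N(2)[of i] by linarith
  have w1: "sum (w i) (I i) = 1" for i
    using avg[of i "\<lambda>_. 1"] \<nu>(2)[of i] N0[of i] by (simp add: Birkhoff_average_def flip: sum_distrib_right)
  obtain r and \<mu> :: "'a measure" where r: "strict_mono r" and \<mu>: "prob_space \<mu>" "sets \<mu> = sets borel"
    and lim': "\<And>f :: 'a \<Rightarrow> real. continuous_on UNIV f \<Longrightarrow>
      (\<lambda>i. \<Sum>p\<in>I (r i). w (r i) p * f (z (r i) p)) \<longlonglongrightarrow> (\<integral>x. f x \<partial>\<mu>)"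
    by (rule weak_limit_of_finite_measures[OF compact_space, of I w z, OF fin w0 w1]) (rule that)
  note lim = lim'[unfolded avg]
  have T_meas: "T \<in> borel_measurable \<mu>"
    using borel_measurable_continuous_onI[OF T] \<mu>(2) by (simp cong: measurable_cong_sets)
  have "distr \<mu> borel T = \<mu>"
  proof (rule measure_eqI_continuous)
    show "prob_space (distr \<mu> borel T)" by (rule prob_space.prob_space_distr[OF \<mu>(1) T_meas])
    fix f :: "'a \<Rightarrow> real" assume f: "continuous_on UNIV f" and f1: "\<And>x. \<bar>f x\<bar> \<le> 1"
    have fT: "continuous_on UNIV (\<lambda>x. f (T x))"
      using continuous_on_compose_funpow[OF f, of 1] by simp
    have diff: "\<bar>Birkhoff_average (N i) (F i) (\<nu> i) (\<lambda>x. f (T x)) - Birkhoff_average (N i) (F i) (\<nu> i) f\<bar>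
        \<le> 2 / real (N i)" for i
    proof -
      have tele: "(\<Sum>k<n. f (T ((T ^^ k) x))) - (\<Sum>k<n. f ((T ^^ k) x)) = f ((T ^^ n) x) - f x" for n x
        by (induction n) simp_all
      have "Birkhoff_average (N i) (F i) (\<nu> i) (\<lambda>x. f (T x)) - Birkhoff_average (N i) (F i) (\<nu> i) f
          = (\<Sum>x\<in>F i. \<nu> i x * (f ((T ^^ N i) x) - f x)) / real (N i)"
        unfolding Birkhoff_average_def tele[symmetric]
        by (simp add: right_diff_distrib sum_subtractf diff_divide_distrib)
      moreover have "\<bar>\<Sum>x\<in>F i. \<nu> i x * (f ((T ^^ N i) x) - f x)\<bar> \<le> (\<Sum>x\<in>F i. \<nu> i x * 2)"
      proof (rule order_trans[OF sum_abs sum_mono])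
        fix x
        have "\<bar>f ((T ^^ N i) x) - f x\<bar> \<le> 2" using f1[of "(T ^^ N i) x"] f1[of x] by linarith
        then show "\<bar>\<nu> i x * (f ((T ^^ N i) x) - f x)\<bar> \<le> \<nu> i x * 2"
          using \<nu>(1)[of i x] unfolding abs_mult by (simp add: mult_left_mono)
      qed
      ultimately show ?thesis
        using \<nu>(2)[of i] N0[of i] by (simp add: divide_right_mono flip: sum_distrib_right)
    qed
    have "strict_mono (\<lambda>i. N (r i))" using N(1) r by (auto simp: strict_mono_def)
    then have "filterlim (\<lambda>i. N (r i)) at_top sequentially" by (rule filterlim_subseq)
    then have "(\<lambda>i. 2 / real (N (r i))) \<longlonglongrightarrow> 0"
      using filterlim_compose[OF lim_const_over_n[of "2 :: real"]] by blast
    then have "(\<lambda>i. Birkhoff_average (N (r i)) (F (r i)) (\<nu> (r i)) (\<lambda>x. f (T x))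
        - Birkhoff_average (N (r i)) (F (r i)) (\<nu> (r i)) f) \<longlonglongrightarrow> 0"
      by (rule Lim_null_comparison[rotated]) (use diff in auto)
    from tendsto_add[OF this lim[OF f]]
    have "(\<lambda>i. Birkhoff_average (N (r i)) (F (r i)) (\<nu> (r i)) (\<lambda>x. f (T x))) \<longlonglongrightarrow> (\<integral>x. f x \<partial>\<mu>)" by simp
    then have "(\<integral>x. f (T x) \<partial>\<mu>) = (\<integral>x. f x \<partial>\<mu>)" using LIMSEQ_unique[OF lim[OF fT]] by blast
    then show "(\<integral>x. f x \<partial>distr \<mu> borel T) = (\<integral>x. f x \<partial>\<mu>)"
      by (subst integral_distr[OF T_meas borel_measurable_continuous_onI[OF f]])
  qed (use \<mu> in simp_all)
  then have "\<mu> \<in> invariant_measures T" using \<mu> by (simp add: invariant_measures_def)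
  then show thesis using that r lim by blast
qed

lemma integral_funpow_invariant:
  assumes \<mu>: "\<mu> \<in> invariant_measures T" and f: "continuous_on UNIV (f :: 'a \<Rightarrow> real)"
  shows "(\<integral>x. f ((T ^^ k) x) \<partial>\<mu>) = (\<integral>x. f x \<partial>\<mu>)"
proof (induction k)
  case (Suc k)
  have T_meas: "T \<in> borel_measurable \<mu>"
    using borel_measurable_continuous_onI[OF T] \<mu> by (simp add: invariant_measures_def cong: measurable_cong_sets)
  have "(\<integral>x. f ((T ^^ Suc k) x) \<partial>\<mu>) = (\<integral>x. f ((T ^^ k) x) \<partial>distr \<mu> borel T)"
    by (subst integral_distr[OF T_meas borel_measurable_continuous_onI[OF continuous_on_compose_funpow[OF f]]])
      (simp add: funpow_swap1)
  also have "\<dots> = (\<integral>x. f x \<partial>\<mu>)" using \<mu> Suc by (simp add: invariant_measures_def)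
  finally show ?case .
qed simp

text \<open>
  Write \<open>N\<close> as \<open>j\<close>, then blocks of length \<open>n\<close>, then a remainder, and average over the offsets
  \<open>j < n\<close>. The pieces outside the blocks have total length at most \<open>2 n\<close> for every offset.
\<close>

lemma subadditive_le_Birkhoff:
  assumes sub: "subadditive_potential T \<phi>" and C: "\<And>n x. 1 \<le> n \<Longrightarrow> \<bar>\<phi> n x\<bar> \<le> C * real n"
    and n: "1 \<le> n" "n \<le> N"
  shows "real n * \<phi> N x \<le> (\<Sum>k<N. \<phi> n ((T ^^ k) x)) + 4 * C * real n ^ 2"
proof -
  have sub': "\<phi> (a + b) y \<le> \<phi> a y + \<phi> b ((T ^^ a) y)" if "1 \<le> a" "1 \<le> b" for a b y
    using sub that by (simp add: subadditive_potential_def)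
  have C0: "0 \<le> C" using C[of 1 x] by simp
  \<comment> \<open>leaves a remainder of length at least \<open>1\<close> for every offset; the index \<open>0\<close> is not available\<close>
  define M where "M = N div n - 1"
  have N_eq: "N = N div n * n + N mod n" and mod: "N mod n < n" using n by auto
  have "1 \<le> N div n" using n by (simp add: Suc_le_eq div_greater_zero_iff)
  then have "N = M * n + n + N mod n" using N_eq unfolding M_def by (cases "N div n") auto
  then have MN: "M * n + n \<le> N" "N - M * n \<le> 2 * n" using mod by linarith+
  have blocks: "\<phi> (m * n + b) y \<le> (\<Sum>i<m. \<phi> n ((T ^^ (i * n)) y)) + \<phi> b ((T ^^ (m * n)) y)" if "1 \<le> b" for m b y
    using that
  proof (induction m arbitrary: b)
    case (Suc m)
    have "\<phi> (m * n + (n + b)) y \<le> (\<Sum>i<m. \<phi> n ((T ^^ (i * n)) y)) + \<phi> (n + b) ((T ^^ (m * n)) y)"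
      by (rule Suc.IH) (use Suc.prems in simp)
    moreover have "\<phi> (n + b) ((T ^^ (m * n)) y) \<le> \<phi> n ((T ^^ (m * n)) y) + \<phi> b ((T ^^ n) ((T ^^ (m * n)) y))"
      by (rule sub') (use n Suc.prems in auto)
    moreover have "(T ^^ n) ((T ^^ (m * n)) y) = (T ^^ (Suc m * n)) y" by (simp add: funpow_add)
    ultimately show ?case by (simp add: add_ac)
  qed simp
  have "\<phi> N x \<le> (\<Sum>i<M. \<phi> n ((T ^^ (i * n + j)) x)) + 2 * real n * C" if j: "j < n" for j
  proof -
    define b where "b = N - M * n - j"
    have b: "1 \<le> b" "N = j + (M * n + b)" "j + b \<le> 2 * n" using MN j by (auto simp: b_def)
    have "\<phi> N x \<le> C * real j + \<phi> (M * n + b) ((T ^^ j) x)"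
    proof (cases "j = 0")
      case False
      then have "\<phi> N x \<le> \<phi> j x + \<phi> (M * n + b) ((T ^^ j) x)"
        using sub'[of j "M * n + b" x] b by simp
      then show ?thesis using C[of j x] False by auto
    qed (use b C0 in simp)
    also have "\<phi> (M * n + b) ((T ^^ j) x)
        \<le> (\<Sum>i<M. \<phi> n ((T ^^ (i * n)) ((T ^^ j) x))) + \<phi> b ((T ^^ (M * n)) ((T ^^ j) x))"
      by (rule blocks[OF b(1)])
    also have "\<phi> b ((T ^^ (M * n)) ((T ^^ j) x)) \<le> C * real b" using C[OF b(1)] abs_le_D1 by blast
    finally have "\<phi> N x \<le> (\<Sum>i<M. \<phi> n ((T ^^ (i * n + j)) x)) + C * real (j + b)"
      unfolding funpow_add comp_apply of_nat_add distrib_left by linarith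
    moreover have "C * real (j + b) \<le> C * real (2 * n)"
      using b(3) C0 by (intro mult_left_mono) (auto simp del: of_nat_add of_nat_mult)
    ultimately show ?thesis by (simp add: mult_ac)
  qed
  then have "(\<Sum>j<n. \<phi> N x) \<le> (\<Sum>j<n. (\<Sum>i<M. \<phi> n ((T ^^ (i * n + j)) x)) + 2 * real n * C)"
    by (intro sum_mono) auto
  also have "\<dots> = (\<Sum>k<M * n. \<phi> n ((T ^^ k) x)) + 2 * C * real n ^ 2"
    unfolding sum_lessThan_blocks by (subst sum.swap) (simp add: sum.distrib power2_eq_square)
  also have "(\<Sum>k<M * n. \<phi> n ((T ^^ k) x)) \<le> (\<Sum>k<N. \<phi> n ((T ^^ k) x)) + 2 * C * real n ^ 2"
  proof -
    have "{..<N} = {..<M * n} \<union> {M * n..<N}" using MN by auto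
    then have "(\<Sum>k<N. \<phi> n ((T ^^ k) x)) = (\<Sum>k<M * n. \<phi> n ((T ^^ k) x)) + (\<Sum>k\<in>{M * n..<N}. \<phi> n ((T ^^ k) x))"
      by (simp add: sum.union_disjoint ivl_disj_int)
    moreover have "(\<Sum>k\<in>{M * n..<N}. - (C * real n)) \<le> (\<Sum>k\<in>{M * n..<N}. \<phi> n ((T ^^ k) x))"
      using C[OF n(1)] by (intro sum_mono) (metis abs_le_iff minus_le_iff)
    moreover have "(\<Sum>k\<in>{M * n..<N}. - (C * real n)) = - (real (N - M * n) * (C * real n))" by simp
    moreover have "real (N - M * n) * (C * real n) \<le> real (2 * n) * (C * real n)"
      using MN C0 by (intro mult_right_mono) (auto simp del: of_nat_mult)
    moreover have "real (2 * n) * (C * real n) = 2 * C * real n ^ 2" by (simp add: power2_eq_square)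
    ultimately show ?thesis by linarith
  qed
  finally show ?thesis by simp
qed

text \<open>
  For fixed \<open>n\<close> the function \<open>\<phi> n\<close> is continuous, so the lower bound on \<open>\<phi> (N i)\<close> passes through
  \<open>subadditive_le_Birkhoff\<close> to its integral. Invariance makes the integrals subadditive in \<open>n\<close>,
  whence the limit that defines the mean potential exists.
\<close>

lemma potential_mean_ge:
  assumes sub: "subadditive_potential T \<phi>" and C: "\<And>n x. 1 \<le> n \<Longrightarrow> \<bar>\<phi> n x\<bar> \<le> C * real n"
    and \<mu>: "\<mu> \<in> invariant_measures T"
    and N: "filterlim N at_top sequentially" and \<nu>: "\<And>i x. 0 \<le> \<nu> i x" "\<And>i. sum (\<nu> i) (F i) = 1"
    and lim: "\<And>f. continuous_on UNIV f \<Longrightarrow>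
      (\<lambda>i. Birkhoff_average (N i) (F i) (\<nu> i) f) \<longlonglongrightarrow> (\<integral>x. f x \<partial>\<mu>)"
    and c: "\<And>i x. x \<in> F i \<Longrightarrow> c * real (N i) \<le> \<phi> (N i) x"
  shows "ereal c \<le> potential_mean \<phi> \<mu>"
proof -
  have cont: "continuous_on UNIV (\<phi> n)" if "1 \<le> n" for n using sub that by (simp add: subadditive_potential_def)
  have low: "c \<le> (\<integral>x. \<phi> n x \<partial>\<mu>) / real n" if n: "1 \<le> n" for n
  proof -
    have "\<forall>\<^sub>F i in sequentially. real n * c
        \<le> Birkhoff_average (N i) (F i) (\<nu> i) (\<phi> n) + 4 * C * real n ^ 2 / real (N i)"
    proof -
      have "\<forall>\<^sub>F i in sequentially. n \<le> N i" using N by (auto simp: filterlim_at_top)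
      then show ?thesis
      proof eventually_elim
        case (elim i)
        have "(\<Sum>x\<in>F i. \<nu> i x * (real n * (c * real (N i))))
          \<le> (\<Sum>x\<in>F i. \<nu> i x * ((\<Sum>k<N i. \<phi> n ((T ^^ k) x)) + 4 * C * real n ^ 2))"
        proof (intro sum_mono mult_left_mono \<nu>(1))
          fix x assume "x \<in> F i"
          from mult_left_mono[OF c[OF this], of "real n"]
          show "real n * (c * real (N i)) \<le> (\<Sum>k<N i. \<phi> n ((T ^^ k) x)) + 4 * C * real n ^ 2"
            using subadditive_le_Birkhoff[OF sub C n elim, of x] by simp
        qed
        also have "\<dots> = (\<Sum>x\<in>F i. \<nu> i x * (\<Sum>k<N i. \<phi> n ((T ^^ k) x))) + 4 * C * real n ^ 2"
          using \<nu>(2)[of i] by (simp add: distrib_left sum.distrib flip: sum_distrib_right)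
        also have "(\<Sum>x\<in>F i. \<nu> i x * (real n * (c * real (N i)))) = real n * (c * real (N i))"
          using \<nu>(2)[of i] by (simp flip: sum_distrib_right)
        finally show ?case using elim n by (simp add: Birkhoff_average_def field_simps)
      qed
    qed
    moreover have "(\<lambda>i. 4 * C * real n ^ 2 / real (N i)) \<longlonglongrightarrow> 0"
      by (rule filterlim_compose[OF lim_const_over_n N])
    from tendsto_add[OF lim[OF cont[OF n]] this]
    have "(\<lambda>i. Birkhoff_average (N i) (F i) (\<nu> i) (\<phi> n) + 4 * C * real n ^ 2 / real (N i))
      \<longlonglongrightarrow> (\<integral>x. \<phi> n x \<partial>\<mu>)" by simp
    ultimately have "real n * c \<le> (\<integral>x. \<phi> n x \<partial>\<mu>)"
      by (intro tendsto_lowerbound) auto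
    then show ?thesis using n by (simp add: field_simps)
  qed
  have "convergent (\<lambda>n. (\<integral>x. \<phi> n x \<partial>\<mu>) / real n)"
  proof (rule Fekete_bounded_below[OF _ low])
    fix m n :: nat assume mn: "1 \<le> m" "1 \<le> n"
    have int: "integrable \<mu> f" if "continuous_on UNIV (f :: 'a \<Rightarrow> real)" for f
      using integrable_continuous[OF _ _ that] \<mu> by (simp add: invariant_measures_def)
    note cont_n = continuous_on_compose_funpow[OF cont[OF mn(2)], of m]
    have "(\<integral>x. \<phi> (m + n) x \<partial>\<mu>) \<le> (\<integral>x. \<phi> m x + \<phi> n ((T ^^ m) x) \<partial>\<mu>)"
      using sub mn cont[OF mn(1)] cont_n cont[of "m + n"]
      by (intro integral_mono int continuous_intros) (auto simp: subadditive_potential_def)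
    also have "\<dots> = (\<integral>x. \<phi> m x \<partial>\<mu>) + (\<integral>x. \<phi> n x \<partial>\<mu>)"
      using int[OF cont[OF mn(1)]] int[OF cont_n] integral_funpow_invariant[OF \<mu> cont[OF mn(2)], of m] by simp
    finally show "(\<integral>x. \<phi> (m + n) x \<partial>\<mu>) \<le> (\<integral>x. \<phi> m x \<partial>\<mu>) + (\<integral>x. \<phi> n x \<partial>\<mu>)" .
  qed
  then obtain l where l: "(\<lambda>n. (\<integral>x. \<phi> n x \<partial>\<mu>) / real n) \<longlonglongrightarrow> l" by (auto simp: convergent_def)
  have "c \<le> l"
    by (rule tendsto_lowerbound[OF l]) (use low in \<open>auto simp: eventually_sequentially\<close>)
  moreover have "potential_mean \<phi> \<mu> = ereal l"
    unfolding potential_mean_def by (rule limI) (use l in simp)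
  ultimately show ?thesis by simp
qed

end

section \<open>Lower bounds for the rate distortion dimension\<close>

context compact_dynamics
begin

text \<open>
  The free energy \<open>- ln g\<close> of an admissible pair is continuous, so its integral is the limit of its
  Birkhoff averages under \<open>\<nu> i\<close>. These are bounded below by \<open>Birkhoff_free_energy_ge\<close> with the
  Frostman bound at \<open>\<rho> = 2 L \<epsilon>\<close>; the terms that do not grow with \<open>N i\<close> disappear in the limit.
  The Frostman bound is only required from \<open>\<tau> i\<close> on, because the scale \<open>2 L \<epsilon>\<close> is fixed while
  \<open>i\<close> tends to infinity.
\<close>

lemma rate_distortion_ge:
  assumes \<mu>: "\<mu> \<in> invariant_measures T" and \<epsilon>: "0 < \<epsilon>"
    and N: "filterlim N at_top sequentially" and F: "\<And>i. finite (F i)"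
    and \<nu>: "\<And>i x. 0 \<le> \<nu> i x" "\<And>i. sum (\<nu> i) (F i) = 1"
    and lim: "\<And>f. continuous_on UNIV f \<Longrightarrow>
      (\<lambda>i. Birkhoff_average (N i) (F i) (\<nu> i) f) \<longlonglongrightarrow> (\<integral>x. f x \<partial>\<mu>)"
    and t: "0 \<le> t" and A: "0 < A" and h: "0 < h" and \<tau>: "\<tau> \<longlonglongrightarrow> 0"
    and frostman: "\<And>i E \<rho>. \<tau> i \<le> \<rho> \<Longrightarrow>
      (\<And>x y k. x \<in> E \<Longrightarrow> y \<in> E \<Longrightarrow> k < N i \<Longrightarrow> d ((T ^^ k) x) ((T ^^ k) y) \<le> \<rho>) \<Longrightarrow>
      sum (\<nu> i) (F i \<inter> E) \<le> (A * \<rho>) powr (t * real (N i)) / h"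
  shows "ereal (t * ln (1 / \<epsilon>) - t * ln (max 1 (ln (real (cover_number d \<epsilon>)))) - (t * ln (2 * A) + ln 2 + 4))
    \<le> rate_distortion T d \<mu> \<epsilon>"
  unfolding rate_distortion_def
proof (rule Inf_greatest, clarify)
  fix n and P :: "('a \<times> (nat \<Rightarrow> 'a)) measure" and X Y
  assume adm: "distortion_admissible T d \<mu> \<epsilon> n P X Y"
  then have n: "1 \<le> n" by (simp add: distortion_admissible_def)
  have prob: "prob_space \<mu>" "sets \<mu> = sets borel" using \<mu> by (auto simp: invariant_measures_def)
  define cn where "cn = real (cover_number d \<epsilon>)"
  define L where "L = max 1 (ln cn)"
  have L: "1 \<le> L" "ln cn \<le> L" by (auto simp: L_def)
  define a where "a = A * (2 * L * \<epsilon>)"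
  have a: "0 < a" using A L \<epsilon> by (simp add: a_def)
  obtain V :: "nat set" and q y where V: "finite V" "\<And>v. v \<in> V \<Longrightarrow> 0 \<le> q v" "sum q V = 1"
    and info: "ereal ((\<integral>x. - ln (\<Sum>v\<in>V. q v * exp (- (\<Sum>k<n. d ((T ^^ k) x) (y v k)) / \<epsilon>)) \<partial>\<mu>) - 4 * real n)
      \<le> mutual_info P borel (Pi\<^sub>M {..<n} (\<lambda>_. borel)) X (\<lambda>\<omega>. \<lambda>k\<in>{..<n}. Y k \<omega>)"
    by (rule information_ge_free_energy[OF \<epsilon> prob adm]) (rule that)
  define g where "g x = (\<Sum>v\<in>V. q v * exp (- (\<Sum>k<n. d ((T ^^ k) x) (y v k)) / \<epsilon>))" for x
  have g_pos: "0 < g x" for x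
    unfolding g_def by (rule convex_combination_pos[OF V]) simp_all
  have "continuous_on UNIV g"
    unfolding g_def using \<epsilon> by (intro continuous_intros continuous_on_compose_funpow[OF continuous_on_d]) auto
  then have cont: "continuous_on UNIV (\<lambda>x. - ln (g x))"
    using g_pos[THEN less_imp_neq, THEN not_sym] by (intro continuous_intros) auto
  have "- real n * (ln 2 + t * ln a) \<le> (\<integral>x. - ln (g x) \<partial>\<mu>)"
  proof (rule tendsto_le[OF _ lim[OF cont]])
    have "\<forall>\<^sub>F i in sequentially. 1 \<le> N i" using N by (auto simp: filterlim_at_top)
    moreover have "\<forall>\<^sub>F i in sequentially. \<tau> i < 2 * L * \<epsilon>"
      using L \<epsilon> by (intro order_tendstoD(2)[OF \<tau>]) simp
    ultimately show "\<forall>\<^sub>F i in sequentially. - real n * (ln 2 + t * ln a) - real n * (2 * real n * ln cn - ln h) / real (N i)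
      \<le> Birkhoff_average (N i) (F i) (\<nu> i) (\<lambda>x. - ln (g x))"
    proof eventually_elim
      case (elim i)
      have "- real n * (2 * real n * ln cn + real (N i) * ln 2 + ln (a powr (t * real (N i)) / h))
          \<le> (\<Sum>x\<in>F i. \<nu> i x * (\<Sum>k<N i. - ln (g ((T ^^ k) x))))"
        unfolding g_def cn_def
      proof (rule Birkhoff_free_energy_ge[OF \<epsilon> L[unfolded cn_def] F \<nu>])
        show "0 < a powr (t * real (N i)) / h" using a h by simp
        fix E assume "\<And>x y k. x \<in> E \<Longrightarrow> y \<in> E \<Longrightarrow> k < N i \<Longrightarrow> d ((T ^^ k) x) ((T ^^ k) y) \<le> 2 * L * \<epsilon>"
        then show "sum (\<nu> i) (F i \<inter> E) \<le> a powr (t * real (N i)) / h"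
          unfolding a_def using elim(2) by (intro frostman) auto
      qed (use V n in auto)
      moreover have "ln (a powr (t * real (N i)) / h) = t * real (N i) * ln a - ln h"
        using a h by (simp add: ln_div ln_powr)
      ultimately have "(- real n * (2 * real n * ln cn + real (N i) * ln 2 + (t * real (N i) * ln a - ln h))) / real (N i)
          \<le> Birkhoff_average (N i) (F i) (\<nu> i) (\<lambda>x. - ln (g x))"
        unfolding Birkhoff_average_def using elim(1) by (intro divide_right_mono) auto
      moreover have "(- real n * (2 * real n * ln cn + real (N i) * ln 2 + (t * real (N i) * ln a - ln h))) / real (N i)
          = - real n * (ln 2 + t * ln a) - real n * (2 * real n * ln cn - ln h) / real (N i)"
        using elim(1) by (simp add: field_simps)
      ultimately show ?case by simp
    qed
    have "(\<lambda>i. real n * (2 * real n * ln cn - ln h) / real (N i)) \<longlonglongrightarrow> 0"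
      by (rule filterlim_compose[OF lim_const_over_n N])
    from tendsto_diff[OF tendsto_const this]
    show "(\<lambda>i. - real n * (ln 2 + t * ln a) - real n * (2 * real n * ln cn - ln h) / real (N i))
      \<longlonglongrightarrow> - real n * (ln 2 + t * ln a)" by simp
  qed simp
  then have "ereal (- real n * (ln 2 + t * ln a) - 4 * real n) \<le> mutual_info P borel (Pi\<^sub>M {..<n} (\<lambda>_. borel)) X (\<lambda>\<omega>. \<lambda>k\<in>{..<n}. Y k \<omega>)"
    using info unfolding g_def by (meson diff_right_mono ereal_less_eq(3) order_trans)
  moreover have "- real n * (ln 2 + t * ln a) - 4 * real n
      = real n * (t * ln (1 / \<epsilon>) - t * ln L - (t * ln (2 * A) + ln 2 + 4))"
  proof -
    have "ln a = ln (2 * A) + ln L - ln (1 / \<epsilon>)"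
      using A L \<epsilon> by (simp add: a_def ln_mult ln_div)
    then show ?thesis by (simp only:) (simp add: algebra_simps)
  qed
  ultimately have "ereal (t * ln (1 / \<epsilon>) - t * ln L - (t * ln (2 * A) + ln 2 + 4)) \<le> process_rate n P X Y"
    unfolding process_rate_def using n by (simp add: ereal_le_divide_pos)
  then show "ereal (t * ln (1 / \<epsilon>) - t * ln (max 1 (ln (real (cover_number d \<epsilon>)))) - (t * ln (2 * A) + ln 2 + 4))
    \<le> process_rate n P X Y" by (simp add: L_def cn_def)
qed

text \<open>
  This is where tame growth enters: the logarithm of the covering number is eventually
  at most \<open>\<epsilon>\<^bsup>-\<delta>\<^esup>\<close>, so the loss \<open>t ln (max 1 (ln #))\<close> is at most \<open>t \<delta> ln (1 / \<epsilon>)\<close> for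
  every \<open>\<delta> > 0\<close>.
\<close>

lemma lower_rdim_ge:
  assumes tame: "tame_growth d" and t: "0 \<le> t"
    and rate: "\<And>\<epsilon>. 0 < \<epsilon> \<Longrightarrow>
      ereal (t * ln (1 / \<epsilon>) - t * ln (max 1 (ln (real (cover_number d \<epsilon>)))) - C) \<le> rate_distortion T d \<mu> \<epsilon>"
  shows "ereal t \<le> lower_rdim T d \<mu>"
proof (rule dense_le)
  fix y assume "y < ereal t"
  then obtain t' where t': "y < ereal t'" "t' < t" using ereal_dense2[of y "ereal t"] by auto
  \<comment> \<open>half of the gap \<open>t - t'\<close> absorbs the covering numbers, the other half the constant \<open>C\<close>\<close>
  define \<delta> where "\<delta> = (t - t') / (2 * (t + 1))"
  have \<delta>: "0 < \<delta>" "t * \<delta> \<le> (t - t') / 2"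
    using t t' by (simp_all add: \<delta>_def field_simps)
  have ev1: "\<forall>\<^sub>F \<epsilon> in at_right 0. \<epsilon> powr \<delta> * ln (real (cover_number d \<epsilon>)) < 1"
    using tame \<delta>(1) by (intro order_tendstoD(2)[of _ 0]) (auto simp: tame_growth_def)
  have ev2: "\<forall>\<^sub>F \<epsilon> in at_right 0. \<epsilon> \<in> {0<..<min 1 (exp (- (2 * C / (t - t'))))}"
    by (rule eventually_at_right_real) simp
  have "\<forall>\<^sub>F \<epsilon> in at_right 0. ereal t' \<le> rate_distortion T d \<mu> \<epsilon> / ereal (ln (1 / \<epsilon>))"
    using ev1 ev2
  proof eventually_elim
    case (elim \<epsilon>)
    define l where "l = ln (1 / \<epsilon>)"
    have \<epsilon>: "0 < \<epsilon>" "\<epsilon> < 1" using elim(2) by auto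
    have l: "0 < l" using \<epsilon> by (simp add: l_def)
    have "ln \<epsilon> < ln (exp (- (2 * C / (t - t'))))"
      using elim(2) by (subst ln_less_cancel_iff) auto
    then have "ln \<epsilon> < - (2 * C / (t - t'))" by simp
    then have Cl: "2 * C / (t - t') < l" using \<epsilon> by (simp add: l_def ln_div)
    have powr: "1 / \<epsilon> powr \<delta> = exp (\<delta> * l)" using \<epsilon> by (simp add: powr_def l_def ln_div exp_minus field_simps)
    have "ln (real (cover_number d \<epsilon>)) \<le> 1 / \<epsilon> powr \<delta>" using elim(1) \<epsilon> by (simp add: field_simps)
    then have "max 1 (ln (real (cover_number d \<epsilon>))) \<le> exp (\<delta> * l)"
      unfolding powr using \<delta> l by simp
    then have "ln (max 1 (ln (real (cover_number d \<epsilon>)))) \<le> \<delta> * l"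
      by (subst ln_exp[of "\<delta> * l", symmetric], subst ln_le_cancel_iff) auto
    then have "t * ln (max 1 (ln (real (cover_number d \<epsilon>)))) \<le> t * (\<delta> * l)" using t by (rule mult_left_mono)
    also have "\<dots> \<le> (t - t') / 2 * l" using mult_right_mono[OF \<delta>(2), of l] l by (simp add: mult_ac)
    finally have "t' * l \<le> t * l - t * ln (max 1 (ln (real (cover_number d \<epsilon>)))) - C"
      using Cl t' by (simp add: field_simps)
    then have "ereal (t' * l) \<le> rate_distortion T d \<mu> \<epsilon>"
      using rate[OF \<epsilon>(1)] unfolding l_def by (meson ereal_less_eq(3) order_trans)
    then show ?case using l unfolding l_def[symmetric] by (simp add: ereal_le_divide_pos mult.commute)
  qed
  then have "ereal t' \<le> lower_rdim T d \<mu>" unfolding lower_rdim_def by (rule Liminf_bounded)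
  then show "y \<le> lower_rdim T d \<mu>" using t' by (meson less_imp_le order_trans)
qed

end

section \<open>Level sets of the potential and the mean Hausdorff dimension\<close>

lemma hausdorff_sum_antimono: "\<epsilon> \<le> \<epsilon>' \<Longrightarrow> hausdorff_sum D \<phi> \<epsilon>' s \<le> hausdorff_sum D \<phi> \<epsilon> s"
  unfolding hausdorff_sum_def by (rule INF_superset_mono) (auto intro: less_le_trans)

lemma hausdorff_dim_antimono: "\<epsilon> \<le> \<epsilon>' \<Longrightarrow> hausdorff_dim D \<phi> \<epsilon>' \<le> hausdorff_dim D \<phi> \<epsilon>"
  unfolding hausdorff_dim_def
  by (rule SUP_subset_mono) (auto intro: order_trans[OF _ hausdorff_sum_antimono])

text \<open>
  The dimension at scale \<open>\<epsilon>\<close> increases as \<open>\<epsilon>\<close> decreases, so the limit defining the mean Hausdorff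
  dimension exists and is a supremum; a strict lower bound is attained at some scale below \<open>1\<close>.
\<close>

lemma less_mdim_H_imp_frequently:
  assumes "ereal s < mdim_H T d \<phi>"
  obtains \<epsilon> where "0 < \<epsilon>" "\<epsilon> < 1"
    "\<exists>\<^sub>F N in sequentially. 1 \<le> N \<and> (\<exists>s'. s * real N < s' \<and> (SUP x. \<phi> N x) \<le> s' \<and>
      1 \<le> hausdorff_sum (orbit_metric T d N) (\<phi> N) \<epsilon> s')"
proof -
  define H where "H \<epsilon> = limsup (\<lambda>N. hausdorff_dim (orbit_metric T d N) (\<phi> N) \<epsilon> / ereal (real N))" for \<epsilon> :: real
  have H_mono: "H \<epsilon>' \<le> H \<epsilon>" if "\<epsilon> \<le> \<epsilon>'" for \<epsilon> \<epsilon>'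
    unfolding H_def
  proof (rule Limsup_mono)
    show "\<forall>\<^sub>F N in sequentially. hausdorff_dim (orbit_metric T d N) (\<phi> N) \<epsilon>' / ereal (real N)
        \<le> hausdorff_dim (orbit_metric T d N) (\<phi> N) \<epsilon> / ereal (real N)"
      using eventually_gt_at_top[of 0]
      by eventually_elim (intro ereal_divide_right_mono hausdorff_dim_antimono that, simp)
  qed
  have "(H \<longlongrightarrow> (SUP \<epsilon>\<in>{0<..}. H \<epsilon>)) (at_right 0)"
  proof (rule order_tendstoI)
    fix a assume "a < (SUP \<epsilon>\<in>{0<..}. H \<epsilon>)"
    then obtain \<epsilon>1 where "0 < \<epsilon>1" "a < H \<epsilon>1" by (auto simp: less_SUP_iff)
    have "\<forall>\<^sub>F \<epsilon> in at_right 0. \<epsilon> \<in> {0<..<\<epsilon>1}" using \<open>0 < \<epsilon>1\<close> by (rule eventually_at_right_real)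
    then show "\<forall>\<^sub>F \<epsilon> in at_right 0. a < H \<epsilon>"
      by eventually_elim (use \<open>a < H \<epsilon>1\<close> H_mono in \<open>auto intro: less_le_trans less_imp_le\<close>)
  next
    fix a assume a: "(SUP \<epsilon>\<in>{0<..}. H \<epsilon>) < a"
    have "\<forall>\<^sub>F \<epsilon> in at_right 0. \<epsilon> \<in> {0<..<1::real}" by (rule eventually_at_right_real) simp
    then show "\<forall>\<^sub>F \<epsilon> in at_right 0. H \<epsilon> < a"
      by eventually_elim (auto intro!: le_less_trans[OF SUP_upper a])
  qed
  then have "mdim_H T d \<phi> = (SUP \<epsilon>\<in>{0<..}. H \<epsilon>)"
    unfolding mdim_H_def H_def[symmetric] by (intro tendsto_Lim) (auto simp: trivial_limit_at_right_real)
  with assms obtain \<epsilon>1 where \<epsilon>1: "0 < \<epsilon>1" "ereal s < H \<epsilon>1" by (auto simp: less_SUP_iff)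
  define \<epsilon> where "\<epsilon> = min \<epsilon>1 (1 / 2)"
  have \<epsilon>: "0 < \<epsilon>" "\<epsilon> < 1" "\<epsilon> \<le> \<epsilon>1" using \<epsilon>1 by (auto simp: \<epsilon>_def)
  have "ereal s < H \<epsilon>" using \<epsilon>1(2) H_mono[OF \<epsilon>(3)] by (rule less_le_trans)
  then have "\<exists>\<^sub>F N in sequentially. ereal s < hausdorff_dim (orbit_metric T d N) (\<phi> N) \<epsilon> / ereal (real N)"
    unfolding H_def using Limsup_bounded[of "\<lambda>N. hausdorff_dim (orbit_metric T d N) (\<phi> N) \<epsilon> / ereal (real N)" "ereal s" sequentially]
    by (auto simp: frequently_def not_less not_le[symmetric])
  moreover have "\<forall>\<^sub>F N in sequentially. 1 \<le> N" by (rule eventually_ge_at_top)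
  ultimately have "\<exists>\<^sub>F N in sequentially. ereal s < hausdorff_dim (orbit_metric T d N) (\<phi> N) \<epsilon> / ereal (real N) \<and> 1 \<le> N"
    by (rule frequently_eventually_frequently)
  then have "\<exists>\<^sub>F N in sequentially. 1 \<le> N \<and> (\<exists>s'. s * real N < s' \<and> (SUP x. \<phi> N x) \<le> s' \<and>
      1 \<le> hausdorff_sum (orbit_metric T d N) (\<phi> N) \<epsilon> s')"
  proof (rule frequently_elim1)
    fix N assume N: "ereal s < hausdorff_dim (orbit_metric T d N) (\<phi> N) \<epsilon> / ereal (real N) \<and> 1 \<le> N"
    then have "ereal (real N) * ereal s < hausdorff_dim (orbit_metric T d N) (\<phi> N) \<epsilon>"
      using ereal_less_divide_pos[of "ereal (real N)" "ereal s"] by simp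
    then show "1 \<le> N \<and> (\<exists>s'. s * real N < s' \<and> (SUP x. \<phi> N x) \<le> s' \<and>
      1 \<le> hausdorff_sum (orbit_metric T d N) (\<phi> N) \<epsilon> s')"
      using N by (auto simp: hausdorff_dim_def less_SUP_iff mult.commute)
  qed
  then show thesis using that \<epsilon> by blast
qed

text \<open>
  If every level set had a cover with sum below \<open>1 / m\<close>, these covers together would be a cover of
  the space with weighted sum below \<open>1\<close>: on \<open>\<Omega> k\<close> the exponent \<open>s - sup\<^sub>E \<phi>\<close> is at least \<open>e k\<close>,
  and diameters are below \<open>1\<close>. Covers are stated with upper bounds \<open>\<rho> b > 0\<close> of the diameters,
  which avoids zero bases of powers; the convention \<open>0\<^sup>0 = 1\<close> in the weighted sum then agrees with
  \<open>\<rho>\<^sup>0 = 1\<close>.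
\<close>

lemma hausdorff_sum_level_set:
  fixes D :: "'a \<Rightarrow> 'a \<Rightarrow> real" and \<phi> :: "'a \<Rightarrow> real"
  assumes D: "\<And>x. D x x = 0" and \<epsilon>: "\<epsilon> < 1" and H: "1 \<le> hausdorff_sum D \<phi> \<epsilon> s"
    and s: "\<And>x. \<phi> x \<le> s" and m: "1 \<le> (m :: nat)" and eps0: "0 < \<epsilon>"
    and u: "\<And>k x. k < m \<Longrightarrow> x \<in> \<Omega> k \<Longrightarrow> \<phi> x \<le> u k" and cover: "(\<Union>k<m. \<Omega> k) = UNIV"
    and e: "\<And>k. k < m \<Longrightarrow> 0 \<le> e k \<and> e k \<le> max 0 (s - u k)"
  shows "\<exists>k<m. \<forall>(B :: ('a \<times> nat) set) E \<rho>. finite B \<longrightarrow> \<Omega> k \<subseteq> (\<Union>b\<in>B. E b) \<longrightarrow>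
    (\<forall>b\<in>B. 0 < \<rho> b \<and> \<rho> b < \<epsilon>) \<longrightarrow> (\<forall>b\<in>B. \<forall>x\<in>E b. \<forall>y\<in>E b. D x y \<le> \<rho> b) \<longrightarrow>
    1 / real m \<le> (\<Sum>b\<in>B. \<rho> b powr e k)"
proof (rule ccontr)
  assume "\<not> ?thesis"
  then have "\<forall>k\<in>{..<m}. \<exists>B :: ('a \<times> nat) set. \<exists>E \<rho>. finite B \<and> \<Omega> k \<subseteq> (\<Union>b\<in>B. E b) \<and>
    (\<forall>b\<in>B. 0 < \<rho> b \<and> \<rho> b < \<epsilon>) \<and> (\<forall>b\<in>B. \<forall>x\<in>E b. \<forall>y\<in>E b. D x y \<le> \<rho> b) \<and>
    (\<Sum>b\<in>B. \<rho> b powr e k) < 1 / real m"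
    by (force simp: not_le)
  then obtain B :: "nat \<Rightarrow> ('a \<times> nat) set" and E \<rho> where BE: "\<forall>k\<in>{..<m}. finite (B k) \<and> \<Omega> k \<subseteq> (\<Union>b\<in>B k. E k b) \<and>
    (\<forall>b\<in>B k. 0 < \<rho> k b \<and> \<rho> k b < \<epsilon>) \<and> (\<forall>b\<in>B k. \<forall>x\<in>E k b. \<forall>y\<in>E k b. D x y \<le> \<rho> k b) \<and>
    (\<Sum>b\<in>B k. \<rho> k b powr e k) < 1 / real m"
    by metis
  define J where "J = Sigma {..<m} B"
  have finJ: "finite J" unfolding J_def using BE by (intro finite_SigmaI) auto
  obtain js where js: "set js = J" "distinct js" using finite_distinct_list[OF finJ] by blast
  define E' where "E' = (\<lambda>(k, b). E k b \<inter> \<Omega> k)"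
  define \<rho>' where "\<rho>' = (\<lambda>(k, b). \<rho> k b)"
  define e' where "e' = (\<lambda>(k :: nat, b :: 'a \<times> nat). e k)"
  have diam: "0 \<le> diam_wrt D (E' j)" "diam_wrt D (E' j) \<le> \<rho>' j" if j: "j \<in> J" for j
  proof -
    have *: "D x y \<le> \<rho>' j" if "x \<in> E' j" "y \<in> E' j" for x y
      using that j BE by (auto simp: J_def E'_def \<rho>'_def)
    have \<rho>0: "0 < \<rho>' j" using j BE by (auto simp: J_def \<rho>'_def)
    show "diam_wrt D (E' j) \<le> \<rho>' j"
      using * \<rho>0 by (auto simp: diam_wrt_def intro!: cSUP_least)
    show "0 \<le> diam_wrt D (E' j)"
    proof (cases "E' j = {}")
      case False
      then obtain x where x: "x \<in> E' j" by auto
      have "D x x \<le> (SUP (x, y)\<in>E' j \<times> E' j. D x y)"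
        by (rule cSUP_upper2[where x = "(x, x)"]) (use x * in \<open>auto intro!: bdd_aboveI2\<close>)
      then show ?thesis using False D by (simp add: diam_wrt_def)
    qed (simp add: diam_wrt_def)
  qed
  have term_le: "hausdorff_term D \<phi> s (E' j) \<le> \<rho>' j powr e' j" if j: "j \<in> J" for j
  proof (cases "E' j = {}")
    case True
    then show ?thesis by (simp add: hausdorff_term_def)
  next
    case False
    obtain k b where kb: "j = (k, b)" "k < m" "b \<in> B k" using j by (auto simp: J_def)
    have \<rho>j: "0 < \<rho>' j" "\<rho>' j < 1" using BE kb \<epsilon> by (fastforce simp: \<rho>'_def)+
    define S where "S = (SUP x\<in>E' j. \<phi> x)"
    have "S \<le> u k" "S \<le> s"
      unfolding S_def using False u[OF kb(2)] s kb by (auto simp: E'_def intro!: cSUP_least)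
    then have eS: "e' j \<le> s - S" and e0: "0 \<le> e' j" using e[OF kb(2)] by (auto simp: e'_def kb(1))
    show ?thesis
    proof (cases "s - S = 0")
      case True
      then have "e' j = 0" using eS e0 by simp
      then show ?thesis using True False \<rho>j by (simp add: hausdorff_term_def S_def)
    next
      case ne: False
      then have "hausdorff_term D \<phi> s (E' j) = diam_wrt D (E' j) powr (s - S)"
        using False by (simp add: hausdorff_term_def S_def)
      also have "\<dots> \<le> \<rho>' j powr (s - S)"
        using diam[OF j] eS e0 by (intro powr_mono2) auto
      also have "\<dots> \<le> \<rho>' j powr e' j" using \<rho>j eS by (intro powr_mono') auto
      finally show ?thesis .
    qed
  qed
  have term0: "0 \<le> hausdorff_term D \<phi> s (E' j)" for j by (simp add: hausdorff_term_def)
  define C where "C i = (if i < length js then E' (js ! i) else {})" for i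
  have "hausdorff_sum D \<phi> \<epsilon> s \<le> (\<Sum>i. ennreal (hausdorff_term D \<phi> s (C i)))"
    unfolding hausdorff_sum_def
  proof (rule INF_lower, safe)
    fix x
    obtain k where k: "k < m" "x \<in> \<Omega> k" using cover by blast
    then obtain b where "b \<in> B k" "x \<in> E k b" using BE by blast
    then have "(k, b) \<in> set js" "x \<in> E' (k, b)" using k js by (auto simp: J_def E'_def)
    then show "x \<in> (\<Union>i. C i)" by (auto simp: C_def in_set_conv_nth)
  next
    fix i
    show "diam_wrt D (C i) < \<epsilon>"
    proof (cases "i < length js")
      case True
      then have j: "js ! i \<in> J" using js by auto
      have "\<rho>' (js ! i) < \<epsilon>" using j BE by (auto simp: J_def \<rho>'_def)
      then show ?thesis using diam(2)[OF j] True by (simp add: C_def)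
    qed (simp add: C_def diam_wrt_def eps0)
  qed simp
  also have "(\<Sum>i. ennreal (hausdorff_term D \<phi> s (C i))) = (\<Sum>i<length js. ennreal (hausdorff_term D \<phi> s (C i)))"
    by (rule suminf_finite) (auto simp: C_def hausdorff_term_def)
  also have "\<dots> = (\<Sum>i<length js. ennreal (hausdorff_term D \<phi> s (E' (js ! i))))"
    by (simp add: C_def)
  also have "\<dots> = (\<Sum>j\<in>J. ennreal (hausdorff_term D \<phi> s (E' j)))"
    using sum.reindex_bij_betw[OF bij_betw_nth[OF js(2) refl refl], of "\<lambda>j. ennreal (hausdorff_term D \<phi> s (E' j))"] js(1)
    by simp
  also have "\<dots> = ennreal (\<Sum>j\<in>J. hausdorff_term D \<phi> s (E' j))" using term0 by (rule sum_ennreal)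
  also have "\<dots> < 1"
  proof -
    have "(\<Sum>j\<in>J. hausdorff_term D \<phi> s (E' j)) \<le> (\<Sum>j\<in>J. \<rho>' j powr e' j)" by (rule sum_mono[OF term_le])
    also have "\<dots> = (\<Sum>k<m. \<Sum>b\<in>B k. \<rho> k b powr e k)"
      unfolding J_def \<rho>'_def e'_def using BE by (subst sum.Sigma) (auto intro!: sum.cong)
    also have "\<dots> < (\<Sum>k<m. 1 / real m)" using BE m by (intro sum_strict_mono) (auto simp: lessThan_empty_iff)
    also have "\<dots> = 1" using m by simp
    finally show ?thesis by simp
  qed
  finally show False using H by simp
qed

section \<open>The variational inequality\<close>

context compact_dynamics
begin

lemma orbit_metric_le_iff:
  "1 \<le> N \<Longrightarrow> orbit_metric T d N x y \<le> \<rho> \<longleftrightarrow> (\<forall>k<N. d ((T ^^ k) x) ((T ^^ k) y) \<le> \<rho>)"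
  unfolding orbit_metric_def by (subst Max_le_iff) (auto simp: lessThan_empty_iff)

lemma le_orbit_metric: "k < N \<Longrightarrow> d ((T ^^ k) x) ((T ^^ k) y) \<le> orbit_metric T d N x y"
  unfolding orbit_metric_def by (rule Max_ge) auto

lemma orbit_metric_pseudometric:
  assumes "1 \<le> N"
  shows "orbit_metric T d N x y = orbit_metric T d N y x" "orbit_metric T d N x x = 0"
    "orbit_metric T d N x z \<le> orbit_metric T d N x y + orbit_metric T d N y z"
proof -
  show "orbit_metric T d N x y = orbit_metric T d N y x" by (simp add: orbit_metric_def d_commute)
  show "orbit_metric T d N x x = 0"
    using assms by (simp add: orbit_metric_def d_refl lessThan_empty_iff image_constant_conv)
  show "orbit_metric T d N x z \<le> orbit_metric T d N x y + orbit_metric T d N y z"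
    unfolding orbit_metric_le_iff[OF assms]
    using d_triangle le_orbit_metric by (meson add_mono order_trans)
qed

lemma finite_orbit_net:
  assumes N: "1 \<le> N" and \<tau>: "0 < \<tau>"
  obtains F where "finite F" "F \<subseteq> \<Omega>" "\<And>x. x \<in> \<Omega> \<Longrightarrow> \<exists>p\<in>F. orbit_metric T d N x p \<le> \<tau>"
proof -
  obtain c :: "'a \<Rightarrow> nat" and r m where c: "\<And>x. c x < m"
    "\<And>x k. k < N \<Longrightarrow> d ((T ^^ k) x) ((T ^^ k) (r (c x))) < \<tau> / 2"
    using orbit_code[of "\<tau> / 2" N] \<tau> by (metis half_gt_zero)
  define pick where "pick u = (SOME x. x \<in> \<Omega> \<and> c x = u)" for u
  have pick: "pick (c x) \<in> \<Omega> \<and> c (pick (c x)) = c x" if "x \<in> \<Omega>" for x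
    unfolding pick_def by (rule someI[of _ x]) (use that in simp)
  show thesis
  proof
    have "c ` \<Omega> \<subseteq> {..<m}" using c(1) by auto
    then show "finite (pick ` c ` \<Omega>)" by (meson finite_imageI finite_lessThan finite_subset)
    show "pick ` c ` \<Omega> \<subseteq> \<Omega>" using pick by auto
    fix x assume x: "x \<in> \<Omega>"
    have "d ((T ^^ k) x) ((T ^^ k) (pick (c x))) \<le> \<tau>" if "k < N" for k
      using c(2)[OF that, of x] c(2)[OF that, of "pick (c x)"] pick[OF x]
        d_triangle[of "(T ^^ k) x" "(T ^^ k) (pick (c x))" "(T ^^ k) (r (c x))"]
        d_commute[of "(T ^^ k) (r (c x))" "(T ^^ k) (pick (c x))"] by simp
    then show "\<exists>p\<in>pick ` c ` \<Omega>. orbit_metric T d N x p \<le> \<tau>"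
      using x by (intro bexI[of _ "pick (c x)"]) (simp_all add: orbit_metric_le_iff[OF N])
  qed
qed

text \<open>
  The levels are spaced by \<open>\<delta>\<close> and there are boundedly many, so some level \<open>lev k\<close> is selected
  for infinitely many \<open>N\<close>. The exponent is \<open>t k N\<close> with \<open>t k = max 0 (s - lev k - \<delta>)\<close>. The maximum
  treats levels above \<open>s - \<delta>\<close> uniformly: there the potential alone is large enough and only
  the nonnegativity of the rate distortion dimension is asked for.
\<close>

lemma ex_measure_near_mdim_H:
  assumes tame: "tame_growth d" and sub: "subadditive_potential T \<phi>"
    and C: "0 < C" "\<And>n x. 1 \<le> n \<Longrightarrow> \<bar>\<phi> n x\<bar> \<le> C * real n"
    and s: "ereal s < mdim_H T d \<phi>" and \<delta>: "0 < \<delta>"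
  shows "\<exists>\<mu>\<in>invariant_measures T. ereal (s - \<delta>) \<le> lower_rdim T d \<mu> + potential_mean \<phi> \<mu>"
proof -
  obtain \<epsilon> where \<epsilon>: "0 < \<epsilon>" "\<epsilon> < 1"
    and freq: "\<exists>\<^sub>F N in sequentially. 1 \<le> N \<and> (\<exists>s'. s * real N < s' \<and> (SUP x. \<phi> N x) \<le> s' \<and>
      1 \<le> hausdorff_sum (orbit_metric T d N) (\<phi> N) \<epsilon> s')"
    using less_mdim_H_imp_frequently[OF s] by blast
  define lev where "lev k = - C + real k * \<delta>" for k :: nat
  define m where "m = nat \<lceil>2 * C / \<delta>\<rceil> + 1"
  define \<Omega> where "\<Omega> N k = {x. lev k * real N \<le> \<phi> N x \<and> \<phi> N x \<le> (lev k + \<delta>) * real N}" for N k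
  define t where "t k = max 0 (s - lev k - \<delta>)" for k
  define content where "content N k \<longleftrightarrow> (\<forall>(B :: ('a \<times> nat) set) E \<rho>. finite B \<longrightarrow> \<Omega> N k \<subseteq> (\<Union>b\<in>B. E b) \<longrightarrow>
    (\<forall>b\<in>B. 0 < \<rho> b \<and> \<rho> b < \<epsilon>) \<longrightarrow> (\<forall>b\<in>B. \<forall>x\<in>E b. \<forall>y\<in>E b. orbit_metric T d N x y \<le> \<rho> b) \<longrightarrow>
    1 / real m \<le> (\<Sum>b\<in>B. \<rho> b powr (t k * real N)))" for N k
  have "\<exists>\<^sub>F N in sequentially. \<exists>k\<in>{..<m}. 1 \<le> N \<and> content N k"
    using freq
  proof (rule frequently_elim1)
    fix N assume *: "1 \<le> N \<and> (\<exists>s'. s * real N < s' \<and> (SUP x. \<phi> N x) \<le> s' \<and>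
      1 \<le> hausdorff_sum (orbit_metric T d N) (\<phi> N) \<epsilon> s')"
    then obtain s' where N: "1 \<le> N" and s': "s * real N < s'" "(SUP x. \<phi> N x) \<le> s'"
      "1 \<le> hausdorff_sum (orbit_metric T d N) (\<phi> N) \<epsilon> s'" by blast
    have bdd: "bdd_above (range (\<phi> N))" using C(2)[OF N] by (intro bdd_aboveI2[of _ _ "C * real N"]) (metis abs_le_D1)
    have "\<exists>k<m. \<forall>(B :: ('a \<times> nat) set) E \<rho>. finite B \<longrightarrow> \<Omega> N k \<subseteq> (\<Union>b\<in>B. E b) \<longrightarrow>
      (\<forall>b\<in>B. 0 < \<rho> b \<and> \<rho> b < \<epsilon>) \<longrightarrow> (\<forall>b\<in>B. \<forall>x\<in>E b. \<forall>y\<in>E b. orbit_metric T d N x y \<le> \<rho> b) \<longrightarrow>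
      1 / real m \<le> (\<Sum>b\<in>B. \<rho> b powr (t k * real N))"
    proof (rule hausdorff_sum_level_set[where u = "\<lambda>k. (lev k + \<delta>) * real N" and s = s' and \<phi> = "\<phi> N"])
      show "orbit_metric T d N x x = 0" for x by (rule orbit_metric_pseudometric(2)[OF N])
      show "\<phi> N x \<le> s'" for x using cSUP_upper[OF UNIV_I bdd, of x] s'(2) by linarith
      show "\<phi> N x \<le> (lev k + \<delta>) * real N" if "x \<in> \<Omega> N k" for k x using that by (simp add: \<Omega>_def)
      show "(\<Union>k<m. \<Omega> N k) = UNIV"
      proof (intro equalityI subsetI UNIV_I)
        fix x
        define v where "v = \<phi> N x / real N"
        have phi: "\<phi> N x = v * real N" using N by (simp add: v_def)
        have v: "- C \<le> v" "v \<le> C" using C(2)[OF N, of x] N by (auto simp: v_def field_simps abs_le_iff)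
        define k where "k = nat \<lfloor>(v + C) / \<delta>\<rfloor>"
        have k: "real k \<le> (v + C) / \<delta>" "(v + C) / \<delta> < real k + 1"
          using v \<delta> by (simp_all add: k_def)
        have "lev k \<le> v" "v \<le> lev k + \<delta>" using k \<delta> by (auto simp: lev_def field_simps)
        then have "x \<in> \<Omega> N k" using N by (auto simp: \<Omega>_def phi intro!: mult_right_mono)
        moreover have "k < m"
        proof -
          have "(v + C) / \<delta> \<le> 2 * C / \<delta>" using v \<delta> by (intro divide_right_mono) auto
          then have "real k \<le> 2 * C / \<delta>" using k by linarith
          then show ?thesis unfolding m_def by linarith
        qed
        ultimately show "x \<in> (\<Union>k<m. \<Omega> N k)" by blast
      qed
      show "0 \<le> t k * real N \<and> t k * real N \<le> max 0 (s' - (lev k + \<delta>) * real N)" for k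
        using s'(1) by (auto simp: t_def max_def algebra_simps)
    qed (use \<epsilon> s' in \<open>auto simp: m_def\<close>)
    then show "\<exists>k\<in>{..<m}. 1 \<le> N \<and> content N k" using N by (auto simp: content_def)
  qed
  from frequently_bex_finite[OF finite_lessThan this]
  obtain k where k: "\<exists>\<^sub>F N in sequentially. 1 \<le> N \<and> content N k" by blast
  define S where "S = {N. 1 \<le> N \<and> content N k}"
  have S: "infinite S" using k by (simp add: S_def frequently_cofinite flip: cofinite_eq_sequentially)
  define N where "N = enumerate S"
  have N_mono: "strict_mono N" unfolding N_def by (rule strict_mono_enumerate[OF S])
  have N_lim: "filterlim N at_top sequentially" by (rule filterlim_subseq[OF N_mono])
  have N1: "1 \<le> N i" and cont: "content (N i) k" for i
    using enumerate_in_set[OF S, of i] by (auto simp: N_def S_def)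
  \<comment> \<open>any scale tending to \<open>0\<close> would do\<close>
  define \<tau> where "\<tau> i = min (\<epsilon> / 16) (1 / real (Suc i))" for i
  have \<tau>: "0 < \<tau> i" "\<tau> i \<le> \<epsilon> / 16" for i using \<epsilon> by (auto simp: \<tau>_def)
  have "\<tau> \<longlonglongrightarrow> 0"
    by (rule tendsto_sandwich[OF _ _ tendsto_const LIMSEQ_Suc[OF lim_const_over_n[of 1]]])
      (use \<tau>(1) in \<open>auto simp: \<tau>_def less_imp_le\<close>)
  define frostman where "frostman i F \<nu> \<longleftrightarrow> finite F \<and> F \<subseteq> \<Omega> (N i) k \<and> (\<forall>x. 0 \<le> \<nu> x) \<and> sum \<nu> F = 1 \<and>
    (\<forall>E \<rho>. \<tau> i \<le> \<rho> \<longrightarrow> (\<forall>x\<in>E. \<forall>y\<in>E. orbit_metric T d (N i) x y \<le> \<rho>) \<longrightarrow>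
      sum \<nu> (F \<inter> E) \<le> (32 / \<epsilon>) powr (t k * real (N i)) * \<rho> powr (t k * real (N i)) / (1 / real m))"
    for i F and \<nu> :: "'a \<Rightarrow> real"
  have "\<exists>F \<nu>. frostman i F \<nu>" for i
  proof -
    obtain F where F: "finite F" "F \<subseteq> \<Omega> (N i) k"
      "\<And>x. x \<in> \<Omega> (N i) k \<Longrightarrow> \<exists>p\<in>F. orbit_metric T d (N i) x p \<le> \<tau> i"
      using finite_orbit_net[OF N1 \<tau>(1)] by metis
    have "\<exists>\<nu>. (\<forall>x. 0 \<le> \<nu> x) \<and> sum \<nu> F = 1 \<and>
      (\<forall>E \<rho>. \<tau> i \<le> \<rho> \<longrightarrow> (\<forall>x\<in>E. \<forall>y\<in>E. orbit_metric T d (N i) x y \<le> \<rho>) \<longrightarrow>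
        sum \<nu> (F \<inter> E) \<le> (32 / \<epsilon>) powr (t k * real (N i)) * \<rho> powr (t k * real (N i)) / (1 / real m))"
    proof (rule finite_Frostman[OF orbit_metric_pseudometric[OF N1] F(1,3) \<tau> \<epsilon>(2)])
      show "0 \<le> t k * real (N i)" by (simp add: t_def)
      show "0 < 1 / real m" "1 / real m \<le> 1" by (simp_all add: m_def)
      fix B :: "('a \<times> nat) set" and E \<rho>
      assume "finite B" "\<Omega> (N i) k \<subseteq> (\<Union>b\<in>B. E b)" "\<And>b. b \<in> B \<Longrightarrow> 0 < \<rho> b \<and> \<rho> b < \<epsilon>"
        "\<And>b x y. b \<in> B \<Longrightarrow> x \<in> E b \<Longrightarrow> y \<in> E b \<Longrightarrow> orbit_metric T d (N i) x y \<le> \<rho> b"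
      then show "1 / real m \<le> (\<Sum>b\<in>B. \<rho> b powr (t k * real (N i)))"
        using cont[of i] unfolding content_def by blast
    qed
    then show ?thesis unfolding frostman_def using F(1,2) by blast
  qed
  then obtain F \<nu> where frostman: "\<And>i. frostman i (F i) (\<nu> i)" by metis
  then have F: "\<And>i. finite (F i)" "\<And>i. F i \<subseteq> \<Omega> (N i) k"
    and \<nu>: "\<And>i x. 0 \<le> \<nu> i x" "\<And>i. sum (\<nu> i) (F i) = 1"
    and frost: "\<And>i E \<rho>. \<tau> i \<le> \<rho> \<Longrightarrow> (\<forall>x\<in>E. \<forall>y\<in>E. orbit_metric T d (N i) x y \<le> \<rho>) \<Longrightarrow>
      sum (\<nu> i) (F i \<inter> E) \<le> (32 / \<epsilon>) powr (t k * real (N i)) * \<rho> powr (t k * real (N i)) / (1 / real m)"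
    unfolding frostman_def by blast+
  obtain r \<mu> where r: "strict_mono (r :: nat \<Rightarrow> nat)" and \<mu>: "\<mu> \<in> invariant_measures T"
    and lim: "\<And>f. continuous_on UNIV f \<Longrightarrow>
      (\<lambda>i. Birkhoff_average (N (r i)) (F (r i)) (\<nu> (r i)) f) \<longlonglongrightarrow> (\<integral>x. f x \<partial>\<mu>)"
    by (rule invariant_weak_limit[OF N_mono N1 F(1) \<nu>]) (rule that)
  have r_lim: "filterlim r at_top sequentially" by (rule filterlim_subseq[OF r])
  note Nr_lim = filterlim_compose[OF N_lim r_lim]
  have "ereal (lev k) \<le> potential_mean \<phi> \<mu>"
  proof (rule potential_mean_ge[OF sub C(2) \<mu> Nr_lim, of "\<lambda>i. \<nu> (r i)" "\<lambda>i. F (r i)"])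
    show "lev k * real (N (r i)) \<le> \<phi> (N (r i)) x" if "x \<in> F (r i)" for i x
      using F(2)[of "r i"] that by (auto simp: \<Omega>_def)
  qed (use \<nu> lim in auto)
  moreover have "ereal (t k) \<le> lower_rdim T d \<mu>"
  proof (rule lower_rdim_ge[OF tame, where C = "t k * ln (2 * (32 / \<epsilon>)) + ln 2 + 4"])
    show "0 \<le> t k" by (simp add: t_def)
    fix \<eta> :: real assume "0 < \<eta>"
    show "ereal (t k * ln (1 / \<eta>) - t k * ln (max 1 (ln (real (cover_number d \<eta>)))) - (t k * ln (2 * (32 / \<epsilon>)) + ln 2 + 4))
      \<le> rate_distortion T d \<mu> \<eta>"
    proof (rule rate_distortion_ge[OF \<mu> \<open>0 < \<eta>\<close> Nr_lim, of "\<lambda>i. F (r i)" "\<lambda>i. \<nu> (r i)" _ _ "1 / real m" "\<lambda>i. \<tau> (r i)"])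
      show "(\<lambda>i. \<tau> (r i)) \<longlonglongrightarrow> 0" using filterlim_compose[OF \<open>\<tau> \<longlonglongrightarrow> 0\<close> r_lim] .
      fix i E \<rho> assume \<rho>: "\<tau> (r i) \<le> \<rho>"
        and E: "\<And>x y k. x \<in> E \<Longrightarrow> y \<in> E \<Longrightarrow> k < N (r i) \<Longrightarrow> d ((T ^^ k) x) ((T ^^ k) y) \<le> \<rho>"
      have "sum (\<nu> (r i)) (F (r i) \<inter> E)
          \<le> (32 / \<epsilon>) powr (t k * real (N (r i))) * \<rho> powr (t k * real (N (r i))) / (1 / real m)"
        by (rule frost[OF \<rho>]) (simp add: orbit_metric_le_iff[OF N1] E)
      also have "(32 / \<epsilon>) powr (t k * real (N (r i))) * \<rho> powr (t k * real (N (r i))) = (32 / \<epsilon> * \<rho>) powr (t k * real (N (r i)))"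
        using \<epsilon> \<rho> \<tau>(1)[of "r i"] by (subst powr_mult) auto
      finally show "sum (\<nu> (r i)) (F (r i) \<inter> E) \<le> (32 / \<epsilon> * \<rho>) powr (t k * real (N (r i))) / (1 / real m)" .
    qed (use F \<nu> lim \<epsilon> in \<open>auto simp: t_def m_def\<close>)
  qed
  ultimately have "ereal (t k) + ereal (lev k) \<le> lower_rdim T d \<mu> + potential_mean \<phi> \<mu>"
    by (intro add_mono)
  moreover have "s - \<delta> \<le> t k + lev k" by (simp add: t_def)
  ultimately have "ereal (s - \<delta>) \<le> lower_rdim T d \<mu> + potential_mean \<phi> \<mu>"
    by (metis ereal_less_eq(3) order_trans plus_ereal.simps(1))
  then show ?thesis using \<mu> by blast
qed

end

theorem theorem1p4:
  fixes T :: "'a::metric_space \<Rightarrow> 'a"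
    and d :: "'a \<Rightarrow> 'a \<Rightarrow> real"
    and \<phi> :: "nat \<Rightarrow> 'a \<Rightarrow> real"
  assumes "dynamical_system T"
    and "d \<in> compatible_metrics"
    and "tame_growth d"
    and "subadditive_potential T \<phi>"
    and "\<And>d' :: 'a \<Rightarrow> 'a \<Rightarrow> real. d' \<in> compatible_metrics \<Longrightarrow> upper_mdim_M T d' < \<infinity>"
    and "\<exists>K>0. \<forall>n\<ge>1. \<forall>x. \<bar>\<phi> (n + 1) x - \<phi> n x\<bar> < K"
  shows "mdim_H T d \<phi> \<le> (SUP \<mu>\<in>invariant_measures T. lower_rdim T d \<mu> + potential_mean \<phi> \<mu>)"
proof -
  interpret compact_dynamics T d
    using assms(1,2) by unfold_locales (auto simp: dynamical_system_def homeomorphism_def)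
  obtain K where K: "0 < K" "\<And>n x. 1 \<le> n \<Longrightarrow> \<bar>\<phi> (n + 1) x - \<phi> n x\<bar> < K" using assms(6) by blast
  have "continuous_on UNIV (\<phi> 1)" using assms(4) by (simp add: subadditive_potential_def)
  then obtain B where B: "0 \<le> B" "\<And>x. \<bar>\<phi> 1 x\<bar> \<le> B" using continuous_bounded by blast
  have bound: "\<bar>\<phi> n x\<bar> \<le> (B + K) * real n" if "1 \<le> n" for n x
    using that
  proof (induction n rule: dec_induct)
    case base
    then show ?case using B(2)[of x] K(1) by simp
  next
    case (step n)
    then show ?case using K(2)[of n x] B(1) by (simp add: algebra_simps)
  qed
  show ?thesis
  proof (rule dense_le)
    fix y assume "y < mdim_H T d \<phi>"
    then obtain s where s: "y < ereal s" "ereal s < mdim_H T d \<phi>" using ereal_dense2 by blast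
    then obtain s' where s': "y < ereal s'" "s' < s" using ereal_dense2[of y "ereal s"] by auto
    obtain \<mu> where "\<mu> \<in> invariant_measures T" "ereal (s - (s - s')) \<le> lower_rdim T d \<mu> + potential_mean \<phi> \<mu>"
      using ex_measure_near_mdim_H[OF assms(3,4) _ bound s(2), of "s - s'"] B K s' by auto
    then show "y \<le> (SUP \<mu>\<in>invariant_measures T. lower_rdim T d \<mu> + potential_mean \<phi> \<mu>)"
      using s'(1) by (intro SUP_upper2[of \<mu>]) auto
  qed
qed

end
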